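(* Let $\theta\in\Theta$ (i.e. $\rho(A_0)<1$), and assume that the noise $(\xi_n)_{n\ge1}$ satisfies: $r(n)=O(n^{-\alpha_1})$ as $n\to\infty$ for some $\alpha_1>0$; $\int_{-\pi}^{\pi}|\log f_\xi(\lambda)|\,d\lambda<\infty$; and $\beta_n^2=O(n^{-\alpha_2})$ for some $\alpha_2>1$. Let $I(\theta)$ be the unique solution of $I(\theta)=A_0I(\theta)A_0^*+bb^*$. Then, when the true parameter is $\theta$, for all $v\in\mathbb{R}^p$, $$\limsup_{n\to\infty}\Big(\frac{n}{2\log\log n}\Big)^{1/2}v^*(\widehat\theta_n-\theta)=-\liminf_{n\to\infty}\Big(\frac{n}{2\log\log n}\Big)^{1/2}v^*(\widehat\theta_n-\theta)=\big(v^*I(\theta)^{-1}v\big)^{1/2}\quad\text{a.s.}$$ Consequently, $\|\widehat\theta_n-\theta\|^2=O\big(\frac{\log\log n}{n}\big)$ a.s.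
   Context: Fix an integer $p\ge1$. $A^*$ is the transpose of $A$, $\|\cdot\|$ the Euclidean norm, $Id_p$ the $p\times p$ identity matrix, $\rho(\cdot)$ the spectral radius, $b=(1,0,\dots,0)^*\in\mathbb{R}^p$. Noise: $(\xi_n)_{n\ge1}$ is a real stationary centered Gaussian process with covariance function $r(n)=\mathbb{E}(\xi_1\xi_{1+n})$, $r(0)=1$, and spectral density $f_\xi$. Let $\sigma_1\varepsilon_1=\xi_1$, $\sigma_1=1$, and for $n\ge2$, $\sigma_n\varepsilon_n=\xi_n-\mathbb{E}(\xi_n\mid\xi_1,\dots,\xi_{n-1})$, where $\sigma_n>0$ and the $\varepsilon_n$ are i.i.d. $\mathcal N(0,1)$. Write $\sigma_n\varepsilon_n=\sum_{i=1}^n k(n,i)\xi_i$ with deterministic $k(n,i)$, $k(n,n)=1$. For $n\ge1$, $\beta_n=-k(n+1,1)$ (the partial autocorrelation function, PACF, of $(\xi_n)$); by convention $\beta_0=1$ (it plays no role below since $\zeta_0=0$). One has $\sigma_n^2=\prod_{i=1}^{n-1}(1-\beta_i^2)$. Model: $X_n=\sum_{i=1}^p\theta_iX_{n-i}+\xi_n$ for $n\ge1$, with $X_n=0$ for $n\le0$ and $\theta=(\theta_1,\dots,\theta_p)^*\in\mathbb{R}^p$. $A_0$ is the $p\times p$ companion matrix with first row $(\theta_1,\dots,\theta_p)$, ones on the subdiagonal and zeros elsewhere. $\Theta=\{\theta\in\mathbb{R}^p:\rho(A_0)<1\}$. Let $Y_n=(X_n,\dots,X_{n-p+1})^*$, $Z_n=\sum_{i=1}^nk(n,i)Y_i$,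 and $\zeta_n=\begin{pmatrix}Z_n\\ \sum_{k=1}^{n-1}\beta_kZ_k\end{pmatrix}\in\mathbb{R}^{2p}$ for $n\ge1$, $\zeta_0=0$. Then $\zeta_n=\widetilde A_{n-1}\zeta_{n-1}+\ell\sigma_n\varepsilon_n$ with $\widetilde A_n=\begin{pmatrix}A_0&\beta_nA_0\\ \beta_nId_p&Id_p\end{pmatrix}$ and $\ell=(1,0,\dots,0)^*\in\mathbb{R}^{2p}$. MLE: with $a_n=(Id_p,\beta_nId_p)^*$ (a $2p\times p$ matrix), $$\widehat\theta_n=\Big(\sum_{i=1}^n\frac{a_{i-1}^*\zeta_{i-1}\zeta_{i-1}^*a_{i-1}}{\sigma_i^2}\Big)^{-1}\Big(\sum_{i=1}^n\frac{a_{i-1}^*\zeta_{i-1}\,\ell^*\zeta_i}{\sigma_i^2}\Big)$$ (defined when the matrix is invertible). *)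

theory Defs
  imports
    "HOL-Probability.Probability"
    "HOL-Library.Landau_Symbols"
    "Jordan_Normal_Form.Spectral_Radius"
    "Jordan_Normal_Form.Gauss_Jordan_Elimination"
begin

no_notation inner (infix "\<bullet>" 70)
no_notation vec_nth (infixl "$" 90)

text \<open>
  Vectors and matrices are those of Jordan_Normal_Form, so that the order \<open>p\<close> of the
  autoregression is a natural number. Their components are counted from 0:
  \<open>\<theta>\<^sub>i\<close> is \<open>\<theta> $ (i - 1)\<close>. Sequences indexed by \<open>n \<ge> 1\<close> are functions on
  \<^typ>\<open>nat\<close> whose value at 0 is irrelevant.
\<close>

section \<open>The noise\<close>

text \<open>Degenerate (almost surely constant) variables count as Gaussian.\<close>

definition gaussian_rv :: "'a measure \<Rightarrow> ('a \<Rightarrow> real) \<Rightarrow> bool" where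
  "gaussian_rv M X \<longleftrightarrow> X \<in> borel_measurable M \<and>
     ((\<exists>\<mu> s. 0 < s \<and> distributed M lborel X (normal_density \<mu> s)) \<or>
      (\<exists>c. AE \<omega> in M. X \<omega> = c))"

definition gaussian_process :: "'a measure \<Rightarrow> (nat \<Rightarrow> 'a \<Rightarrow> real) \<Rightarrow> bool" where
  "gaussian_process M \<xi> \<longleftrightarrow>
     (\<forall>n\<ge>1. \<xi> n \<in> borel_measurable M) \<and>
     (\<forall>N c. gaussian_rv M (\<lambda>\<omega>. \<Sum>i=1..N. c i * \<xi> i \<omega>))"

definition centered_process :: "'a measure \<Rightarrow> (nat \<Rightarrow> 'a \<Rightarrow> real) \<Rightarrow> bool" where
  "centered_process M \<xi> \<longleftrightarrow>
     (\<forall>n\<ge>1. integrable M (\<xi> n) \<and> integral\<^sup>L M (\<xi> n) = 0)"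

text \<open>Strict stationarity: the law of the whole sequence is invariant under time shifts.\<close>

definition stationary_process :: "'a measure \<Rightarrow> (nat \<Rightarrow> 'a \<Rightarrow> real) \<Rightarrow> bool" where
  "stationary_process M \<xi> \<longleftrightarrow>
     (\<forall>h. distr M (PiM UNIV (\<lambda>_. borel)) (\<lambda>\<omega> n. \<xi> (n + 1 + h) \<omega>) =
          distr M (PiM UNIV (\<lambda>_. borel)) (\<lambda>\<omega> n. \<xi> (n + 1) \<omega>))"

definition autocov :: "'a measure \<Rightarrow> (nat \<Rightarrow> 'a \<Rightarrow> real) \<Rightarrow> nat \<Rightarrow> real" where
  "autocov M \<xi> n = (LINT \<omega>|M. \<xi> 1 \<omega> * \<xi> (1 + n) \<omega>)"

text \<open>
  Normalised by \<open>r(n) = \<integral> exp(i n \<lambda>) f(\<lambda>) d\<lambda>\<close> over \<open>[-\<pi>, \<pi>]\<close>; a factor \<open>1/(2\<pi>)\<close> would not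
  affect the integrability of \<open>log f\<close>.
\<close>

definition spectral_density :: "(nat \<Rightarrow> real) \<Rightarrow> (real \<Rightarrow> real) \<Rightarrow> bool" where
  "spectral_density r f \<longleftrightarrow>
     (\<forall>x\<in>{-pi..pi}. 0 \<le> f x) \<and>
     set_integrable lborel {-pi..pi} f \<and>
     (\<forall>n. complex_of_real (r n) =
        (LINT x:{-pi..pi}|lborel. exp (\<i> * of_nat n * of_real x) * of_real (f x)))"

text \<open>Since \<open>ln 0 = 0\<close> in HOL, the value \<open>\<bar>log 0\<bar> = \<infinity>\<close> is put in by hand.\<close>

definition abs_log :: "real \<Rightarrow> ennreal" where
  "abs_log y = (if y = 0 then \<infinity> else ennreal \<bar>ln y\<bar>)"

definition past_algebra :: "'a measure \<Rightarrow> (nat \<Rightarrow> 'a \<Rightarrow> real) \<Rightarrow> nat \<Rightarrow> 'a measure" where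
  "past_algebra M \<xi> n =
     sigma (space M) {\<xi> i -` B \<inter> space M | i B. 1 \<le> i \<and> i < n \<and> B \<in> sets borel}"

definition innovations ::
    "'a measure \<Rightarrow> (nat \<Rightarrow> 'a \<Rightarrow> real) \<Rightarrow> (nat \<Rightarrow> real) \<Rightarrow> (nat \<Rightarrow> 'a \<Rightarrow> real) \<Rightarrow> bool" where
  "innovations M \<xi> \<sigma> \<epsilon> \<longleftrightarrow>
     \<sigma> 1 = 1 \<and> (AE \<omega> in M. \<sigma> 1 * \<epsilon> 1 \<omega> = \<xi> 1 \<omega>) \<and>
     (\<forall>n\<ge>2. AE \<omega> in M.
        \<sigma> n * \<epsilon> n \<omega> = \<xi> n \<omega> - real_cond_exp M (past_algebra M \<xi> n) (\<xi> n) \<omega>) \<and>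
     (\<forall>n\<ge>1. 0 < \<sigma> n) \<and>
     prob_space.indep_vars M (\<lambda>_. borel) \<epsilon> {1..} \<and>
     (\<forall>n\<ge>1. distributed M lborel (\<epsilon> n) std_normal_density)"

definition innovation_coeffs ::
    "'a measure \<Rightarrow> (nat \<Rightarrow> 'a \<Rightarrow> real) \<Rightarrow> (nat \<Rightarrow> real) \<Rightarrow> (nat \<Rightarrow> 'a \<Rightarrow> real) \<Rightarrow>
      (nat \<Rightarrow> nat \<Rightarrow> real) \<Rightarrow> bool" where
  "innovation_coeffs M \<xi> \<sigma> \<epsilon> k \<longleftrightarrow>
     (\<forall>n\<ge>1. k n n = 1 \<and> (AE \<omega> in M. \<sigma> n * \<epsilon> n \<omega> = (\<Sum>i=1..n. k n i * \<xi> i \<omega>)))"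

definition pacf :: "(nat \<Rightarrow> nat \<Rightarrow> real) \<Rightarrow> nat \<Rightarrow> real" where
  "pacf k n = (if n = 0 then 1 else - k (n + 1) 1)"

section \<open>The autoregressive model\<close>

definition companion :: "real Matrix.vec \<Rightarrow> real Matrix.mat" where
  "companion \<theta> = Matrix.mat (dim_vec \<theta>) (dim_vec \<theta>)
     (\<lambda>(i, j). if i = 0 then \<theta> $ j else if i = j + 1 then 1 else 0)"

definition stable_params :: "nat \<Rightarrow> real Matrix.vec set" where
  "stable_params p =
     {\<theta> \<in> carrier_vec p. spectral_radius (map_mat complex_of_real (companion \<theta>)) < 1}"

definition ar_model ::
    "'a measure \<Rightarrow> (nat \<Rightarrow> 'a \<Rightarrow> real) \<Rightarrow> real Matrix.vec \<Rightarrow> (int \<Rightarrow> 'a \<Rightarrow> real) \<Rightarrow> bool" where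
  "ar_model M \<xi> \<theta> X \<longleftrightarrow> (\<forall>\<omega>\<in>space M.
     (\<forall>n\<le>0. X n \<omega> = 0) \<and>
     (\<forall>n\<ge>1. X n \<omega> = (\<Sum>i=1..dim_vec \<theta>. \<theta> $ (i - 1) * X (n - int i) \<omega>) + \<xi> (nat n) \<omega>))"

text \<open>
  From here on \<open>x\<close> is an observed trajectory \<open>n \<mapsto> X\<^sub>n(\<omega>)\<close>, so that the estimator
  below is visibly a function of the observations and not of the unknown parameter.
\<close>

definition Y_vec :: "nat \<Rightarrow> (int \<Rightarrow> real) \<Rightarrow> nat \<Rightarrow> real Matrix.vec" where
  "Y_vec p x n = Matrix.vec p (\<lambda>j. x (int n - int j))"

definition Z_vec ::
    "nat \<Rightarrow> (nat \<Rightarrow> nat \<Rightarrow> real) \<Rightarrow> (int \<Rightarrow> real) \<Rightarrow> nat \<Rightarrow> real Matrix.vec" where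
  "Z_vec p k x n = Matrix.vec p (\<lambda>j. \<Sum>i=1..n. k n i * Y_vec p x i $ j)"

definition zeta ::
    "nat \<Rightarrow> (nat \<Rightarrow> nat \<Rightarrow> real) \<Rightarrow> (int \<Rightarrow> real) \<Rightarrow> nat \<Rightarrow> real Matrix.vec" where
  "zeta p k x n =
     (if n = 0 then 0\<^sub>v (2 * p)
      else Z_vec p k x n @\<^sub>v
        Matrix.vec p (\<lambda>j. \<Sum>m=1..<n. pacf k m * Z_vec p k x m $ j))"

section \<open>The maximum likelihood estimator\<close>

text \<open>\<open>A @\<^sub>r B\<close> stacks \<open>A\<close> on top of \<open>B\<close>, so this is the \<open>2p \<times> p\<close> matrix \<open>(Id, \<beta>\<^sub>n Id)\<^sup>*\<close>.\<close>

definition a_mat :: "nat \<Rightarrow> (nat \<Rightarrow> nat \<Rightarrow> real) \<Rightarrow> nat \<Rightarrow> real Matrix.mat" where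
  "a_mat p k n = 1\<^sub>m p @\<^sub>r (pacf k n \<cdot>\<^sub>m 1\<^sub>m p)"

definition regressor ::
    "nat \<Rightarrow> (nat \<Rightarrow> nat \<Rightarrow> real) \<Rightarrow> (int \<Rightarrow> real) \<Rightarrow> nat \<Rightarrow> real Matrix.vec" where
  "regressor p k x n = transpose_mat (a_mat p k n) *\<^sub>v zeta p k x n"

text \<open>
  With \<open>w\<^sub>n = a\<^sub>n\<^sup>* \<zeta>\<^sub>n\<close> the regressor, the matrix to be inverted is
  \<open>\<Sum> w\<^sub>i\<^sub>-\<^sub>1 w\<^sub>i\<^sub>-\<^sub>1\<^sup>* / \<sigma>\<^sub>i\<^sup>2\<close>; sums of matrices and of vectors are taken entrywise.
\<close>

definition normal_matrix ::
    "nat \<Rightarrow> (nat \<Rightarrow> nat \<Rightarrow> real) \<Rightarrow> (nat \<Rightarrow> real) \<Rightarrow> (int \<Rightarrow> real) \<Rightarrow> nat \<Rightarrow> real Matrix.mat" where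
  "normal_matrix p k \<sigma> x n = Matrix.mat p p
     (\<lambda>(s, t). \<Sum>i=1..n. regressor p k x (i - 1) $ s * regressor p k x (i - 1) $ t / (\<sigma> i)\<^sup>2)"

definition normal_vector ::
    "nat \<Rightarrow> (nat \<Rightarrow> nat \<Rightarrow> real) \<Rightarrow> (nat \<Rightarrow> real) \<Rightarrow> (int \<Rightarrow> real) \<Rightarrow> nat \<Rightarrow> real Matrix.vec" where
  "normal_vector p k \<sigma> x n = Matrix.vec p
     (\<lambda>s. \<Sum>i=1..n. regressor p k x (i - 1) $ s *
            (unit_vec (2 * p) 0 \<bullet> zeta p k x i) / (\<sigma> i)\<^sup>2)"

text \<open>Unspecified if the matrix is not invertible.\<close>

definition mat_inv :: "real Matrix.mat \<Rightarrow> real Matrix.mat" where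
  "mat_inv A = the (mat_inverse A)"

definition mle ::
    "nat \<Rightarrow> (nat \<Rightarrow> nat \<Rightarrow> real) \<Rightarrow> (nat \<Rightarrow> real) \<Rightarrow> (int \<Rightarrow> real) \<Rightarrow> nat \<Rightarrow> real Matrix.vec" where
  "mle p k \<sigma> x n = mat_inv (normal_matrix p k \<sigma> x n) *\<^sub>v normal_vector p k \<sigma> x n"

text \<open>The single 1 in the second summand is the matrix \<open>b b\<^sup>*\<close>.\<close>

definition asymptotic_info :: "real Matrix.vec \<Rightarrow> real Matrix.mat" where
  "asymptotic_info \<theta> = (THE J. J \<in> carrier_mat (dim_vec \<theta>) (dim_vec \<theta>) \<and>
     J = companion \<theta> * J * transpose_mat (companion \<theta>) +
         Matrix.mat (dim_vec \<theta>) (dim_vec \<theta>) (\<lambda>(i, j). if i = 0 \<and> j = 0 then 1 else 0))"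

definition vec_euclid_norm :: "real Matrix.vec \<Rightarrow> real" where
  "vec_euclid_norm v = sqrt (v \<bullet> v)"

end

theory Submission
  imports Defs "HOL-Real_Asymp.Real_Asymp"
begin

text \<open>
  The Levinson-Durbin recursion turns \<open>Z\<^sub>n\<close> into \<open>Z\<^sub>n = A\<^sub>0 w\<^sub>n\<^sub>-\<^sub>1 + b \<sigma>\<^sub>n \<epsilon>\<^sub>n\<close>, where \<open>w\<^sub>n\<close> is the regressor, so the error of
  the estimator is \<open>\<langle>M\<rangle>\<^sub>n\<^sup>-\<^sup>1 M\<^sub>n\<close> for the martingale \<open>M\<^sub>n = \<Sum> w\<^sub>i\<^sub>-\<^sub>1 \<epsilon>\<^sub>i / \<sigma>\<^sub>i\<close>. As \<open>\<Sum> \<beta>\<^sub>n\<^sup>2 < \<infinity>\<close>, a discrete Gronwall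
  argument on each path shows that \<open>w\<^sub>i\<^sub>-\<^sub>1 / \<sigma>\<^sub>i\<close> differs from the autoregression \<open>\<Sum>\<^sub>j A\<^sub>0\<^sup>j b \<epsilon>\<^sub>i\<^sub>-\<^sub>1\<^sub>-\<^sub>j\<close> by a sequence that
  is negligible in quadratic mean, which gives \<open>\<langle>M\<rangle>\<^sub>n / n \<rightarrow> I(\<theta>)\<close>. Since the increments of \<open>M\<close> are
  conditionally Gaussian, exponential martingales yield the upper half of the law of the iterated logarithm
  and show that negligible integrands do not matter. What remains is a quadratic form in independent
  Gaussian variables with short memory; its lower half follows from the central limit theorem on long
  independent blocks and the second Borel-Cantelli lemma.
\<close>

section \<open>Noise adapted to its past and the exponential maximal inequality\<close>

text \<open>Two obstacles shape the proof. The integrands of M are random, so its increments are not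
  independent. The upper half copes with this, since it needs only the compensator of M on each
  path; the lower half does not. Hence M is compared with a form whose integrand is a fixed filter
  of the noise, and the upper half with limiting variance 0 disposes of the difference. Second, the
  central limit theorem says nothing about probabilities as small as 1/k. It is used at a fixed
  level A only: that K consecutive equal blocks all exceed A standard deviations costs about
  exp(-A^2 K / 2), and their sum then exceeds A sqrt K standard deviations of the whole. For large A
  this is the Gaussian price of such a deviation up to a factor near 1 in the exponent. The decay of
  beta enters twice: summability of beta_n^2 gives the Gronwall bound and a positive limit of
  sigma_n, while n beta_n^2 -> 0 makes the product of beta_n with the sum of the beta_m Z_m
  negligible, although the bound available for that sum is of order sqrt n.\<close>

definition lil_scale :: "nat \<Rightarrow> real" where
  "lil_scale n = sqrt (2 * real n * ln (ln (real n)))"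

locale gaussian_noise = prob_space M for M :: "'a measure" +
  fixes \<eta> :: "nat \<Rightarrow> 'a \<Rightarrow> real"
  assumes indep_noise: "indep_vars (\<lambda>_. borel) \<eta> UNIV"
    and noise_normal: "\<And>n. distributed M lborel (\<eta> n) std_normal_density"
begin

lemma noise_measurable [measurable]: "\<eta> n \<in> borel_measurable M"
  using indep_noise by (auto simp: indep_vars_def)

text \<open>Encoded as the preimage algebra of one vector-valued map: every event of the past is
  then a condition on the restriction to \<open>{..<n}\<close>, and its independence of
  \<open>\<eta> n\<close> is that of two restrictions of an independent family.\<close>

definition past :: "nat \<Rightarrow> 'a measure" where
  "past n = vimage_algebra (space M) (\<lambda>\<omega>. \<lambda>i\<in>{..<n}. \<eta> i \<omega>) (PiM {..<n} (\<lambda>_. borel))"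

lemma space_past [simp]: "space (past n) = space M"
  by (simp add: past_def)

lemma restrict_noise_measurable [measurable]:
  "(\<lambda>\<omega>. \<lambda>i\<in>I. \<eta> i \<omega>) \<in> measurable M (PiM I (\<lambda>_. borel))"
  by measurable

lemma sets_past:
  "sets (past n) = {(\<lambda>\<omega>. \<lambda>i\<in>{..<n}. \<eta> i \<omega>) -` A \<inter> space M | A. A \<in> sets (PiM {..<n} (\<lambda>_. borel))}"
  unfolding past_def by (rule sets_vimage_algebra2) (auto simp: space_PiM)

lemma subalgebra_past: "subalgebra M (past n)"
  unfolding subalgebra_def sets_past by auto

lemma past_measurable: "X \<in> measurable (past n) N \<Longrightarrow> X \<in> measurable M N"
  using measurable_from_subalg[OF subalgebra_past] .

lemma noise_past_measurable: "i < n \<Longrightarrow> \<eta> i \<in> borel_measurable (past n)"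
proof -
  assume "i < n"
  have 1: "(\<lambda>\<omega>. \<lambda>i\<in>{..<n}. \<eta> i \<omega>) \<in> measurable (past n) (PiM {..<n} (\<lambda>_. borel))"
    unfolding past_def by (rule measurable_vimage_algebra1) (auto simp: space_PiM)
  have "(\<lambda>\<omega>. (\<lambda>i\<in>{..<n}. \<eta> i \<omega>) i) \<in> borel_measurable (past n)"
    by (rule measurable_compose[OF 1 measurable_component_singleton]) (use \<open>i < n\<close> in auto)
  then show ?thesis using \<open>i < n\<close> by simp
qed

lemma subalgebra_past_mono: "n \<le> m \<Longrightarrow> subalgebra (past m) (past n)"
proof -
  assume "n \<le> m"
  have 1: "(\<lambda>\<omega>. \<lambda>i\<in>{..<n}. \<eta> i \<omega>) \<in> measurable (past m) (PiM {..<n} (\<lambda>_. borel))"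
    using \<open>n \<le> m\<close> by (intro measurable_restrict noise_past_measurable) auto
  show ?thesis
    unfolding subalgebra_def sets_past[of n] using measurable_sets[OF 1] by auto
qed

lemma past_mono: "X \<in> measurable (past n) N \<Longrightarrow> n \<le> m \<Longrightarrow> X \<in> measurable (past m) N"
  using measurable_from_subalg[OF subalgebra_past_mono] .

lemma prob_past_noise:
  assumes A: "A \<in> sets (past n)" and B: "B \<in> sets borel"
  shows "prob (A \<inter> (\<eta> n -` B \<inter> space M)) = prob A * prob (\<eta> n -` B \<inter> space M)"
proof -
  let ?P = "PiM {..<n} (\<lambda>_. borel) :: (nat \<Rightarrow> real) measure" and ?Q = "PiM {n} (\<lambda>_. borel) :: (nat \<Rightarrow> real) measure"
  have ind: "indep_var ?P (\<lambda>\<omega>. \<lambda>i\<in>{..<n}. \<eta> i \<omega>) ?Q (\<lambda>\<omega>. \<lambda>i\<in>{n}. \<eta> i \<omega>)"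
    by (rule indep_var_restrict[OF indep_noise]) auto
  obtain A' where A': "A' \<in> sets ?P" "A = (\<lambda>\<omega>. \<lambda>i\<in>{..<n}. \<eta> i \<omega>) -` A' \<inter> space M"
    using A unfolding sets_past by blast
  define B' where "B' = (\<lambda>x. x n) -` B \<inter> space ?Q"
  have B': "B' \<in> sets ?Q" unfolding B'_def
    using measurable_sets[OF measurable_component_singleton[of n "{n}" "\<lambda>_. borel"] B] by simp
  have eB: "(\<lambda>\<omega>. \<lambda>i\<in>{n}. \<eta> i \<omega>) -` B' \<inter> space M = \<eta> n -` B \<inter> space M"
    unfolding B'_def by (auto simp: space_PiM)
  have eAB: "(\<lambda>x. (\<lambda>i\<in>{..<n}. \<eta> i x, \<lambda>i\<in>{n}. \<eta> i x)) -` (A' \<times> B') \<inter> space M = A \<inter> (\<eta> n -` B \<inter> space M)"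
    unfolding A'(2) eB[symmetric] by blast
  from indep_varD[OF ind A'(1) B'] show ?thesis
    unfolding eAB eB A'(2)[symmetric] .
qed

lemma distr_noise: "distr M borel (\<eta> n) = std_normal_distribution"
proof -
  have "distr M borel (\<eta> n) = distr M lborel (\<eta> n)" by (rule distr_cong) auto
  then show ?thesis using noise_normal[of n] by (simp add: distributed_def)
qed

lemma prob_space_std_normal: "prob_space std_normal_distribution"
  using prob_space_normal_density[of 1 0] by simp

text \<open>\<open>prob_past_noise\<close> gives agreement on rectangles, which determine a product
  measure. This product form replaces conditional expectations given the past: they become inner
  integrals by Fubini.\<close>

lemma distr_past_noise:
  assumes X: "X \<in> measurable (past n) N"
  shows "distr M N X \<Otimes>\<^sub>M std_normal_distribution = distr M (N \<Otimes>\<^sub>M borel) (\<lambda>x. (X x, \<eta> n x))"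
proof (rule pair_measure_eqI)
  have [measurable]: "X \<in> measurable M N" using X by (rule past_measurable)
  interpret nd: prob_space std_normal_distribution by (rule prob_space_std_normal)
  interpret X: prob_space "distr M N X" by (rule prob_space_distr) simp
  show "sigma_finite_measure (distr M N X)" by (fact X.sigma_finite_measure_axioms)
  show "sigma_finite_measure std_normal_distribution" by (fact nd.sigma_finite_measure_axioms)
  show "sets (distr M N X \<Otimes>\<^sub>M std_normal_distribution) = sets (distr M (N \<Otimes>\<^sub>M borel) (\<lambda>x. (X x, \<eta> n x)))"
    unfolding sets_distr by (rule sets_pair_measure_cong) simp_all
  fix A B assume A: "A \<in> sets (distr M N X)" and B: "B \<in> sets std_normal_distribution"
  then have [measurable]: "A \<in> sets N" "B \<in> sets borel" by simp_all
  have "X -` A \<inter> space M \<in> sets (past n)" using measurable_sets[OF X, of A] A by simp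
  from prob_past_noise[OF this \<open>B \<in> sets borel\<close>]
  have "emeasure M ((X -` A \<inter> space M) \<inter> (\<eta> n -` B \<inter> space M)) = emeasure M (X -` A \<inter> space M) * emeasure M (\<eta> n -` B \<inter> space M)"
    by (simp add: emeasure_eq_measure ennreal_mult)
  moreover have "(\<lambda>x. (X x, \<eta> n x)) -` (A \<times> B) \<inter> space M = (X -` A \<inter> space M) \<inter> (\<eta> n -` B \<inter> space M)" by auto
  ultimately show "emeasure (distr M N X) A * emeasure std_normal_distribution B = emeasure (distr M (N \<Otimes>\<^sub>M borel) (\<lambda>x. (X x, \<eta> n x))) (A \<times> B)"
    unfolding distr_noise[of n, symmetric] by (simp add: emeasure_distr)
qed

lemma indep_past_noise:
  assumes "X \<in> borel_measurable (past n)"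
  shows "indep_var borel X borel (\<eta> n)"
  using distr_past_noise[OF assms] past_measurable[OF assms]
  by (simp add: indep_var_distribution_eq distr_noise)

lemma nn_integral_past_noise:
  assumes X: "X \<in> measurable (past n) N"
    and h [measurable]: "(\<lambda>(x, e). h x e) \<in> borel_measurable (N \<Otimes>\<^sub>M borel)"
  shows "(\<integral>\<^sup>+\<omega>. h (X \<omega>) (\<eta> n \<omega>) \<partial>M) = (\<integral>\<^sup>+\<omega>. (\<integral>\<^sup>+e. h (X \<omega>) e \<partial>std_normal_distribution) \<partial>M)"
proof -
  have [measurable]: "X \<in> measurable M N" using X by (rule past_measurable)
  interpret nd: prob_space std_normal_distribution by (rule prob_space_std_normal)
  have "(\<integral>\<^sup>+\<omega>. h (X \<omega>) (\<eta> n \<omega>) \<partial>M) = (\<integral>\<^sup>+z. (case z of (x, e) \<Rightarrow> h x e) \<partial>(distr M (N \<Otimes>\<^sub>M borel) (\<lambda>x. (X x, \<eta> n x))))"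
    by (subst nn_integral_distr) auto
  also have "\<dots> = (\<integral>\<^sup>+x. (\<integral>\<^sup>+e. h x e \<partial>std_normal_distribution) \<partial>distr M N X)"
    unfolding distr_past_noise[OF X, symmetric] by (subst nd.nn_integral_fst[symmetric]) auto
  also have "\<dots> = (\<integral>\<^sup>+\<omega>. (\<integral>\<^sup>+e. h (X \<omega>) e \<partial>std_normal_distribution) \<partial>M)"
    by (subst nn_integral_distr) (auto intro!: nd.borel_measurable_nn_integral)
  finally show ?thesis .
qed

text \<open>Completing the square turns the tilted standard density into that of the normal law with
  mean u. The factor l carries the value accumulated in the past.\<close>

lemma std_normal_exp_integral:
  "(\<integral>\<^sup>+e. ennreal (l * exp (u * e - u\<^sup>2 / 2)) \<partial>std_normal_distribution) = ennreal l" if "l \<ge> 0"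
proof -
  have "(\<integral>\<^sup>+e. ennreal (l * exp (u * e - u\<^sup>2 / 2)) \<partial>std_normal_distribution)
     = (\<integral>\<^sup>+e. ennreal l * ennreal (normal_density u 1 e) \<partial>lborel)"
  proof (subst nn_integral_density, simp, simp, rule nn_integral_cong)
    fix e
    have "std_normal_density e * exp (u * e - u\<^sup>2 / 2) = normal_density u 1 e"
      by (simp add: normal_density_def exp_add[symmetric] power2_eq_square field_simps)
    then show "ennreal (std_normal_density e) * ennreal (l * exp (u * e - u\<^sup>2 / 2)) = ennreal l * ennreal (normal_density u 1 e)"
      using that by (simp add: ennreal_mult[symmetric] mult_ac)
  qed
  also have "\<dots> = ennreal l"
    using prob_space.emeasure_space_1[OF prob_space_normal_density[of 1 u]]
    by (simp add: nn_integral_cmult emeasure_density)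
  finally show ?thesis .
qed

text \<open>Each new factor has mean 1 given the past by \<open>std_normal_exp_integral\<close>.
  Nonnegative integrals are used, so the integrand may be unbounded.\<close>

lemma exp_martingale:
  assumes u: "\<And>i. u i \<in> borel_measurable (past i)"
  shows "(\<integral>\<^sup>+\<omega>. ennreal (exp (\<Sum>i<n. u i \<omega> * \<eta> i \<omega> - (u i \<omega>)\<^sup>2 / 2)) \<partial>M) = 1"
proof (induction n)
  case 0
  then show ?case by (simp add: emeasure_space_1)
next
  case (Suc n)
  have un [measurable]: "u n \<in> borel_measurable (past n)" by fact
  let ?L = "\<lambda>\<omega>. exp (\<Sum>i<n. u i \<omega> * \<eta> i \<omega> - (u i \<omega>)\<^sup>2 / 2)"
  have [measurable]: "(\<lambda>\<omega>. \<Sum>i<n. u i \<omega> * \<eta> i \<omega> - (u i \<omega>)\<^sup>2 / 2) \<in> borel_measurable (past n)"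
    by (intro borel_measurable_sum borel_measurable_diff borel_measurable_times
         borel_measurable_power borel_measurable_divide borel_measurable_const)
       (auto intro: past_mono[OF u] noise_past_measurable)
  have "(\<lambda>\<omega>. (?L \<omega>, u n \<omega>)) \<in> measurable (past n) (borel \<Otimes>\<^sub>M borel)"
    by measurable
  from nn_integral_past_noise[OF this, of "\<lambda>p e. ennreal (fst p * exp (snd p * e - (snd p)\<^sup>2 / 2))"]
  have "(\<integral>\<^sup>+\<omega>. ennreal (?L \<omega> * exp (u n \<omega> * \<eta> n \<omega> - (u n \<omega>)\<^sup>2 / 2)) \<partial>M) = (\<integral>\<^sup>+\<omega>. ennreal (?L \<omega>) \<partial>M)"
    by (simp add: std_normal_exp_integral)
  then show ?case using Suc by (simp add: exp_add)
qed

text \<open>Doob's inequality for the exponential martingale, with the stopping done in the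
  integrand: \<open>u'\<close> is still adapted, so \<open>exp (S' N)\<close> again has mean 1, and
  Markov's inequality at the single time N suffices because \<open>S'\<close> is frozen from the
  first passage on.\<close>

lemma exp_maximal_inequality:
  assumes u: "\<And>i. u i \<in> borel_measurable (past i)"
  defines "S \<equiv> \<lambda>n \<omega>. \<Sum>i<n. u i \<omega> * \<eta> i \<omega> - (u i \<omega>)\<^sup>2 / 2"
  shows "prob {\<omega>\<in>space M. \<exists>n\<le>N. x \<le> S n \<omega>} \<le> exp (- x)"
proof -
  \<comment> \<open>Switch the integrand off once the level has been reached.\<close>
  define u' where "u' = (\<lambda>i \<omega>. if \<forall>n\<le>i. S n \<omega> < x then u i \<omega> else 0)"
  define S' where "S' = (\<lambda>n \<omega>. \<Sum>i<n. u' i \<omega> * \<eta> i \<omega> - (u' i \<omega>)\<^sup>2 / 2)"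
  have [measurable]: "u i \<in> borel_measurable M" for i by (rule past_measurable[OF u])
  have [measurable]: "S n \<in> borel_measurable M" for n unfolding S_def by measurable
  have S_past: "S n \<in> borel_measurable (past i)" if "n \<le> i" for n i
    unfolding S_def
    by (intro borel_measurable_sum borel_measurable_diff borel_measurable_times
         borel_measurable_power borel_measurable_divide borel_measurable_const)
       (use that in \<open>auto intro: past_mono[OF u] noise_past_measurable\<close>)
  have u'_past: "u' i \<in> borel_measurable (past i)" for i
  proof -
    have "{\<omega>\<in>space (past i). \<forall>n\<le>i. S n \<omega> < x} = {\<omega>\<in>space (past i). \<forall>n\<in>{..i}. S n \<omega> < x}" by auto
    also have "\<dots> \<in> sets (past i)"
    proof (rule sets.sets_Collect_finite_All')
      fix n assume "n \<in> {..i}"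
      then have [measurable]: "S n \<in> borel_measurable (past i)" by (auto intro: S_past)
      show "{\<omega>\<in>space (past i). S n \<omega> < x} \<in> sets (past i)" by measurable
    qed auto
    finally have P: "{\<omega>\<in>space (past i). \<forall>n\<le>i. S n \<omega> < x} \<in> sets (past i)" .
    show ?thesis
      unfolding u'_def by (rule measurable_If[OF u borel_measurable_const P])
  qed
  have [measurable]: "u' i \<in> borel_measurable M" for i by (rule past_measurable[OF u'_past])
  have [measurable]: "S' n \<in> borel_measurable M" for n unfolding S'_def by measurable
  have key: "x \<le> S' N \<omega>" if ex: "\<exists>n\<le>N. x \<le> S n \<omega>" for \<omega>
  proof -
    define m where "m = (LEAST n. x \<le> S n \<omega>)"
    from ex obtain n where n: "n \<le> N" "x \<le> S n \<omega>" by blast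
    have m: "x \<le> S m \<omega>" unfolding m_def by (rule LeastI[of "\<lambda>n. x \<le> S n \<omega>", OF n(2)])
    have "m \<le> n" unfolding m_def by (rule Least_le[of "\<lambda>n. x \<le> S n \<omega>", OF n(2)])
    with n(1) have mN: "m \<le> N" by simp
    have less: "S i \<omega> < x" if "i < m" for i
    proof -
      from that have "\<not> x \<le> S i \<omega>" unfolding m_def by (rule not_less_Least)
      then show ?thesis by simp
    qed
    have a: "u' i \<omega> = u i \<omega>" if "i < m" for i using less that by (auto simp: u'_def)
    have b: "u' i \<omega> = 0" if "m \<le> i" for i
    proof -
      from m that have "\<not> (\<forall>n\<le>i. S n \<omega> < x)" by (meson not_less)
      then show ?thesis unfolding u'_def by (rule if_not_P)
    qed
    have "S' N \<omega> = (\<Sum>i<m. u' i \<omega> * \<eta> i \<omega> - (u' i \<omega>)\<^sup>2 / 2)"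
      unfolding S'_def by (rule sum.mono_neutral_right) (use mN b in auto)
    also have "\<dots> = S m \<omega>" unfolding S_def by (rule sum.cong) (use a in auto)
    finally show ?thesis using m by simp
  qed
  have "emeasure M {\<omega>\<in>space M. \<exists>n\<le>N. x \<le> S n \<omega>} \<le> emeasure M {\<omega>\<in>space M. 1 \<le> ennreal (exp (- x)) * ennreal (exp (S' N \<omega>))}"
  proof (rule emeasure_mono)
    have "1 \<le> ennreal (exp (- x)) * ennreal (exp (S' N \<omega>))" if "x \<le> S' N \<omega>" for \<omega>
    proof -
      have "1 \<le> exp (- x + S' N \<omega>)" using that by simp
      then have "ennreal 1 \<le> ennreal (exp (- x) * exp (S' N \<omega>))" unfolding exp_add by (rule ennreal_leI)
      then show ?thesis by (subst ennreal_mult[symmetric]) auto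
    qed
    with key show "{\<omega>\<in>space M. \<exists>n\<le>N. x \<le> S n \<omega>} \<subseteq> {\<omega>\<in>space M. 1 \<le> ennreal (exp (- x)) * ennreal (exp (S' N \<omega>))}"
      by blast
  qed simp
  also have "\<dots> \<le> ennreal (exp (- x)) * (\<integral>\<^sup>+\<omega>. ennreal (exp (S' N \<omega>)) * indicator (space M) \<omega> \<partial>M)"
    by (rule nn_integral_Markov_inequality[where u = "\<lambda>\<omega>. ennreal (exp (S' N \<omega>))" and A = "space M"]) simp_all
  also have "(\<integral>\<^sup>+\<omega>. ennreal (exp (S' N \<omega>)) * indicator (space M) \<omega> \<partial>M) = (\<integral>\<^sup>+\<omega>. ennreal (exp (S' N \<omega>)) \<partial>M)"
    by (rule nn_integral_cong) simp
  also have "\<dots> = 1" unfolding S'_def by (rule exp_martingale[where u = u', OF u'_past])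
  finally show ?thesis by (simp add: emeasure_eq_measure)
qed

end

section \<open>The law of the iterated logarithm: upper bound\<close>

context gaussian_noise
begin

text \<open>Between consecutive powers of q the maximal inequality is applied with one tilt
  \<open>lam k\<close>. Since the compensator is part of \<open>S\<close>, the events
  \<open>A k\<close> involve no bound on it. The hypothesis on the quadratic variation enters only
  after Borel-Cantelli, on a fixed path, and so may hold from a random time on.\<close>

lemma upper_lil_aux:
  assumes u: "\<And>i. u i \<in> borel_measurable (past i)"
    and Q: "AE \<omega> in M. \<forall>\<^sub>F n in sequentially. (\<Sum>i<n. (u i \<omega>)\<^sup>2) \<le> v * real n"
    and v: "v > 0" and \<delta>: "\<delta> > 0"
  shows "AE \<omega> in M. \<forall>\<^sub>F n in sequentially. (\<Sum>i<n. u i \<omega> * \<eta> i \<omega>) \<le> (1 + \<delta>) * sqrt v * lil_scale n"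
proof -
  \<comment> \<open>Three losses, 1 + d/2 from the level and 1 + d each from the spacing q and from
    replacing ln k by ln ln n, multiply to at most 1 + 5 d.\<close>
  define d where "d = min 1 (\<delta> / 5)"
  have d: "0 < d" "d \<le> 1" "d \<le> \<delta> / 5" using \<delta> by (auto simp: d_def)
  define q where "q = (1 + d)\<^sup>2"
  have q1: "q > 1" using d by (simp add: q_def power2_eq_square algebra_simps add_pos_pos)
  have sq: "sqrt q = 1 + d" using d by (simp add: q_def)
  define N where "N = (\<lambda>k::nat. nat \<lceil>q ^ (k + 1)\<rceil>)"
  \<comment> \<open>Balances the two terms of \<open>S\<close>: while the quadratic variation is at
    most v q^(k+1) the compensator is at most ln k, and the level (1 + d) ln k gives the summable
    probabilities k^(-1-d).\<close>
  define lam where "lam = (\<lambda>k::nat. sqrt (2 * ln (real k) / (v * q ^ (k + 1))))"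
  define S where "S = (\<lambda>k n \<omega>. \<Sum>i<n. (lam k * u i \<omega>) * \<eta> i \<omega> - (lam k * u i \<omega>)\<^sup>2 / 2)"
  define A where "A = (\<lambda>k. {\<omega>\<in>space M. \<exists>n\<le>N k. (1 + d) * ln (real k) \<le> S k n \<omega>})"
  have [measurable]: "u i \<in> borel_measurable M" for i by (rule past_measurable[OF u])
  have A_sets: "A k \<in> sets M" for k unfolding A_def S_def by measurable
  have A_prob: "prob (A k) \<le> exp (- ((1 + d) * ln (real k)))" for k
    unfolding A_def S_def by (rule exp_maximal_inequality) (use u in auto)
  have "summable (\<lambda>k. prob (A k))"
  proof (rule summable_comparison_test_ev)
    show "summable (\<lambda>k. real k powr (- (1 + d)))"
      using d by (subst summable_real_powr_iff) auto
    show "\<forall>\<^sub>F k in sequentially. norm (prob (A k)) \<le> real k powr - (1 + d)"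
      using eventually_gt_at_top[of 0]
    proof eventually_elim
      case (elim k)
      then show ?case using A_prob[of k] by (simp add: powr_def algebra_simps)
    qed
  qed
  have fin: "emeasure M (A k) < \<infinity>" for k by (simp add: emeasure_eq_measure)
  from borel_cantelli_AE1[OF A_sets fin \<open>summable (\<lambda>k. prob (A k))\<close>]
  have BC: "AE \<omega> in M. \<forall>\<^sub>F k in sequentially. \<omega> \<in> space M - A k" by simp
  \<comment> \<open>The index with q^K \<le> n \<le> q^(K+1), so \<open>lam (K n)\<close> is the
    tilt for n.\<close>
  define K where "K = (\<lambda>n::nat. nat \<lfloor>ln (real n) / ln q\<rfloor>)"
  have K_top: "filterlim K at_top sequentially"
    unfolding K_def using q1 by real_asymp
  have rat: "\<forall>\<^sub>F n in sequentially. sqrt (ln (ln (real n) / ln q)) \<le> (1 + d) * sqrt (ln (ln (real n)))"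
  proof -
    have "((\<lambda>n. sqrt (ln (ln (real n) / ln q)) / sqrt (ln (ln (real n)))) \<longlongrightarrow> 1) sequentially"
      using q1 by real_asymp
    then have "\<forall>\<^sub>F n in sequentially. sqrt (ln (ln (real n) / ln q)) / sqrt (ln (ln (real n))) < 1 + d"
      using d by (intro order_tendstoD) auto
    moreover have "\<forall>\<^sub>F n in sequentially. ln (ln (real n)) > 0" by real_asymp
    ultimately show ?thesis
      by eventually_elim (simp add: divide_less_eq)
  qed
  have det: "\<forall>\<^sub>F n in sequentially. n \<ge> 3 \<and> K n \<ge> 2 \<and> q ^ K n \<le> real n \<and> real n \<le> q ^ (K n + 1) \<and> ln (real (K n)) \<le> ln (ln (real n) / ln q)"
  proof -
    have "\<forall>\<^sub>F n in sequentially. K n \<ge> 2" using K_top by (auto simp: filterlim_at_top)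
    then show ?thesis using eventually_ge_at_top[of 3]
    proof eventually_elim
      case (elim n)
      let ?x = "ln (real n) / ln q"
      have "2 \<le> \<lfloor>?x\<rfloor>" using elim(1) unfolding K_def by linarith
      then have x: "?x \<ge> 2" by linarith
      have K1: "real (K n) \<le> ?x" "?x < real (K n) + 1" using x unfolding K_def by (auto simp: of_nat_nat)
      have "q ^ K n = exp (real (K n) * ln q)" using q1 by (simp add: exp_of_nat_mult)
      also have "\<dots> \<le> exp (ln (real n))" using K1(1) q1 by (simp add: field_simps)
      finally have 1: "q ^ K n \<le> real n" using elim by simp
      have "real n = exp (ln (real n))" using elim by simp
      also have "\<dots> \<le> exp (real (K n + 1) * ln q)" using K1(2) q1 by (simp add: field_simps)
      also have "\<dots> = q ^ (K n + 1)" using q1 by (subst exp_of_nat_mult) simp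
      finally have 2: "real n \<le> q ^ (K n + 1)" .
      show ?case using 1 2 K1 elim by auto
    qed
  qed
  from BC Q show ?thesis
  proof eventually_elim
    case (elim \<omega>)
    have "\<forall>\<^sub>F n in sequentially. \<omega> \<in> space M - A (K n)"
      using elim(1) K_top by (rule eventually_compose_filterlim)
    with elim(2) rat det show ?case
    proof eventually_elim
      case (elim n)
      let ?k = "K n" and ?B = "v * q ^ (K n + 1)" and ?l = "ln (real (K n))"
      have B: "?B > 0" using v q1 by simp
      have l: "?l > 0" using elim by simp
      have lam: "lam ?k > 0" unfolding lam_def using B l by simp
      have nN: "n \<le> N ?k" unfolding N_def using elim by (simp add: le_nat_iff) linarith
      have "\<not> (\<exists>n\<le>N ?k. (1 + d) * ?l \<le> S ?k n \<omega>)" using elim(4) unfolding A_def by blast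
      with nN have "S ?k n \<omega> < (1 + d) * ?l" by (meson not_le)
      moreover have "S ?k n \<omega> = lam ?k * (\<Sum>i<n. u i \<omega> * \<eta> i \<omega>) - (lam ?k)\<^sup>2 / 2 * (\<Sum>i<n. (u i \<omega>)\<^sup>2)"
        unfolding S_def by (simp add: sum_subtractf sum_distrib_left power_mult_distrib sum_divide_distrib mult_ac)
      moreover have "(lam ?k)\<^sup>2 / 2 * (\<Sum>i<n. (u i \<omega>)\<^sup>2) \<le> ?l"
      proof -
        have "(lam ?k)\<^sup>2 / 2 = ?l / ?B" unfolding lam_def using B l by (subst real_sqrt_pow2) auto
        moreover have "(\<Sum>i<n. (u i \<omega>)\<^sup>2) \<le> ?B"
          using elim(1) v mult_left_mono[of "real n" "q ^ (K n + 1)" v] elim(3) by linarith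
        ultimately show ?thesis using B l by (simp add: divide_le_eq mult_left_mono)
      qed
      ultimately have "lam ?k * (\<Sum>i<n. u i \<omega> * \<eta> i \<omega>) \<le> (2 + d) * ?l" by (simp add: algebra_simps)
      then have "(\<Sum>i<n. u i \<omega> * \<eta> i \<omega>) \<le> (2 + d) * ?l / lam ?k" using lam by (simp add: field_simps)
      also have "\<dots> = (1 + d / 2) * sqrt (2 * ?l * ?B)"
      proof -
        obtain B where B_def: "B = ?B" by blast
        have "lam ?k * sqrt (2 * ?l * B) = sqrt (2 * ?l / B * (2 * ?l * B))"
          unfolding lam_def B_def by (simp only: real_sqrt_mult[symmetric])
        also have "2 * ?l / B * (2 * ?l * B) = (2 * ?l)\<^sup>2"
          using B unfolding B_def[symmetric] by (simp add: power2_eq_square)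
        finally have "lam ?k * sqrt (2 * ?l * ?B) = 2 * ?l" using l unfolding B_def by (simp only: real_sqrt_abs)
        then have "2 * ?l / lam ?k = sqrt (2 * ?l * ?B)" using lam by (simp add: field_simps)
        moreover have "(2 + d) * ?l = (1 + d / 2) * (2 * ?l)" by (simp add: algebra_simps)
        ultimately show ?thesis by (metis times_divide_eq_right)
      qed
      also have "\<dots> \<le> (1 + d / 2) * sqrt (2 * ?l * (v * (q * real n)))"
      proof -
        have "?B \<le> v * (q * real n)" using elim v q1 by simp
        then have "2 * ?l * ?B \<le> 2 * ?l * (v * (q * real n))" by (rule mult_left_mono) (use l in simp)
        then have "sqrt (2 * ?l * ?B) \<le> sqrt (2 * ?l * (v * (q * real n)))" by (rule real_sqrt_le_mono)
        then show ?thesis by (rule mult_left_mono) (use d in auto)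
      qed
      also have "\<dots> = (1 + d / 2) * (sqrt v * (1 + d) * sqrt (2 * real n)) * sqrt ?l"
        using sq by (simp add: real_sqrt_mult)
      also have "\<dots> \<le> (1 + d / 2) * (sqrt v * (1 + d) * sqrt (2 * real n)) * ((1 + d) * sqrt (ln (ln (real n))))"
      proof (rule mult_left_mono)
        have "sqrt ?l \<le> sqrt (ln (ln (real n) / ln q))" using elim by simp
        then show "sqrt ?l \<le> (1 + d) * sqrt (ln (ln (real n)))" using elim(2) by linarith
      qed (use d v in auto)
      also have "\<dots> = ((1 + d / 2) * (1 + d)\<^sup>2) * sqrt v * lil_scale n"
        unfolding lil_scale_def by (simp add: real_sqrt_mult power2_eq_square)
      also have "\<dots> \<le> (1 + \<delta>) * sqrt v * lil_scale n"
      proof -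
        have "0 \<le> sqrt v * lil_scale n" 
        proof -
          have "exp 1 \<le> real n" using exp_le elim by linarith
          then have "1 \<le> ln (real n)" using elim by (subst ln_ge_iff) auto
          then show ?thesis using v unfolding lil_scale_def by (auto intro!: mult_nonneg_nonneg ln_ge_zero)
        qed
        have "(1 + d / 2) * (1 + d)\<^sup>2 = 1 + 5/2 * d + 2 * (d * d) + (d * d) * d / 2"
          by (simp add: power2_eq_square algebra_simps)
        also have "\<dots> \<le> 1 + 5 * d"
        proof -
          have "d * d \<le> d" using d mult_left_mono[of d 1 d] by linarith
          moreover from this have "d * d * d \<le> d" using d mult_right_mono[of "d * d" d d] by linarith
          ultimately show ?thesis by linarith
        qed
        finally have "(1 + d / 2) * (1 + d)\<^sup>2 \<le> 1 + \<delta>" using d by simp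
        then have "(1 + d / 2) * (1 + d)\<^sup>2 * (sqrt v * lil_scale n) \<le> (1 + \<delta>) * (sqrt v * lil_scale n)"
          using \<open>0 \<le> sqrt v * lil_scale n\<close> by (rule mult_right_mono)
        then show ?thesis by (simp only: mult.assoc)
      qed
      finally show ?case .
    qed
  qed
qed

end

lemma lil_scale_pos_ev: "\<forall>\<^sub>F n in sequentially. lil_scale n > 0"
  unfolding lil_scale_def by real_asymp

lemma lil_scale_less_n: "(\<lambda>n. lil_scale n / real n) \<longlonglongrightarrow> 0"
  unfolding lil_scale_def by real_asymp

lemma integrable_mult_of_square:
  fixes f g :: "'b \<Rightarrow> real"
  assumes "f \<in> borel_measurable M" "g \<in> borel_measurable M"
    and "integrable M (\<lambda>x. (f x)\<^sup>2)" "integrable M (\<lambda>x. (g x)\<^sup>2)"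
  shows "integrable M (\<lambda>x. f x * g x)"
proof (rule Bochner_Integration.integrable_bound)
  show "integrable M (\<lambda>x. (f x)\<^sup>2 + (g x)\<^sup>2)" using assms by simp
  show "AE x in M. norm (f x * g x) \<le> norm ((f x)\<^sup>2 + (g x)\<^sup>2)"
  proof (intro always_eventually allI)
    fix x
    have "2 * (\<bar>f x\<bar> * \<bar>g x\<bar>) \<le> \<bar>f x\<bar>\<^sup>2 + \<bar>g x\<bar>\<^sup>2"
      using sum_squares_bound[of "\<bar>f x\<bar>" "\<bar>g x\<bar>"] by (simp add: mult.assoc)
    moreover have "0 \<le> \<bar>f x\<bar> * \<bar>g x\<bar>" by simp
    moreover have "norm (f x * g x) = \<bar>f x\<bar> * \<bar>g x\<bar>" "norm ((f x)\<^sup>2 + (g x)\<^sup>2) = \<bar>f x\<bar>\<^sup>2 + \<bar>g x\<bar>\<^sup>2"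
      by (simp_all add: abs_mult)
    ultimately show "norm (f x * g x) \<le> norm ((f x)\<^sup>2 + (g x)\<^sup>2)" by linarith
  qed
qed (use assms in simp)

text \<open>The expected sum of the series is finite, so the series converges almost surely and its
  terms vanish.\<close>

lemma AE_tendsto_0_of_summable_integral:
  fixes f :: "nat \<Rightarrow> 'b \<Rightarrow> real"
  assumes int: "\<And>j. integrable M (f j)" and nn: "\<And>j x. 0 \<le> f j x"
    and sm: "summable (\<lambda>j. integral\<^sup>L M (f j))"
  shows "AE x in M. (\<lambda>j. f j x) \<longlonglongrightarrow> 0"
proof -
  have [measurable]: "f j \<in> borel_measurable M" for j using int by auto
  have "(\<integral>\<^sup>+x. (\<Sum>j. ennreal (f j x)) \<partial>M) = (\<Sum>j. ennreal (integral\<^sup>L M (f j)))"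
    by (subst nn_integral_suminf) (auto simp: nn_integral_eq_integral[OF int] nn)
  also have "\<dots> = ennreal (\<Sum>j. integral\<^sup>L M (f j))"
    by (rule suminf_ennreal2) (use sm nn in simp_all)
  also have "\<dots> < \<infinity>" by simp
  finally have "AE x in M. (\<Sum>j. ennreal (f j x)) \<noteq> \<infinity>"
    by (intro nn_integral_PInf_AE) auto
  then show ?thesis
  proof eventually_elim
    case (elim x)
    have "summable (\<lambda>j. f j x)" by (rule summable_suminf_not_top) (use elim nn in auto)
    then show ?case by (rule summable_LIMSEQ_zero)
  qed
qed

context gaussian_noise
begin

text \<open>The countable family of slacks \<open>b m\<close> lets \<delta> be quantified inside the
  almost sure event. Adding \<open>b m\<close> to the variance bound keeps it positive, which admits
  s = 0: a martingale with negligible integrand is then of smaller order than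
  \<open>lil_scale\<close>.\<close>

lemma upper_lil_one_sided:
  assumes u: "\<And>i. u i \<in> borel_measurable (past i)"
    and s: "s \<ge> 0"
    and Q: "AE \<omega> in M. \<forall>\<delta>>0. \<forall>\<^sub>F n in sequentially. (\<Sum>i<n. (u i \<omega>)\<^sup>2) \<le> (s\<^sup>2 + \<delta>) * real n"
  shows "AE \<omega> in M. \<forall>\<delta>>0. \<forall>\<^sub>F n in sequentially. (\<Sum>i<n. u i \<omega> * \<eta> i \<omega>) \<le> (s + \<delta>) * lil_scale n"
proof -
  define b where "b = (\<lambda>m::nat. 1 / (real m + 1))"
  have b0: "b m > 0" for m by (simp add: b_def)
  have "AE \<omega> in M. \<forall>\<^sub>F n in sequentially. (\<Sum>i<n. u i \<omega> * \<eta> i \<omega>) \<le> (1 + b m) * sqrt (s\<^sup>2 + b m) * lil_scale n" for m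
    by (rule upper_lil_aux) (use u Q s b0[of m] in \<open>auto intro: add_nonneg_pos\<close>)
  then have "AE \<omega> in M. \<forall>m. \<forall>\<^sub>F n in sequentially. (\<Sum>i<n. u i \<omega> * \<eta> i \<omega>) \<le> (1 + b m) * sqrt (s\<^sup>2 + b m) * lil_scale n"
    by (simp add: AE_all_countable)
  then show ?thesis
  proof eventually_elim
    case (elim \<omega>)
    show ?case
    proof (intro allI impI)
      fix \<delta> :: real assume "\<delta> > 0"
      have "b \<longlonglongrightarrow> 0" unfolding b_def by real_asymp
      then have "(\<lambda>m. (1 + b m) * sqrt (s\<^sup>2 + b m)) \<longlonglongrightarrow> (1 + 0) * sqrt (s\<^sup>2 + 0)"
        by (intro tendsto_intros)
      then have "\<forall>\<^sub>F m in sequentially. (1 + b m) * sqrt (s\<^sup>2 + b m) < s + \<delta>"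
        using s \<open>\<delta> > 0\<close> by (intro order_tendstoD) auto
      then obtain m where m: "(1 + b m) * sqrt (s\<^sup>2 + b m) < s + \<delta>"
        by (auto simp: eventually_sequentially)
      show "\<forall>\<^sub>F n in sequentially. (\<Sum>i<n. u i \<omega> * \<eta> i \<omega>) \<le> (s + \<delta>) * lil_scale n"
        using elim[rule_format, of m] lil_scale_pos_ev
      proof eventually_elim
        case (elim n)
        then show ?case using mult_right_mono[of "(1 + b m) * sqrt (s\<^sup>2 + b m)" "s + \<delta>" "lil_scale n"] m by linarith
      qed
    qed
  qed
qed

theorem upper_lil:
  assumes u: "\<And>i. u i \<in> borel_measurable (past i)"
    and s: "s \<ge> 0"
    and Q: "AE \<omega> in M. \<forall>\<delta>>0. \<forall>\<^sub>F n in sequentially. (\<Sum>i<n. (u i \<omega>)\<^sup>2) \<le> (s\<^sup>2 + \<delta>) * real n"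
  shows "AE \<omega> in M. \<forall>\<delta>>0. \<forall>\<^sub>F n in sequentially. \<bar>\<Sum>i<n. u i \<omega> * \<eta> i \<omega>\<bar> \<le> (s + \<delta>) * lil_scale n"
proof -
  have "AE \<omega> in M. \<forall>\<delta>>0. \<forall>\<^sub>F n in sequentially. (\<Sum>i<n. - u i \<omega> * \<eta> i \<omega>) \<le> (s + \<delta>) * lil_scale n"
    by (rule upper_lil_one_sided[where u = "\<lambda>i \<omega>. - u i \<omega>"]) (use u s Q in auto)
  with upper_lil_one_sided[OF assms] show ?thesis
  proof eventually_elim
    case (elim \<omega>)
    show ?case
    proof (intro allI impI)
      fix \<delta> :: real assume "\<delta> > 0"
      from elim(1)[rule_format, OF this] elim(2)[rule_format, OF this]
      show "\<forall>\<^sub>F n in sequentially. \<bar>\<Sum>i<n. u i \<omega> * \<eta> i \<omega>\<bar> \<le> (s + \<delta>) * lil_scale n"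
        by eventually_elim (simp add: sum_negf abs_le_iff)
    qed
  qed
qed

section \<open>Moments of the noise, the martingale isometry and the law of large numbers for
  squares\<close>

lemma noise_moments:
  "integrable M (\<lambda>\<omega>. \<eta> n \<omega> ^ k)"
  "expectation (\<lambda>\<omega>. \<eta> n \<omega> ^ k) = (LINT x|std_normal_distribution. x ^ k)"
proof -
  have "integrable (distr M borel (\<eta> n)) (\<lambda>x. x ^ k)"
    unfolding distr_noise by (rule integrable_std_normal_distribution_moment)
  then show "integrable M (\<lambda>\<omega>. \<eta> n \<omega> ^ k)" by (subst (asm) integrable_distr_eq) auto
  show "expectation (\<lambda>\<omega>. \<eta> n \<omega> ^ k) = (LINT x|std_normal_distribution. x ^ k)"
    unfolding distr_noise[of n, symmetric] by (subst integral_distr) auto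
qed

lemma noise_integrable: "integrable M (\<eta> n)" and noise_mean: "expectation (\<eta> n) = 0"
  using noise_moments[of n 1] integral_std_normal_distribution_moment_odd[of 1] by auto

lemma noise_square_integrable: "integrable M (\<lambda>\<omega>. (\<eta> n \<omega>)\<^sup>2)"
  and noise_second_moment: "expectation (\<lambda>\<omega>. (\<eta> n \<omega>)\<^sup>2) = 1"
  using noise_moments[of n 2] std_normal_distribution_even_moments(1)[of 1] by (auto simp: fact_numeral)

lemma integral_past_noise:
  fixes X :: "'a \<Rightarrow> real" and h :: "real \<Rightarrow> real"
  assumes X: "X \<in> borel_measurable (past n)" "integrable M X"
    and h [measurable]: "h \<in> borel_measurable borel" and hi: "integrable M (\<lambda>\<omega>. h (\<eta> n \<omega>))"
  shows "integrable M (\<lambda>\<omega>. X \<omega> * h (\<eta> n \<omega>))"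
    and "expectation (\<lambda>\<omega>. X \<omega> * h (\<eta> n \<omega>)) = expectation X * expectation (\<lambda>\<omega>. h (\<eta> n \<omega>))"
proof -
  have "indep_var borel ((\<lambda>x. x) \<circ> X) borel (h \<circ> \<eta> n)"
    by (rule indep_var_compose[OF indep_past_noise[OF X(1)]]) auto
  then have ind: "indep_var borel X borel (\<lambda>\<omega>. h (\<eta> n \<omega>))" by (simp add: comp_def)
  show "integrable M (\<lambda>\<omega>. X \<omega> * h (\<eta> n \<omega>))" by (rule indep_var_integrable[OF ind X(2) hi])
  show "expectation (\<lambda>\<omega>. X \<omega> * h (\<eta> n \<omega>)) = expectation X * expectation (\<lambda>\<omega>. h (\<eta> n \<omega>))"
    by (rule indep_var_lebesgue_integral[OF ind X(2) hi])
qed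

lemma past_martingale_sum:
  assumes "\<And>i. i < n \<Longrightarrow> u i \<in> borel_measurable (past i)"
  shows "(\<lambda>\<omega>. \<Sum>i<n. u i \<omega> * \<eta> i \<omega>) \<in> borel_measurable (past n)"
  by (intro borel_measurable_sum borel_measurable_times past_mono[OF assms] noise_past_measurable) auto

text \<open>The new term is centred given the past, so the cross term drops out, and unit variance
  of the noise leaves only the square of the integrand.\<close>

lemma martingale_isometry:
  assumes u: "\<And>i. i < n \<Longrightarrow> u i \<in> borel_measurable (past i)"
    and ui: "\<And>i. i < n \<Longrightarrow> integrable M (\<lambda>\<omega>. (u i \<omega>)\<^sup>2)"
  shows "integrable M (\<lambda>\<omega>. (\<Sum>i<n. u i \<omega> * \<eta> i \<omega>)\<^sup>2)
    \<and> expectation (\<lambda>\<omega>. (\<Sum>i<n. u i \<omega> * \<eta> i \<omega>)\<^sup>2) = (\<Sum>i<n. expectation (\<lambda>\<omega>. (u i \<omega>)\<^sup>2))"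
  using assms
proof (induction n)
  case 0
  then show ?case by simp
next
  case (Suc n)
  let ?S = "\<lambda>\<omega>. \<Sum>i<n. u i \<omega> * \<eta> i \<omega>"
  have IH: "integrable M (\<lambda>\<omega>. (?S \<omega>)\<^sup>2)" "expectation (\<lambda>\<omega>. (?S \<omega>)\<^sup>2) = (\<Sum>i<n. expectation (\<lambda>\<omega>. (u i \<omega>)\<^sup>2))"
    using Suc by auto
  have un: "u n \<in> borel_measurable (past n)" "integrable M (\<lambda>\<omega>. (u n \<omega>)\<^sup>2)" using Suc.prems by auto
  have S: "?S \<in> borel_measurable (past n)" by (rule past_martingale_sum) (use Suc.prems in auto)
  have Su: "(\<lambda>\<omega>. ?S \<omega> * u n \<omega>) \<in> borel_measurable (past n)" using S un(1) by measurable
  have Su': "integrable M (\<lambda>\<omega>. ?S \<omega> * u n \<omega>)"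
    by (rule integrable_mult_of_square[OF past_measurable[OF S] past_measurable[OF un(1)] IH(1) un(2)])
  have u2: "(\<lambda>\<omega>. (u n \<omega>)\<^sup>2) \<in> borel_measurable (past n)" using un(1) by measurable
  note a = integral_past_noise[OF Su Su', of "\<lambda>x. x", simplified, OF noise_integrable, unfolded noise_mean]
  note b = integral_past_noise[OF u2 un(2), of "\<lambda>x. x\<^sup>2", simplified, OF noise_square_integrable, unfolded noise_second_moment]
  have eq: "(\<lambda>\<omega>. (\<Sum>i<Suc n. u i \<omega> * \<eta> i \<omega>)\<^sup>2) = (\<lambda>\<omega>. (?S \<omega>)\<^sup>2 + 2 * (?S \<omega> * u n \<omega> * \<eta> n \<omega>) + (u n \<omega>)\<^sup>2 * (\<eta> n \<omega>)\<^sup>2)"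
    by (rule ext) (simp add: power2_eq_square algebra_simps)
  show ?case unfolding eq using a b IH by simp
qed

text \<open>The centred squares are orthogonal, so their sum has variance C n. Along n = j^2 the
  normalised variances are summable, which gives the limit there. The sums of squares are
  nondecreasing, so the values between consecutive j^2 are sandwiched.\<close>

lemma noise_square_lln: "AE \<omega> in M. (\<lambda>n. (\<Sum>i<n. (\<eta> i \<omega>)\<^sup>2) / real n) \<longlonglongrightarrow> 1"
proof -
  define h where "h = (\<lambda>x::real. x\<^sup>2 - 1)"
  have h [measurable]: "h \<in> borel_measurable borel" unfolding h_def by measurable
  have hi: "integrable M (\<lambda>\<omega>. h (\<eta> n \<omega>))" and h0: "expectation (\<lambda>\<omega>. h (\<eta> n \<omega>)) = 0" for n
    unfolding h_def using noise_square_integrable[of n] noise_second_moment[of n] by (auto simp: prob_space)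
  define C where "C = (LINT x|std_normal_distribution. (h x)\<^sup>2)"
  have h2: "(\<lambda>x. (h x)\<^sup>2) = (\<lambda>x. x ^ 4 - 2 * x\<^sup>2 + 1)"
    unfolding h_def by (auto simp: power2_eq_square power4_eq_xxxx algebra_simps)
  have hi2: "integrable M (\<lambda>\<omega>. (h (\<eta> n \<omega>))\<^sup>2)" for n
    using noise_moments(1)[of n 4] noise_square_integrable[of n] by (simp add: fun_cong[OF h2])
  have hC: "expectation (\<lambda>\<omega>. (h (\<eta> n \<omega>))\<^sup>2) = C" for n
    unfolding C_def distr_noise[of n, symmetric] by (subst integral_distr) auto
  define S where "S = (\<lambda>n \<omega>. \<Sum>i<n. h (\<eta> i \<omega>))"
  have Sp: "S n \<in> borel_measurable (past n)" for n
    unfolding S_def by (intro borel_measurable_sum measurable_compose[OF noise_past_measurable h]) auto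
  have S: "integrable M (\<lambda>\<omega>. (S n \<omega>)\<^sup>2) \<and> integrable M (S n) \<and> expectation (\<lambda>\<omega>. (S n \<omega>)\<^sup>2) = C * real n" for n
  proof (induction n)
    case 0 then show ?case by (simp add: S_def)
  next
    case (Suc n)
    note a = integral_past_noise[OF Sp, of n, OF _ h hi, unfolded h0]
    have eq: "(\<lambda>\<omega>. (S (Suc n) \<omega>)\<^sup>2) = (\<lambda>\<omega>. (S n \<omega>)\<^sup>2 + 2 * (S n \<omega> * h (\<eta> n \<omega>)) + (h (\<eta> n \<omega>))\<^sup>2)"
      unfolding S_def by (rule ext) (simp add: power2_eq_square algebra_simps)
    have "integrable M (S (Suc n))" unfolding S_def using hi by simp
    then show ?case unfolding eq using a Suc hi2 hC by (simp add: algebra_simps)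
  qed
  have "AE \<omega> in M. (\<lambda>j. (S ((j+1)\<^sup>2) \<omega> / real ((j+1)\<^sup>2))\<^sup>2) \<longlonglongrightarrow> 0"
  proof (rule AE_tendsto_0_of_summable_integral)
    show "integrable M (\<lambda>\<omega>. (S ((j+1)\<^sup>2) \<omega> / real ((j+1)\<^sup>2))\<^sup>2)" for j
      using S[of "(j+1)\<^sup>2"] by (simp add: power_divide)
    have "expectation (\<lambda>\<omega>. (S ((j+1)\<^sup>2) \<omega> / real ((j+1)\<^sup>2))\<^sup>2) = C * (1 / (real (Suc j))\<^sup>2)" for j
    proof -
      have r: "real ((j+1)\<^sup>2) = (real (Suc j))\<^sup>2" by simp
      have "expectation (\<lambda>\<omega>. (S ((j+1)\<^sup>2) \<omega> / real ((j+1)\<^sup>2))\<^sup>2) = C * real ((j+1)\<^sup>2) / (real ((j+1)\<^sup>2))\<^sup>2"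
        using S[of "(j+1)\<^sup>2"] by (simp only: power_divide integral_divide_zero)
      also have "\<dots> = C * (1 / (real (Suc j))\<^sup>2)" unfolding r by (simp add: power2_eq_square del: of_nat_Suc)
      finally show ?thesis .
    qed
    moreover have "summable (\<lambda>j. C * (1 / (real (Suc j))\<^sup>2))"
      by (rule summable_mult) (use sums_summable[OF inverse_squares_sums] in \<open>simp add: add.commute\<close>)
    ultimately show "summable (\<lambda>j. expectation (\<lambda>\<omega>. (S ((j+1)\<^sup>2) \<omega> / real ((j+1)\<^sup>2))\<^sup>2))" by simp
  qed simp
  then show ?thesis
  proof eventually_elim
    case (elim \<omega>)
    define R where "R = (\<lambda>n. \<Sum>i<n. (\<eta> i \<omega>)\<^sup>2)"
    have Rm: "R m \<le> R n" if "m \<le> n" for m n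
      unfolding R_def by (rule sum_mono2) (use that in auto)
    have RS: "R n = S n \<omega> + real n" for n unfolding R_def S_def h_def by (simp add: sum_subtractf)
    have "(\<lambda>j. S ((j+1)\<^sup>2) \<omega> / real ((j+1)\<^sup>2)) \<longlonglongrightarrow> 0"
      using elim tendsto_power_zero[of _ sequentially] by (simp add: power_tendsto_0_iff)
    then have "(\<lambda>j. S (j\<^sup>2) \<omega> / real (j\<^sup>2)) \<longlonglongrightarrow> 0"
      by (subst (asm) filterlim_sequentially_Suc[where f = "\<lambda>j. S (j\<^sup>2) \<omega> / real (j\<^sup>2)", unfolded Suc_eq_plus1])
    then have "(\<lambda>j. S (j\<^sup>2) \<omega> / real (j\<^sup>2) + 1) \<longlonglongrightarrow> 0 + 1" by (intro tendsto_intros)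
    moreover have "\<forall>\<^sub>F j in sequentially. S (j\<^sup>2) \<omega> / real (j\<^sup>2) + 1 = R (j\<^sup>2) / real (j\<^sup>2)"
      using eventually_gt_at_top[of 0] by eventually_elim (simp add: RS field_simps)
    ultimately have lim: "(\<lambda>j. R (j\<^sup>2) / real (j\<^sup>2)) \<longlonglongrightarrow> 1"
      by (simp add: tendsto_cong)
    \<comment> \<open>The integer root: q^2 \<le> n \<le> (q+1)^2, with both ends asymptotic to
      n.\<close>
    define q where "q = (\<lambda>n::nat. nat \<lfloor>sqrt (real n)\<rfloor>)"
    have q_top: "filterlim q at_top sequentially" unfolding q_def by real_asymp
    have q1_top: "filterlim (\<lambda>n. q n + 1) at_top sequentially" unfolding q_def by real_asymp
    have qn: "(q n)\<^sup>2 \<le> n" "n \<le> (q n + 1)\<^sup>2" for n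
    proof -
      have "real (q n) \<le> sqrt (real n)" "sqrt (real n) \<le> real (q n) + 1" unfolding q_def by simp_all
      then have "(real (q n))\<^sup>2 \<le> (sqrt (real n))\<^sup>2" "(sqrt (real n))\<^sup>2 \<le> (real (q n) + 1)\<^sup>2"
        using power_mono[of "real (q n)" "sqrt (real n)" 2] power_mono[of "sqrt (real n)" "real (q n) + 1" 2] by simp_all
      then have "real ((q n)\<^sup>2) \<le> real n" "real n \<le> real ((q n + 1)\<^sup>2)" by (simp_all add: add.commute)
      then show "(q n)\<^sup>2 \<le> n" "n \<le> (q n + 1)\<^sup>2" by (simp_all only: of_nat_le_iff)
    qed
    have l1: "(\<lambda>n. R ((q n)\<^sup>2) / real ((q n)\<^sup>2) * (real ((q n)\<^sup>2) / real n)) \<longlonglongrightarrow> 1 * 1"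
    proof (rule tendsto_mult)
      show "(\<lambda>n. R ((q n)\<^sup>2) / real ((q n)\<^sup>2)) \<longlonglongrightarrow> 1" by (rule filterlim_compose[OF lim q_top])
      show "(\<lambda>n. real ((q n)\<^sup>2) / real n) \<longlonglongrightarrow> 1" unfolding q_def of_nat_power by real_asymp
    qed
    have l2: "(\<lambda>n. R ((q n + 1)\<^sup>2) / real ((q n + 1)\<^sup>2) * (real ((q n + 1)\<^sup>2) / real n)) \<longlonglongrightarrow> 1 * 1"
    proof (rule tendsto_mult)
      show "(\<lambda>n. R ((q n + 1)\<^sup>2) / real ((q n + 1)\<^sup>2)) \<longlonglongrightarrow> 1" by (rule filterlim_compose[OF lim q1_top])
      show "(\<lambda>n. real ((q n + 1)\<^sup>2) / real n) \<longlonglongrightarrow> 1" unfolding q_def of_nat_power of_nat_add by real_asymp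
    qed
    have "(\<lambda>n. R n / real n) \<longlonglongrightarrow> 1"
    proof (rule tendsto_sandwich)
      show "(\<lambda>n. R ((q n)\<^sup>2) / real ((q n)\<^sup>2) * (real ((q n)\<^sup>2) / real n)) \<longlonglongrightarrow> 1" using l1 by simp
      show "(\<lambda>n. R ((q n + 1)\<^sup>2) / real ((q n + 1)\<^sup>2) * (real ((q n + 1)\<^sup>2) / real n)) \<longlonglongrightarrow> 1" using l2 by simp
      have ev: "\<forall>\<^sub>F n in sequentially. 1 \<le> q n" using q_top by (simp add: filterlim_at_top)
      show "\<forall>\<^sub>F n in sequentially. R ((q n)\<^sup>2) / real ((q n)\<^sup>2) * (real ((q n)\<^sup>2) / real n) \<le> R n / real n"
        using ev
      proof eventually_elim
        case (elim n)
        then have "R ((q n)\<^sup>2) / real ((q n)\<^sup>2) * (real ((q n)\<^sup>2) / real n) = R ((q n)\<^sup>2) / real n" by simp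
        also have "\<dots> \<le> R n / real n" by (rule divide_right_mono[OF Rm[OF qn(1)]]) simp
        finally show ?case .
      qed
      show "\<forall>\<^sub>F n in sequentially. R n / real n \<le> R ((q n + 1)\<^sup>2) / real ((q n + 1)\<^sup>2) * (real ((q n + 1)\<^sup>2) / real n)"
      proof (intro always_eventually allI)
        fix n
        have "real ((q n + 1)\<^sup>2) \<noteq> 0" by simp
        then have "R ((q n + 1)\<^sup>2) / real ((q n + 1)\<^sup>2) * (real ((q n + 1)\<^sup>2) / real n) = R ((q n + 1)\<^sup>2) / real n"
          by (simp del: of_nat_power of_nat_add)
        then show "R n / real n \<le> R ((q n + 1)\<^sup>2) / real ((q n + 1)\<^sup>2) * (real ((q n + 1)\<^sup>2) / real n)"
          using divide_right_mono[OF Rm[OF qn(2)], of "real n" n] by simp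
      qed
    qed
    then show ?case by (simp add: R_def)
  qed
qed

end

section \<open>Quadratic forms in the noise\<close>

text \<open>The causal moving average x_i = sum over d < i of c_d e_{i-1-d}, with zero noise before
  time 0. The smallest lag is 1, so x_i depends on the noise strictly before i and can serve as a
  predictable integrand.\<close>

definition lin_proc :: "(nat \<Rightarrow> real) \<Rightarrow> (nat \<Rightarrow> real) \<Rightarrow> nat \<Rightarrow> real" where
  "lin_proc c e i = (\<Sum>j<i. c (i - 1 - j) * e j)"

definition quad_form :: "(nat \<Rightarrow> real) \<Rightarrow> nat \<Rightarrow> (nat \<Rightarrow> real) \<Rightarrow> real" where
  "quad_form c n e = (\<Sum>i<n. lin_proc c e i * e i)"

lemma lin_proc_cong: "(\<And>j. j < i \<Longrightarrow> e j = e' j) \<Longrightarrow> lin_proc c e i = lin_proc c e' i"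
  unfolding lin_proc_def by (rule sum.cong) auto

lemma quad_form_cong: "(\<And>j. j < n \<Longrightarrow> e j = e' j) \<Longrightarrow> quad_form c n e = quad_form c n e'"
  unfolding quad_form_def by (intro sum.cong refl arg_cong2[where f = times] lin_proc_cong) auto

lemma quad_form_measurable:
  assumes "\<And>i. i < n \<Longrightarrow> f i \<in> borel_measurable N"
  shows "(\<lambda>x. quad_form c n (\<lambda>i. f i x)) \<in> borel_measurable N"
  unfolding quad_form_def lin_proc_def
  by (intro borel_measurable_sum borel_measurable_times borel_measurable_const assms) auto

text \<open>The second Borel-Cantelli lemma, for events read off independent variables that may live
  in different spaces. Since 1 - p \<le> exp(-p), a positive probability that nothing happens from m
  on would bound the sums of the probabilities from m on by minus its logarithm.\<close>

lemma (in prob_space) borel_cantelli_indep: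
  assumes ind: "indep_vars N X UNIV" and B: "\<And>k::nat. B k \<in> sets (N k)"
    and ns: "\<not> summable (\<lambda>k. prob (X k -` B k \<inter> space M))"
  shows "AE \<omega> in M. \<exists>\<^sub>F k in sequentially. X k \<omega> \<in> B k"
proof -
  define p where "p = (\<lambda>k. prob (X k -` B k \<inter> space M))"
  have X [measurable]: "X k \<in> measurable M (N k)" for k using ind by (auto simp: indep_vars_def)
  have XB: "X k -` B k \<inter> space M \<in> sets M" for k by (rule measurable_sets[OF X B])
  have p01: "0 \<le> p k" "p k \<le> 1" for k unfolding p_def by auto
  define F where "F = (\<lambda>m. \<Inter>k\<in>{m..}. X k -` (space (N k) - B k) \<inter> space M)"
  have Fs: "F m \<in> sets M" for m
    unfolding F_def by (intro sets.countable_INT') (auto intro!: measurable_sets[OF X] B)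
  have pc: "prob (X k -` (space (N k) - B k) \<inter> space M) = 1 - p k" for k
  proof -
    have "X k -` (space (N k) - B k) \<inter> space M = space M - (X k -` B k \<inter> space M)"
      using measurable_space[OF X] by auto
    then show ?thesis using prob_compl[OF XB] by (simp add: p_def)
  qed
  have bound: "prob (F m) \<le> exp (- (\<Sum>k\<in>{m..<n}. p k))" if "m < n" for m n
  proof -
    have "prob (F m) \<le> prob (\<Inter>k\<in>{m..<n}. X k -` (space (N k) - B k) \<inter> space M)"
    proof (rule finite_measure_mono)
      show "F m \<subseteq> (\<Inter>k\<in>{m..<n}. X k -` (space (N k) - B k) \<inter> space M)"
        unfolding F_def by (rule INF_superset_mono) auto
      show "(\<Inter>k\<in>{m..<n}. X k -` (space (N k) - B k) \<inter> space M) \<in> sets M"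
        by (rule sets.finite_INT) (use that in \<open>auto intro!: measurable_sets[OF X] B\<close>)
    qed
    also have "\<dots> = (\<Prod>k\<in>{m..<n}. prob (X k -` (space (N k) - B k) \<inter> space M))"
      by (rule indep_varsD[OF ind]) (use that B in auto)
    also have "\<dots> \<le> (\<Prod>k\<in>{m..<n}. exp (- p k))"
      unfolding pc using p01 exp_ge_add_one_self[of "- p k" for k] by (intro prod_mono) auto
    also have "\<dots> = exp (- (\<Sum>k\<in>{m..<n}. p k))" by (simp add: exp_sum sum_negf[symmetric])
    finally show ?thesis .
  qed
  have F0: "prob (F m) = 0" for m
  proof (rule ccontr)
    assume "prob (F m) \<noteq> 0"
    then have pos: "prob (F m) > 0" by (simp add: zero_less_measure_iff)
    have "summable p"
    proof (rule summableI_nonneg_bounded)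
      fix n
      show "0 \<le> p n" by (rule p01)
      have "(\<Sum>k<n. p k) \<le> (\<Sum>k<m. p k) + (\<Sum>k\<in>{m..<Suc (n + m)}. p k)"
      proof -
        have "(\<Sum>k<n. p k) \<le> (\<Sum>k<Suc (n + m). p k)" by (rule sum_mono2) (use p01 in auto)
        also have "\<dots> = (\<Sum>k<m. p k) + (\<Sum>k\<in>{m..<Suc (n + m)}. p k)"
          using sum.atLeastLessThan_concat[of 0 m "Suc (n + m)" p] by (simp add: lessThan_atLeast0)
        finally show ?thesis .
      qed
      also have "(\<Sum>k\<in>{m..<Suc (n + m)}. p k) \<le> - ln (prob (F m))"
      proof -
        have "ln (prob (F m)) \<le> ln (exp (- (\<Sum>k\<in>{m..<Suc (n + m)}. p k)))"
          using bound[of m "Suc (n + m)"] pos by (subst ln_le_cancel_iff) auto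
        then show ?thesis by simp
      qed
      finally show "(\<Sum>k<n. p k) \<le> (\<Sum>k<m. p k) - ln (prob (F m))" by simp
    qed
    then show False using ns by (simp add: p_def)
  qed
  have "AE \<omega> in M. \<omega> \<notin> F m" for m
    using Fs F0[of m] by (intro AE_not_in) (auto simp: null_sets_def emeasure_eq_measure)
  then have "AE \<omega> in M. \<forall>m. \<omega> \<notin> F m" by (simp add: AE_all_countable)
  with AE_space show ?thesis
  proof eventually_elim
    case (elim \<omega>)
    show ?case unfolding frequently_sequentially
    proof
      fix m
      from elim(2) obtain k where "k \<ge> m" "X k \<omega> \<notin> space (N k) - B k"
        unfolding F_def using elim(1) by auto
      then show "\<exists>k\<ge>m. X k \<omega> \<in> B k" using measurable_space[OF X elim(1), of k] by auto
    qed
  qed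
qed

context gaussian_noise
begin

section \<open>Forms over disjoint windows of the noise\<close>

lemma indep_noise_shift: "indep_vars (\<lambda>_. borel) (\<lambda>i. \<eta> (a + i)) UNIV"
proof -
  have "indep_vars (\<lambda>i. PiM {a + i} (\<lambda>_. borel)) (\<lambda>i \<omega>. restrict (\<lambda>j. \<eta> j \<omega>) {a + i}) UNIV"
    by (rule indep_vars_restrict[OF indep_noise]) (auto simp: disjoint_family_on_def)
  from indep_vars_compose2[OF this, of "\<lambda>i x. x (a + i)" "\<lambda>_. borel"]
  show ?thesis by (simp add: measurable_component_singleton)
qed

lemma distr_noise_block:
  assumes "n > 0"
  shows "distr M (PiM {..<n} (\<lambda>_. borel)) (\<lambda>\<omega>. \<lambda>i\<in>{..<n}. \<eta> (a + i) \<omega>) = PiM {..<n} (\<lambda>_. std_normal_distribution)"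
proof -
  have "indep_vars (\<lambda>_. borel) (\<lambda>i. \<eta> (a + i)) {..<n}"
    by (rule indep_vars_subset[OF indep_noise_shift]) auto
  moreover have "{..<n} \<noteq> {}" using assms by auto
  ultimately show ?thesis by (subst (asm) indep_vars_iff_distr_eq_PiM) (auto simp: distr_noise)
qed

text \<open>The filter is restarted at a without memory of earlier noise. Hence forms over disjoint
  windows are independent, and all windows of one length give the same law.\<close>

definition block_form :: "(nat \<Rightarrow> real) \<Rightarrow> nat \<Rightarrow> nat \<Rightarrow> 'a \<Rightarrow> real" where
  "block_form c a n \<omega> = quad_form c n (\<lambda>i. \<eta> (a + i) \<omega>)"

lemma block_form_measurable [measurable]: "block_form c a n \<in> borel_measurable M"
  unfolding block_form_def[abs_def] by (rule quad_form_measurable) simp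

lemma distr_block_form: "distr M borel (block_form c a n) = distr M borel (block_form c 0 n)"
proof (cases "n = 0")
  case True
  then show ?thesis by (simp add: block_form_def[abs_def] quad_form_def)
next
  case False
  have m: "quad_form c n \<in> borel_measurable (PiM {..<n} (\<lambda>_. borel))"
    using quad_form_measurable[of n "\<lambda>i x. x i" "PiM {..<n} (\<lambda>_. borel)" c]
    by (simp add: measurable_component_singleton)
  have "distr M borel (block_form c a n) = distr (PiM {..<n} (\<lambda>_. std_normal_distribution)) borel (quad_form c n)" for a
  proof -
    have "block_form c a n = (\<lambda>\<omega>. quad_form c n (\<lambda>i\<in>{..<n}. \<eta> (a + i) \<omega>))"
      unfolding block_form_def by (intro ext quad_form_cong) auto
    then show ?thesis
      using False unfolding distr_noise_block[of n a, OF False[unfolded neq0_conv], symmetric] by (subst distr_distr) (auto simp: m comp_def)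
  qed
  from this[of a] this[of 0] show ?thesis by simp
qed

lemma indep_block_forms: "indep_vars (\<lambda>_. borel) (\<lambda>l. block_form c (a + l * L) L) UNIV"
proof -
  let ?K = "\<lambda>l. {a + l * L..<a + l * L + L}"
  have "disjoint_family_on ?K UNIV"
    unfolding disjoint_family_on_def
  proof (intro ballI impI)
    fix l m :: nat assume "l \<noteq> m"
    have "?K l \<inter> ?K m = {}" if "l < m" for l m :: nat
    proof -
      have "Suc l * L \<le> m * L" using that by (intro mult_right_mono) auto
      then show ?thesis by auto
    qed
    from this[of l m] this[of m l] \<open>l \<noteq> m\<close> show "?K l \<inter> ?K m = {}" by (cases "l < m") auto
  qed
  then have "indep_vars (\<lambda>l. PiM (?K l) (\<lambda>_. borel)) (\<lambda>l \<omega>. restrict (\<lambda>j. \<eta> j \<omega>) (?K l)) UNIV"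
    by (intro indep_vars_restrict[OF indep_noise]) auto
  then have "indep_vars (\<lambda>_. borel) (\<lambda>l \<omega>. quad_form c L (\<lambda>i. restrict (\<lambda>j. \<eta> j \<omega>) (?K l) (a + l * L + i))) UNIV"
    by (rule indep_vars_compose2[where Y = "\<lambda>l x. quad_form c L (\<lambda>i. x (a + l * L + i))"])
      (auto intro!: quad_form_measurable measurable_component_singleton)
  moreover have "quad_form c L (\<lambda>i. restrict (\<lambda>j. \<eta> j \<omega>) (?K l) (a + l * L + i)) = block_form c (a + l * L) L \<omega>" for l \<omega>
    unfolding block_form_def by (rule quad_form_cong) auto
  ultimately show ?thesis by simp
qed

lemma martingale_mean:
  assumes u: "\<And>i. i < n \<Longrightarrow> u i \<in> borel_measurable (past i)"
    and ui: "\<And>i. i < n \<Longrightarrow> integrable M (\<lambda>\<omega>. (u i \<omega>)\<^sup>2)"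
  shows "expectation (\<lambda>\<omega>. \<Sum>i<n. u i \<omega> * \<eta> i \<omega>) = 0"
proof -
  have 1: "integrable M (u i)" if "i < n" for i
    using integrable_mult_of_square[OF past_measurable[OF u[OF that]] borel_measurable_const ui[OF that], of 1]
    by simp
  have "integrable M (\<lambda>\<omega>. u i \<omega> * \<eta> i \<omega>) \<and> expectation (\<lambda>\<omega>. u i \<omega> * \<eta> i \<omega>) = 0" if "i < n" for i
    using integral_past_noise[OF u[OF that] 1[OF that], of "\<lambda>x. x"] noise_integrable[of i] noise_mean[of i] by simp
  then show ?thesis by (subst Bochner_Integration.integral_sum) auto
qed

lemma noise_combination:
  shows "(\<lambda>\<omega>. \<Sum>j<i. a j * \<eta> j \<omega>) \<in> borel_measurable (past i)"
    and "integrable M (\<lambda>\<omega>. (\<Sum>j<i. a j * \<eta> j \<omega>)\<^sup>2)"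
    and "expectation (\<lambda>\<omega>. (\<Sum>j<i. a j * \<eta> j \<omega>)\<^sup>2) = (\<Sum>j<i. (a j)\<^sup>2)"
  using past_martingale_sum[of i "\<lambda>j _. a j"] martingale_isometry[of i "\<lambda>j _. a j"] by (auto simp: prob_space)

lemma block_form_0: "block_form c 0 n = (\<lambda>\<omega>. \<Sum>i<n. lin_proc c (\<lambda>j. \<eta> j \<omega>) i * \<eta> i \<omega>)"
  by (simp add: block_form_def quad_form_def fun_eq_iff)

lemma sum_lessThan_shift: "(\<Sum>j<i. f (i - 1 - j)) = (\<Sum>d<i. f d)" for f :: "nat \<Rightarrow> real"
  by (rule sum.reindex_bij_witness[of _ "\<lambda>d. i - 1 - d" "\<lambda>j. i - 1 - j"]) auto

text \<open>Computed at a = 0 from the isometry and carried to other windows by equality in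
  law.\<close>

lemma block_form_moments:
  shows "integrable M (\<lambda>\<omega>. (block_form c a n \<omega>)\<^sup>2)"
    and "expectation (block_form c a n) = 0"
    and "expectation (\<lambda>\<omega>. (block_form c a n \<omega>)\<^sup>2) = (\<Sum>i<n. \<Sum>d<i. (c d)\<^sup>2)"
proof -
  let ?u = "\<lambda>i \<omega>. \<Sum>j<i. c (i - 1 - j) * \<eta> j \<omega>"
  have u: "?u i \<in> borel_measurable (past i)" "integrable M (\<lambda>\<omega>. (?u i \<omega>)\<^sup>2)"
    "expectation (\<lambda>\<omega>. (?u i \<omega>)\<^sup>2) = (\<Sum>j<i. (c (i - 1 - j))\<^sup>2)" for i
    by (fact noise_combination[of "\<lambda>j. c (i - 1 - j)" i])+
  note u3 = u(3)[unfolded sum_lessThan_shift[of "\<lambda>d. (c d)\<^sup>2"]]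
  have e0: "block_form c 0 n = (\<lambda>\<omega>. \<Sum>i<n. ?u i \<omega> * \<eta> i \<omega>)" by (simp add: block_form_0 lin_proc_def)
  have 0: "integrable M (\<lambda>\<omega>. (block_form c 0 n \<omega>)\<^sup>2)" "expectation (block_form c 0 n) = 0"
    "expectation (\<lambda>\<omega>. (block_form c 0 n \<omega>)\<^sup>2) = (\<Sum>i<n. \<Sum>d<i. (c d)\<^sup>2)"
    unfolding e0 using martingale_isometry[of n ?u, OF u(1,2), unfolded u3] martingale_mean[of n ?u, OF u(1,2)]
    by blast+
  have "integrable (distr M borel (block_form c 0 n)) (\<lambda>x. x\<^sup>2)" using 0(1) by (subst integrable_distr_eq) auto
  then show "integrable M (\<lambda>\<omega>. (block_form c a n \<omega>)\<^sup>2)"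
    unfolding distr_block_form[of c a n, symmetric] by (subst (asm) integrable_distr_eq) auto
  have "expectation (\<lambda>\<omega>. f (block_form c a n \<omega>)) = expectation (\<lambda>\<omega>. f (block_form c 0 n \<omega>))"
    if [measurable]: "f \<in> borel_measurable borel" for f :: "real \<Rightarrow> real"
  proof -
    have e: "expectation (\<lambda>\<omega>. f (block_form c a n \<omega>)) = integral\<^sup>L (distr M borel (block_form c a n)) f" for a
      by (subst integral_distr) auto
    show ?thesis unfolding e[of a] e[of 0] distr_block_form[of c a n] ..
  qed
  from this[of "\<lambda>x. x"] this[of "\<lambda>x. x\<^sup>2"] show "expectation (block_form c a n) = 0"
    "expectation (\<lambda>\<omega>. (block_form c a n \<omega>)\<^sup>2) = (\<Sum>i<n. \<Sum>d<i. (c d)\<^sup>2)" using 0 by auto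
qed

lemma sum_consecutive_groups:
  fixes G :: "nat \<Rightarrow> real"
  assumes "a + n * L \<le> t" and "\<And>i. i < t \<Longrightarrow> i < a \<or> a + n * L \<le> i \<Longrightarrow> G i = 0"
  shows "(\<Sum>i<t. G i) = (\<Sum>l<n. \<Sum>r<L. G (a + l * L + r))"
proof -
  have "(\<Sum>i<t. G i) = (\<Sum>i\<in>{a..<a + n * L}. G i)"
    by (rule sum.mono_neutral_right) (use assms in auto)
  also have "\<dots> = (\<Sum>i<n * L. G (a + i))"
    by (rule sum.reindex_bij_witness[of _ "\<lambda>i. a + i" "\<lambda>i. i - a"]) auto
  also have "\<dots> = (\<Sum>l<n. \<Sum>i\<in>{l * L..<l * L + L}. G (a + i))" by (rule sum.nat_group[symmetric])
  also have "\<dots> = (\<Sum>l<n. \<Sum>r<L. G (a + l * L + r))"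
  proof (rule sum.cong)
    fix l
    show "(\<Sum>i\<in>{l * L..<l * L + L}. G (a + i)) = (\<Sum>r<L. G (a + l * L + r))"
      by (rule sum.reindex_bij_witness[of _ "\<lambda>r. l * L + r" "\<lambda>i. i - l * L"]) (auto simp: add.assoc)
  qed simp
  finally show ?thesis .
qed

text \<open>The products \<open>\<eta> j * \<eta> i\<close> with \<open>j < i\<close> are orthonormal, so splitting off the blocks
  costs exactly the squared coefficients of the pairs that are not contained in a block.\<close>

lemma block_remainder:
  assumes t: "a + n * L \<le> t" and s2: "\<And>r. (\<Sum>d<r. (c d)\<^sup>2) \<le> s2"
  defines "R \<equiv> \<lambda>\<omega>. block_form c 0 t \<omega> - (\<Sum>l<n. block_form c (a + l * L) L \<omega>)"
  shows "integrable M (\<lambda>\<omega>. (R \<omega>)\<^sup>2)"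
    and "expectation (\<lambda>\<omega>. (R \<omega>)\<^sup>2) \<le> real t * s2 - real n * (\<Sum>i<L. \<Sum>d<i. (c d)\<^sup>2)"
proof -
  \<comment> \<open>The left end of the block containing i, and i itself outside the blocks. A pair
    j < i lies in one block iff \<open>b i \<le> j\<close>; \<open>q\<close> below keeps the
    coefficients of all other pairs.\<close>
  define b where "b = (\<lambda>i. if i < a \<or> a + n * L \<le> i then i else a + ((i - a) div L) * L)"
  have b_le: "b i \<le> i" for i
  proof (cases "i < a \<or> a + n * L \<le> i")
    case False
    have "((i - a) div L) * L \<le> i - a" by (rule div_times_less_eq_dividend)
    then have "a + ((i - a) div L) * L \<le> i" using False by linarith
    then show ?thesis using False by (simp add: b_def)
  qed (auto simp: b_def)
  have b_grp: "b (a + l * L + r) = a + l * L" if "l < n" "r < L" for l r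
  proof -
    have "Suc l * L \<le> n * L" using that by (intro mult_right_mono) auto
    then have "\<not> (a + l * L + r < a \<or> a + n * L \<le> a + l * L + r)" using that by auto
    moreover have "(a + l * L + r - a) div L = l" using that by (simp add: add.assoc)
    ultimately show ?thesis by (simp add: b_def)
  qed
  define q where "q = (\<lambda>i j. if j < b i then c (i - 1 - j) else 0)"
  let ?u = "\<lambda>i \<omega>. \<Sum>j<i. q i j * \<eta> j \<omega>"
  have Req: "R = (\<lambda>\<omega>. \<Sum>i<t. ?u i \<omega> * \<eta> i \<omega>)"
  proof
    fix \<omega>
    define G where "G = (\<lambda>i. (\<Sum>j\<in>{b i..<i}. c (i - 1 - j) * \<eta> j \<omega>) * \<eta> i \<omega>)"
    have "(\<Sum>i<t. G i) = (\<Sum>l<n. \<Sum>r<L. G (a + l * L + r))"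
      by (rule sum_consecutive_groups[OF t]) (auto simp: G_def b_def)
    also have "\<dots> = (\<Sum>l<n. block_form c (a + l * L) L \<omega>)"
      unfolding block_form_def quad_form_def lin_proc_def
    proof (intro sum.cong refl)
      fix l r assume lr: "l \<in> {..<n}" "r \<in> {..<L}"
      have "(\<Sum>j\<in>{a + l * L..<a + l * L + r}. c (a + l * L + r - 1 - j) * \<eta> j \<omega>) = (\<Sum>j<r. c (r - 1 - j) * \<eta> (a + l * L + j) \<omega>)"
        by (rule sum.reindex_bij_witness[of _ "\<lambda>j. a + l * L + j" "\<lambda>j. j - (a + l * L)"])
          (auto simp: le_iff_add add.assoc add.left_commute)
      then show "G (a + l * L + r) = (\<Sum>j<r. c (r - 1 - j) * \<eta> (a + l * L + j) \<omega>) * \<eta> (a + l * L + r) \<omega>"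
        using b_grp[of l r] lr by (simp add: G_def)
    qed
    finally have 1: "(\<Sum>l<n. block_form c (a + l * L) L \<omega>) = (\<Sum>i<t. G i)" ..
    have 2: "lin_proc c (\<lambda>j. \<eta> j \<omega>) i * \<eta> i \<omega> - G i = ?u i \<omega> * \<eta> i \<omega>" for i
    proof -
      have "lin_proc c (\<lambda>j. \<eta> j \<omega>) i = (\<Sum>j<b i. c (i - 1 - j) * \<eta> j \<omega>) + (\<Sum>j\<in>{b i..<i}. c (i - 1 - j) * \<eta> j \<omega>)"
        unfolding lin_proc_def using sum.atLeastLessThan_concat[OF _ b_le, of 0 i "\<lambda>j. c (i - 1 - j) * \<eta> j \<omega>"] by (simp add: lessThan_atLeast0)
      moreover have "?u i \<omega> = (\<Sum>j<b i. c (i - 1 - j) * \<eta> j \<omega>)"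
        unfolding q_def using b_le[of i] by (intro sum.mono_neutral_cong_right) auto
      ultimately show ?thesis by (simp add: G_def algebra_simps)
    qed
    show "R \<omega> = (\<Sum>i<t. ?u i \<omega> * \<eta> i \<omega>)"
      unfolding R_def 1 block_form_0 sum_subtractf[symmetric] 2 ..
  qed
  have iso: "integrable M (\<lambda>\<omega>. (R \<omega>)\<^sup>2) \<and> expectation (\<lambda>\<omega>. (R \<omega>)\<^sup>2) = (\<Sum>i<t. \<Sum>j<i. (q i j)\<^sup>2)"
    unfolding Req using martingale_isometry[of t ?u, OF noise_combination(1,2)] by (simp add: noise_combination(3))
  then show "integrable M (\<lambda>\<omega>. (R \<omega>)\<^sup>2)" by simp
  \<comment> \<open>What row i loses to its block: \<open>i - b i\<close> is the position of i in
    the block, so these are its first \<open>i - b i\<close> squared coefficients.\<close>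
  define H where "H = (\<lambda>i. \<Sum>d<i - b i. (c d)\<^sup>2)"
  have "(\<Sum>j<i. (q i j)\<^sup>2) \<le> s2 - H i" for i
  proof -
    have "(\<Sum>d<i. (c d)\<^sup>2) = (\<Sum>j<i. (c (i - 1 - j))\<^sup>2)" by (rule sum_lessThan_shift[symmetric])
    also have "\<dots> = (\<Sum>j<b i. (c (i - 1 - j))\<^sup>2) + (\<Sum>j\<in>{b i..<i}. (c (i - 1 - j))\<^sup>2)"
      using sum.atLeastLessThan_concat[OF _ b_le, of 0 i "\<lambda>j. (c (i - 1 - j))\<^sup>2"] by (simp add: lessThan_atLeast0)
    also have "(\<Sum>j\<in>{b i..<i}. (c (i - 1 - j))\<^sup>2) = H i" unfolding H_def
      by (rule sum.reindex_bij_witness[of _ "\<lambda>d. i - 1 - d" "\<lambda>j. i - 1 - j"]) auto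
    also have "(\<Sum>j<b i. (c (i - 1 - j))\<^sup>2) = (\<Sum>j<i. (q i j)\<^sup>2)"
      unfolding q_def using b_le[of i] by (intro sum.mono_neutral_cong_left) auto
    finally show ?thesis using s2[of i] by simp
  qed
  then have "(\<Sum>i<t. \<Sum>j<i. (q i j)\<^sup>2) \<le> (\<Sum>i<t. s2 - H i)" by (intro sum_mono) auto
  also have "\<dots> = real t * s2 - (\<Sum>i<t. H i)" by (simp add: sum_subtractf)
  also have "(\<Sum>i<t. H i) = (\<Sum>l<n. \<Sum>r<L. H (a + l * L + r))"
    by (rule sum_consecutive_groups[OF t]) (auto simp: H_def b_def)
  also have "\<dots> = (\<Sum>l<n. \<Sum>r<L. \<Sum>d<r. (c d)\<^sup>2)"
    by (intro sum.cong refl) (simp add: H_def b_grp)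
  finally show "expectation (\<lambda>\<omega>. (R \<omega>)\<^sup>2) \<le> real t * s2 - real n * (\<Sum>i<L. \<Sum>d<i. (c d)\<^sup>2)"
    using iso by simp
qed

end

section \<open>The law of the iterated logarithm: lower bound\<close>

text \<open>On (x, x+1] the density is at least its value at x + 1, and sqrt(2 pi) \<le> 3.\<close>

lemma std_normal_tail: "measure std_normal_distribution {x<..} \<ge> exp (- (x + 1)\<^sup>2 / 2) / 3" if "x \<ge> 0"
proof -
  interpret prob_space std_normal_distribution
    using prob_space_normal_density[of 1 0] by simp
  let ?m = "exp (- (x + 1)\<^sup>2 / 2) / 3"
  have le: "?m \<le> std_normal_density y" if y: "y \<in> {x<..x+1}" for y
  proof -
    have "sqrt (2 * pi) \<le> sqrt (3\<^sup>2)" using pi_less_4 by (intro real_sqrt_le_mono) simp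
    then have s: "1 / 3 \<le> 1 / sqrt (2 * pi)" by (simp add: field_simps)
    have "y\<^sup>2 \<le> (x + 1)\<^sup>2" using y \<open>x \<ge> 0\<close> by (intro power_mono) auto
    then have "exp (- (x + 1)\<^sup>2 / 2) \<le> exp (- y\<^sup>2 / 2)" by simp
    then have "1 / 3 * exp (- (x + 1)\<^sup>2 / 2) \<le> 1 / sqrt (2 * pi) * exp (- y\<^sup>2 / 2)"
      by (intro mult_mono s) auto
    then show ?thesis by (simp add: std_normal_density_def)
  qed
  have "ennreal ?m = (\<integral>\<^sup>+y. ennreal ?m * indicator {x<..x+1} y \<partial>lborel)"
    by (subst nn_integral_cmult_indicator) auto
  also have "\<dots> \<le> (\<integral>\<^sup>+y. ennreal (std_normal_density y) * indicator {x<..} y \<partial>lborel)"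
    by (rule nn_integral_mono) (use le in \<open>auto split: split_indicator intro: ennreal_leI\<close>)
  also have "\<dots> = emeasure std_normal_distribution {x<..}"
    by (simp add: emeasure_density)
  finally show ?thesis by (simp add: emeasure_eq_measure)
qed

text \<open>A law with a density has no atoms. This lets weak convergence be read as convergence of
  the distribution functions at every level.\<close>

lemma std_normal_cdf_isCont: "isCont (cdf std_normal_distribution) x"
proof -
  interpret real_distribution std_normal_distribution by (rule real_dist_normal_dist)
  have "emeasure std_normal_distribution {x} = 0"
    by (subst emeasure_density) (auto simp: nn_integral_indicator_singleton')
  then show ?thesis unfolding isCont_cdf by (simp add: measure_def)
qed

context gaussian_noise
begin

lemma chebyshev_second_moment:
  assumes [measurable]: "X \<in> borel_measurable M" and i: "integrable M (\<lambda>\<omega>. (X \<omega>)\<^sup>2)" and "a > 0"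
  shows "prob {\<omega>\<in>space M. a < \<bar>X \<omega>\<bar>} \<le> expectation (\<lambda>\<omega>. (X \<omega>)\<^sup>2) / a\<^sup>2"
proof -
  have "prob {\<omega>\<in>space M. a < \<bar>X \<omega>\<bar>} \<le> prob {\<omega>\<in>space M. a\<^sup>2 \<le> (X \<omega>)\<^sup>2}"
  proof (rule finite_measure_mono)
    show "{\<omega>\<in>space M. a < \<bar>X \<omega>\<bar>} \<subseteq> {\<omega>\<in>space M. a\<^sup>2 \<le> (X \<omega>)\<^sup>2}"
      using \<open>a > 0\<close> abs_le_square_iff[of a] by fastforce
  qed measurable
  also have "\<dots> \<le> expectation (\<lambda>\<omega>. (X \<omega>)\<^sup>2) / a\<^sup>2"
    using \<open>a > 0\<close> by (intro integral_Markov_inequality_measure[OF i]) auto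
  finally show ?thesis .
qed

text \<open>The classical central limit theorem for independent identically distributed blocks, at
  one fixed level. The gap between the 3 of \<open>std_normal_tail\<close> and the 4 here absorbs
  the convergence.\<close>

lemma block_form_clt:
  fixes c :: "nat \<Rightarrow> real" and L :: nat
  defines "v \<equiv> (\<Sum>i<L. \<Sum>d<i. (c d)\<^sup>2)"
  assumes v: "v > 0" and x: "x \<ge> 0"
  shows "\<forall>\<^sub>F n in sequentially.
    exp (- (x + 1)\<^sup>2 / 2) / 4 \<le> prob {\<omega>\<in>space M. x * sqrt (real n * v) < (\<Sum>l<n. block_form c (l * L) L \<omega>)}"
proof -
  define W where "W = (\<lambda>l. block_form c (l * L) L)"
  have [measurable]: "W l \<in> borel_measurable M" for l unfolding W_def by simp
  have "weak_conv_m (\<lambda>n. distr M borel (\<lambda>\<omega>. (\<Sum>i<n. W i \<omega>) / sqrt (real n * (sqrt v)\<^sup>2))) std_normal_distribution"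
  proof (rule central_limit_theorem_zero_mean)
    show "indep_vars (\<lambda>i. borel) W UNIV"
      using indep_block_forms[of c 0 L] by (simp add: W_def)
    show "expectation (W n) = 0" for n unfolding W_def by (rule block_form_moments)
    show "integrable M (\<lambda>x. (W n x)\<^sup>2)" for n unfolding W_def by (rule block_form_moments)
    show "variance (W n) = (sqrt v)\<^sup>2" for n
      using v unfolding W_def by (simp add: block_form_moments v_def)
    show "distr M borel (W n) = distr M borel (block_form c 0 L)" for n
      unfolding W_def by (rule distr_block_form)
  qed (use v in simp)
  then have "weak_conv_m (\<lambda>n. distr M borel (\<lambda>\<omega>. (\<Sum>i<n. W i \<omega>) / sqrt (real n * v))) std_normal_distribution"
    using v by simp
  then have "(\<lambda>n. cdf (distr M borel (\<lambda>\<omega>. (\<Sum>i<n. W i \<omega>) / sqrt (real n * v))) x) \<longlonglongrightarrow> cdf std_normal_distribution x"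
    unfolding weak_conv_m_def weak_conv_def using std_normal_cdf_isCont by blast
  then have lim: "(\<lambda>n. 1 - cdf (distr M borel (\<lambda>\<omega>. (\<Sum>i<n. W i \<omega>) / sqrt (real n * v))) x) \<longlonglongrightarrow> 1 - cdf std_normal_distribution x"
    by (intro tendsto_intros)
  interpret nd: real_distribution std_normal_distribution by (rule real_dist_normal_dist)
  have "1 - cdf std_normal_distribution x = measure std_normal_distribution {x<..}"
  proof -
    have "measure std_normal_distribution (space std_normal_distribution - {..x}) = 1 - measure std_normal_distribution {..x}"
      by (rule nd.prob_compl) simp
    moreover have "space std_normal_distribution - {..x} = {x<..}" by auto
    ultimately show ?thesis by (simp add: cdf_def)
  qed
  also have "\<dots> \<ge> exp (- (x + 1)\<^sup>2 / 2) / 3" by (rule std_normal_tail[OF x])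
  finally have "1 - cdf std_normal_distribution x > exp (- (x + 1)\<^sup>2 / 2) / 4"
    using exp_gt_zero[of "- (x + 1)\<^sup>2 / 2"] by linarith
  from order_tendstoD(1)[OF lim this] show ?thesis using eventually_gt_at_top[of 0]
  proof eventually_elim
    case (elim n)
    have nv: "sqrt (real n * v) > 0" using elim v by simp
    let ?S = "\<lambda>\<omega>. (\<Sum>i<n. W i \<omega>) / sqrt (real n * v)"
    have "cdf (distr M borel ?S) x = prob (?S -` {..x} \<inter> space M)"
      unfolding cdf_def by (subst measure_distr) auto
    also have "1 - \<dots> = prob (space M - (?S -` {..x} \<inter> space M))"
      by (rule prob_compl[symmetric]) measurable
    also have "space M - (?S -` {..x} \<inter> space M) = {\<omega>\<in>space M. x * sqrt (real n * v) < (\<Sum>l<n. block_form c (l * L) L \<omega>)}"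
      using nv by (auto simp: W_def divide_le_eq not_le)
    finally show ?case using elim by simp
  qed
qed

text \<open>The normal tail of a quadratic form follows from the central limit theorem for the
  sum of its diagonal blocks of a fixed large length \<open>L\<close>: the remainder has small relative variance.\<close>

lemma quad_form_tail:
  assumes s2: "\<And>r. (\<Sum>d<r. (c d)\<^sup>2) \<le> s2" and s2_pos: "s2 > 0"
    and D: "\<And>L. real L * s2 - (\<Sum>r<L. \<Sum>d<r. (c d)\<^sup>2) \<le> D" and A: "A > 0"
  shows "\<forall>\<^sub>F g in sequentially.
    exp (- (A + 2)\<^sup>2 / 2) / 8 \<le> prob {\<omega>\<in>space M. A * sqrt (s2 * real g) \<le> block_form c 0 g \<omega>}"
proof -
  define h where "h = exp (- (A + 2)\<^sup>2 / 2)"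
  have h: "0 < h" "h \<le> 1" unfolding h_def by auto
  \<comment> \<open>The relative error allowed. The bound h/64 turns the Chebyshev estimate 8k for
    the remainder into at most h/8, half of the h/4 from the central limit theorem; the bound
    1/(2(A+1)) makes (A+1)(1-k) at least A + 1/2.\<close>
  define k where "k = min (h / 64) (1 / (2 * (A + 1)))"
  have k: "0 < k" "k \<le> h / 64" "k \<le> 1 / (2 * (A + 1))" "k < 1" using h A by (auto simp: k_def min_less_iff_disj)
  have D0: "D \<ge> 0" using D[of 0] by simp
  \<comment> \<open>Long blocks: the variance of each falls short of s2 L by at most D, hence by at
    most the fraction k.\<close>
  obtain L where L: "real L > D / (k * s2)" "L > 0"
  proof -
    obtain L where "real L > D / (k * s2)" using reals_Archimedean2 by blast
    moreover have "D / (k * s2) \<ge> 0" using D0 k s2_pos by simp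
    ultimately show ?thesis using that[of L] by (cases "L = 0") auto
  qed
  have DL: "D \<le> k * s2 * real L" using L k s2_pos by (simp add: field_simps)
  define v where "v = (\<Sum>i<L. \<Sum>d<i. (c d)\<^sup>2)"
  have vL: "v \<ge> (1 - k) * s2 * real L" using D[of L] DL unfolding v_def by (simp add: algebra_simps)
  have v0: "v > 0" 
  proof -
    have "(1 - k) * s2 * real L > 0" using L k s2_pos by (intro mult_pos_pos) auto
    then show ?thesis using vL by linarith
  qed
  have vle: "v \<le> s2 * real L"
    unfolding v_def using sum_mono[of "{..<L}" "\<lambda>i. \<Sum>d<i. (c d)\<^sup>2" "\<lambda>_. s2"] s2 by (simp add: mult.commute)
  have "\<forall>\<^sub>F n in sequentially. exp (- ((A + 1) + 1)\<^sup>2 / 2) / 4 \<le> prob {\<omega>\<in>space M. (A + 1) * sqrt (real n * v) < (\<Sum>l<n. block_form c (l * L) L \<omega>)}"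
    using v0 A unfolding v_def by (intro block_form_clt) auto
  then have clt: "\<forall>\<^sub>F n in sequentially. h / 4 \<le> prob {\<omega>\<in>space M. (A + 1) * sqrt (real n * v) < (\<Sum>l<n. block_form c (l * L) L \<omega>)}"
    by (simp add: h_def add.assoc)
  have div_top: "filterlim (\<lambda>g. g div L) at_top sequentially"
    unfolding filterlim_at_top eventually_sequentially
  proof
    fix Z show "\<exists>N. \<forall>n\<ge>N. Z \<le> n div L"
      using L by (intro exI[of _ "Z * L"]) (auto simp: less_eq_div_iff_mult_less_eq)
  qed
  obtain g0 where g0: "real g0 > real L / k" using reals_Archimedean2 by blast
  from eventually_compose_filterlim[OF clt div_top] eventually_ge_at_top[of g0] eventually_gt_at_top[of 0]
  show ?thesis
  proof eventually_elim
    case (elim g)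
    define n where "n = g div L"
    have nL: "n * L \<le> g" unfolding n_def by simp
    have "g < n * L + L" unfolding n_def using L(2) by (metis add.commute dividend_less_div_times mult.commute)
    then have gL: "real g - real L \<le> real n * real L" by (metis (mono_tags, opaque_lifting) diff_le_eq less_imp_le of_nat_add of_nat_le_iff of_nat_mult)
    have Lg: "real L \<le> k * real g"
    proof -
      have "real L / k \<le> real g" using g0 elim(2) by linarith
      then show ?thesis using k by (simp add: field_simps)
    qed
    define R where "R = (\<lambda>\<omega>. block_form c 0 g \<omega> - (\<Sum>l<n. block_form c (l * L) L \<omega>))"
    have [measurable]: "R \<in> borel_measurable M" unfolding R_def by measurable
    have nL': "0 + n * L \<le> g" using nL by simp
    have R: "integrable M (\<lambda>\<omega>. (R \<omega>)\<^sup>2)" "expectation (\<lambda>\<omega>. (R \<omega>)\<^sup>2) \<le> real g * s2 - real n * v"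
      using block_remainder[of 0 n L g c s2, OF nL' s2] unfolding R_def v_def by simp_all
    have g_pos: "real g > 0" using elim by simp
    \<comment> \<open>Half a standard deviation: the central limit theorem is used at level A + 1,
      of which 1/2 goes to the shortfall in variance and 1/2 to the remainder.\<close>
    let ?a = "sqrt (s2 * real g) / 2"
    have a: "?a > 0" using g_pos s2_pos by simp
    have a2: "?a\<^sup>2 = s2 * real g / 4" using g_pos s2_pos by (simp add: power_divide)
    have "expectation (\<lambda>\<omega>. (R \<omega>)\<^sup>2) \<le> 2 * k * s2 * real g"
    proof -
      have "real n * v \<ge> real n * ((1 - k) * s2 * real L)" using vL by (intro mult_left_mono) auto
      also have "real n * ((1 - k) * s2 * real L) = (1 - k) * s2 * (real n * real L)" by simp
      also have "\<dots> \<ge> (1 - k) * s2 * (real g - k * real g)"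
        using gL Lg k s2_pos by (intro mult_left_mono) auto
      finally have "real n * v \<ge> s2 * real g - 2 * k * s2 * real g + k * k * s2 * real g" by (simp add: algebra_simps)
      moreover have "k * k * s2 * real g \<ge> 0" using k s2_pos by simp
      ultimately show ?thesis using R(2) by (simp add: algebra_simps)
    qed
    then have "expectation (\<lambda>\<omega>. (R \<omega>)\<^sup>2) / ?a\<^sup>2 \<le> 8 * k"
      unfolding a2 using g_pos s2_pos by (simp add: divide_le_eq)
    with chebyshev_second_moment[OF \<open>R \<in> borel_measurable M\<close> R(1) a] have pR: "prob {\<omega>\<in>space M. ?a < \<bar>R \<omega>\<bar>} \<le> h / 8"
      using k by simp
    have main: "(A + 1) * sqrt (real n * v) \<ge> (A + 1 / 2) * sqrt (s2 * real g)"
    proof -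
      have kA: "(A + 1) * (1 - k) \<ge> A + 1 / 2"
      proof -
        have "(A + 1) * k \<le> 1 / 2" using k(3) A by (simp add: field_simps)
        then show ?thesis by (simp add: algebra_simps)
      qed
      have "(1 - k) * sqrt (s2 * real g) = sqrt ((1 - k)\<^sup>2 * (s2 * real g))" using k by (simp add: real_sqrt_mult)
      also have "\<dots> \<le> sqrt (real n * v)"
      proof (rule real_sqrt_le_mono)
        have "(1 - k)\<^sup>2 * (s2 * real g) = (1 - k) * s2 * (real g - k * real g)" by (simp add: power2_eq_square algebra_simps)
        also have "\<dots> \<le> (1 - k) * s2 * (real n * real L)"
          using gL Lg k s2_pos by (intro mult_left_mono) auto
        also have "\<dots> = real n * ((1 - k) * s2 * real L)" by simp
        also have "\<dots> \<le> real n * v" using vL by (intro mult_left_mono) auto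
        finally show "(1 - k)\<^sup>2 * (s2 * real g) \<le> real n * v" .
      qed
      finally have "(A + 1) * ((1 - k) * sqrt (s2 * real g)) \<le> (A + 1) * sqrt (real n * v)" using A by (intro mult_left_mono) auto
      moreover have "(A + 1 / 2) * sqrt (s2 * real g) \<le> (A + 1) * (1 - k) * sqrt (s2 * real g)"
        using kA g_pos s2_pos by (intro mult_right_mono) auto
      ultimately show ?thesis by (simp add: mult.assoc)
    qed
    let ?E = "{\<omega>\<in>space M. (A + 1) * sqrt (real n * v) < (\<Sum>l<n. block_form c (l * L) L \<omega>)}"
    let ?F = "{\<omega>\<in>space M. ?a < \<bar>R \<omega>\<bar>}"
    let ?G = "{\<omega>\<in>space M. A * sqrt (s2 * real g) \<le> block_form c 0 g \<omega>}"
    have "?E \<subseteq> ?G \<union> ?F"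
    proof
      fix \<omega> assume w: "\<omega> \<in> ?E"
      show "\<omega> \<in> ?G \<union> ?F"
      proof (cases "\<omega> \<in> ?F")
        case False
        then have "\<bar>R \<omega>\<bar> \<le> ?a" using w by auto
        moreover have "(\<Sum>l<n. block_form c (l * L) L \<omega>) \<ge> (A + 1 / 2) * sqrt (s2 * real g)" using w main by auto
        ultimately have "block_form c 0 g \<omega> \<ge> (A + 1 / 2) * sqrt (s2 * real g) - ?a" unfolding R_def by linarith
        then show ?thesis using w by (auto simp: algebra_simps)
      qed auto
    qed
    then have "prob ?E \<le> prob (?G \<union> ?F)" by (rule finite_measure_mono) measurable
    also have "\<dots> \<le> prob ?G + prob ?F" by (rule measure_Un_le) measurable
    finally show ?case using pR elim(1) unfolding n_def[symmetric] h_def[symmetric] by linarith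
  qed
qed


lemma indep_vars_blocks:
  assumes "disjoint_family B"
  shows "indep_vars (\<lambda>k. PiM (B k) (\<lambda>_. borel)) (\<lambda>k \<omega>. restrict (\<lambda>j. \<eta> j \<omega>) (B k)) UNIV"
  by (rule indep_vars_restrict[OF indep_noise]) (use assms in auto)

text \<open>Along the sequence \<open>N\<close> each gap consists of about \<open>ln k / \<rho>\<close> blocks of equal length; asking every
  block to exceed \<open>A\<close> standard deviations has probability at least \<open>1 / k\<close>.\<close>

lemma lower_lil_aux:
  assumes s2: "\<And>r. (\<Sum>d<r. (c d)\<^sup>2) \<le> s\<^sup>2" and s: "s > 0"
    and D: "\<And>L. real L * s\<^sup>2 - (\<Sum>r<L. \<Sum>d<r. (c d)\<^sup>2) \<le> D" and \<delta>: "0 < \<delta>" "\<delta> < 1"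
  shows "AE \<omega> in M. \<exists>\<^sub>F n in sequentially. (1 - \<delta>) * s * lil_scale n \<le> block_form c 0 n \<omega>"
proof -
  have s20: "s\<^sup>2 > 0" using s by simp
  \<comment> \<open>The quantity under the root is the exponent \<open>rho\<close> paid per block.
    As A grows, A / sqrt rho tends to sqrt 2, the ratio of an ideal Gaussian tail.\<close>
  obtain A :: real where A: "A > 0" "A / sqrt ((A + 2)\<^sup>2 / 2 + ln 8) > (1 - \<delta>) * sqrt 2"
  proof -
    have "((\<lambda>A::real. A / sqrt ((A + 2)\<^sup>2 / 2 + ln 8)) \<longlongrightarrow> sqrt 2) at_top"
      by real_asymp (simp add: powr_half_sqrt real_sqrt_divide)
    moreover have "(1 - \<delta>) * sqrt 2 < sqrt 2" using \<delta> by simp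
    ultimately have "\<forall>\<^sub>F A in at_top. A / sqrt ((A + 2)\<^sup>2 / 2 + ln 8) > (1 - \<delta>) * sqrt 2"
      by (rule order_tendstoD(1))
    then have "\<forall>\<^sub>F A in at_top. A / sqrt ((A + 2)\<^sup>2 / 2 + ln 8) > (1 - \<delta>) * sqrt 2 \<and> A > 0"
      using eventually_gt_at_top[of "0::real"] by eventually_elim simp
    then show ?thesis using that by (auto simp: eventually_at_top_linorder)
  qed
  define rho where "rho = (A + 2)\<^sup>2 / 2 + ln (8::real)"
  have rho: "rho > 1"
  proof -
    have "2 * 2 < (A + 2) * (A + 2)" using A by (intro mult_strict_mono) auto
    then have "(A + 2)\<^sup>2 / 2 > 2" by (simp add: power2_eq_square)
    moreover have "ln (8::real) > 0" by simp
    ultimately show ?thesis unfolding rho_def by linarith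
  qed
  have h_eq: "exp (- (A + 2)\<^sup>2 / 2) / 8 = exp (- rho)"
  proof -
    have "- rho = - (A + 2)\<^sup>2 / 2 - ln 8" by (simp add: rho_def)
    then show ?thesis by (simp only: exp_diff) simp
  qed
  \<comment> \<open>As many blocks as the budget allows: exp(-rho K_k) is at least 1/(k+2), whose
    sum diverges.\<close>
  define K where "K = (\<lambda>k::nat. nat \<lfloor>ln (real k + 2) / rho\<rfloor>)"
  \<comment> \<open>Blocks of length (k+2)^2 N_k dwarf the past, so the remainder \<open>R\<close>
    below, noise before N_k included, has relative variance of order 1/(k+2)^2, which is
    summable.\<close>
  define N where "N = rec_nat 1 (\<lambda>k m. m + K k * ((k + 2)\<^sup>2 * m))"
  define g where "g = (\<lambda>k. (k + 2)\<^sup>2 * N k)"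
  have N0: "N 0 = 1" and NS: "N (Suc k) = N k + K k * g k" for k by (simp_all add: N_def g_def)
  have K_le: "real (K k) \<le> ln (real k + 2) / rho" for k
    unfolding K_def using rho by simp
  have K_ge: "ln (real k + 2) / rho - 1 \<le> real (K k)" for k
    unfolding K_def by linarith
  have N1: "N k \<ge> 1" for k by (induction k) (simp_all add: N0 NS)
  have N_mono: "N k \<le> N m" if "k \<le> m" for k m
    using that by (rule lift_Suc_mono_le[rotated]) (simp add: NS)
  have g_ge: "k \<le> g k" for k
  proof -
    have "k * 1 \<le> (k + 2)\<^sup>2 * N k" using N1[of k] by (intro mult_mono) (auto simp: power2_eq_square)
    then show ?thesis by (simp add: g_def)
  qed
  define B where "B = (\<lambda>k. {N k..<N (Suc k)})"
  have "disjoint_family B"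
    unfolding disjoint_family_on_def
  proof (intro ballI impI)
    fix k m :: nat assume "k \<noteq> m"
    have "B k \<inter> B m = {}" if "k < m" for k m
      using N_mono[of "Suc k" m] that unfolding B_def by auto
    from this[of k m] this[of m k] \<open>k \<noteq> m\<close> show "B k \<inter> B m = {}" by (cases "k < m") auto
  qed
  note ind = indep_vars_blocks[OF this]
  define lev where "lev = (\<lambda>k. A * sqrt (s\<^sup>2 * real (g k)))"
  define E where "E = (\<lambda>k. {x\<in>space (PiM (B k) (\<lambda>_. borel :: real measure)).
      \<forall>l\<in>{..<K k}. lev k \<le> quad_form c (g k) (\<lambda>i. x (N k + l * g k + i))})"
  have in_B: "N k + l * g k + i \<in> B k" if "l < K k" "i < g k" for k l i
  proof -
    have "Suc l * g k \<le> K k * g k" using that by (intro mult_right_mono) auto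
    then show ?thesis using that by (simp add: B_def NS)
  qed
  have E_sets: "E k \<in> sets (PiM (B k) (\<lambda>_. borel))" for k
    unfolding E_def
  proof (rule sets.sets_Collect_finite_All)
    fix l assume "l \<in> {..<K k}"
    then have "(\<lambda>x. quad_form c (g k) (\<lambda>i. x (N k + l * g k + i))) \<in> borel_measurable (PiM (B k) (\<lambda>_. borel))"
      by (intro quad_form_measurable measurable_component_singleton in_B) auto
    then show "{x\<in>space (PiM (B k) (\<lambda>_. borel)). lev k \<le> quad_form c (g k) (\<lambda>i. x (N k + l * g k + i))} \<in> sets (PiM (B k) (\<lambda>_. borel))"
      by measurable
  qed auto
  have E_iff: "restrict (\<lambda>j. \<eta> j \<omega>) (B k) \<in> E k \<longleftrightarrow> (\<forall>l<K k. lev k \<le> block_form c (N k + l * g k) (g k) \<omega>)" for k \<omega>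
  proof -
    have "quad_form c (g k) (\<lambda>i. restrict (\<lambda>j. \<eta> j \<omega>) (B k) (N k + l * g k + i)) = block_form c (N k + l * g k) (g k) \<omega>"
      if "l < K k" for l
      unfolding block_form_def using in_B[OF that] by (intro quad_form_cong) auto
    then show ?thesis by (auto simp: E_def space_PiM)
  qed
  have prob_E: "prob ((\<lambda>\<omega>. restrict (\<lambda>j. \<eta> j \<omega>) (B k)) -` E k \<inter> space M)
      = prob {\<omega>\<in>space M. lev k \<le> block_form c 0 (g k) \<omega>} ^ K k" for k
  proof (cases "K k = 0")
    case True
    then have "(\<lambda>\<omega>. restrict (\<lambda>j. \<eta> j \<omega>) (B k)) -` E k \<inter> space M = space M" using E_iff by auto
    then show ?thesis using True by (simp add: prob_space)
  next
    case False
    have "(\<lambda>\<omega>. restrict (\<lambda>j. \<eta> j \<omega>) (B k)) -` E k \<inter> space M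
        = (\<Inter>l\<in>{..<K k}. block_form c (N k + l * g k) (g k) -` {lev k..} \<inter> space M)"
      using False E_iff[of _ k] by (auto simp: lessThan_empty_iff)
    also have "prob \<dots> = (\<Prod>l\<in>{..<K k}. prob (block_form c (N k + l * g k) (g k) -` {lev k..} \<inter> space M))"
      by (rule indep_varsD[OF indep_block_forms]) (use False in auto)
    also have "\<dots> = (\<Prod>l\<in>{..<K k}. prob {\<omega>\<in>space M. lev k \<le> block_form c 0 (g k) \<omega>})"
    proof (rule prod.cong)
      fix l
      have e: "prob (block_form c a (g k) -` {lev k..} \<inter> space M) = measure (distr M borel (block_form c a (g k))) {lev k..}" for a
        by (subst measure_distr) auto
      have "prob (block_form c (N k + l * g k) (g k) -` {lev k..} \<inter> space M) = prob (block_form c 0 (g k) -` {lev k..} \<inter> space M)"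
        unfolding e distr_block_form[of c "N k + l * g k"] ..
      also have "block_form c 0 (g k) -` {lev k..} \<inter> space M = {\<omega>\<in>space M. lev k \<le> block_form c 0 (g k) \<omega>}" by auto
      finally show "prob (block_form c (N k + l * g k) (g k) -` {lev k..} \<inter> space M) = prob {\<omega>\<in>space M. lev k \<le> block_form c 0 (g k) \<omega>}" .
    qed simp
    finally show ?thesis by simp
  qed
  have g_top: "filterlim g at_top sequentially"
    by (rule filterlim_at_top_mono[OF filterlim_ident]) (use g_ge in auto)
  have "\<forall>\<^sub>F n in sequentially. exp (- rho) \<le> prob {\<omega>\<in>space M. A * sqrt (s\<^sup>2 * real n) \<le> block_form c 0 n \<omega>}"
    using quad_form_tail[OF s2 s20 D A(1)] unfolding h_eq .
  from eventually_compose_filterlim[OF this g_top]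
  have evE: "\<forall>\<^sub>F k in sequentially. 1 / (real k + 2) \<le> prob ((\<lambda>\<omega>. restrict (\<lambda>j. \<eta> j \<omega>) (B k)) -` E k \<inter> space M)"
  proof eventually_elim
    case (elim k)
    have "1 / (real k + 2) = exp (- ln (real k + 2))" by (simp add: exp_minus field_simps)
    also have "\<dots> \<le> exp (- (real (K k) * rho))" using K_le[of k] rho by (simp add: field_simps)
    also have "\<dots> = exp (- rho) ^ K k" by (simp add: exp_of_nat_mult[symmetric])
    also have "\<dots> \<le> prob {\<omega>\<in>space M. lev k \<le> block_form c 0 (g k) \<omega>} ^ K k"
      using elim by (intro power_mono) (auto simp: lev_def)
    finally show ?case unfolding prob_E .
  qed
  have "\<not> summable (\<lambda>k. prob ((\<lambda>\<omega>. restrict (\<lambda>j. \<eta> j \<omega>) (B k)) -` E k \<inter> space M))"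
  proof
    assume "summable (\<lambda>k. prob ((\<lambda>\<omega>. restrict (\<lambda>j. \<eta> j \<omega>) (B k)) -` E k \<inter> space M))"
    then have "summable (\<lambda>k. 1 / (real k + 2))"
      by (rule summable_comparison_test_ev[rotated]) (use evE in simp)
    then have "summable (\<lambda>k. inverse (real (Suc (Suc k))))" by (simp add: inverse_eq_divide add_ac)
    then have "summable (\<lambda>k. inverse (real k))"
      using summable_Suc_iff[of "\<lambda>k. inverse (real (Suc k))"] summable_Suc_iff[of "\<lambda>k. inverse (real k)"] by blast
    then show False using not_summable_harmonic[where 'a = real] by simp
  qed
  from borel_cantelli_indep[OF ind E_sets this]
  have io: "AE \<omega> in M. \<exists>\<^sub>F k in sequentially. restrict (\<lambda>j. \<eta> j \<omega>) (B k) \<in> E k" .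
  define R where "R = (\<lambda>k \<omega>. block_form c 0 (N (Suc k)) \<omega> - (\<Sum>l<K k. block_form c (N k + l * g k) (g k) \<omega>))"
  define f where "f = (\<lambda>k \<omega>. if K k = 0 then 0 else (R k \<omega>)\<^sup>2 / real (N (Suc k)))"
  have D0: "D \<ge> 0" using D[of 0] by simp
  have R_int: "integrable M (\<lambda>\<omega>. (R k \<omega>)\<^sup>2)" and R_exp: "expectation (\<lambda>\<omega>. (R k \<omega>)\<^sup>2) \<le> real (N k) * s\<^sup>2 + real (K k) * D" for k
  proof -
    have le: "N k + K k * g k \<le> N (Suc k)" by (simp add: NS)
    note br = block_remainder[OF le s2]
    show "integrable M (\<lambda>\<omega>. (R k \<omega>)\<^sup>2)" unfolding R_def by (rule br(1))
    have "real (K k) * (real (g k) * s\<^sup>2 - (\<Sum>i<g k. \<Sum>d<i. (c d)\<^sup>2)) \<le> real (K k) * D"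
      by (rule mult_left_mono[OF D]) simp
    then show "expectation (\<lambda>\<omega>. (R k \<omega>)\<^sup>2) \<le> real (N k) * s\<^sup>2 + real (K k) * D"
      using br(2) unfolding R_def by (simp add: NS algebra_simps)
  qed
  have f_lim: "AE \<omega> in M. (\<lambda>k. f k \<omega>) \<longlonglongrightarrow> 0"
  proof (rule AE_tendsto_0_of_summable_integral)
    show "integrable M (f k)" for k unfolding f_def using R_int[of k] by (cases "K k = 0") simp_all
    show "0 \<le> f k \<omega>" for k \<omega> unfolding f_def by auto
    have bound: "expectation (f k) \<le> (s\<^sup>2 + D) * (1 / (real k + 2)\<^sup>2)" for k
    proof (cases "K k = 0")
      case False
      define m where "m = (real k + 2)\<^sup>2"
      have m: "m > 0" unfolding m_def by simp
      have K1: "real (K k) \<ge> 1" using False by simp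
      have Nk: "real (N k) \<ge> 1" using N1[of k] by simp
      have NS': "real (N (Suc k)) \<ge> real (K k) * (m * real (N k))" by (simp add: NS g_def m_def add.commute)
      have pos: "real (N (Suc k)) > 0" using N1[of "Suc k"] by simp
      have "m * (real (N k) * s\<^sup>2 + real (K k) * D) \<le> (s\<^sup>2 + D) * (real (K k) * (m * real (N k)))"
      proof -
        have "m * real (N k) * s\<^sup>2 * 1 \<le> m * real (N k) * s\<^sup>2 * real (K k)" using K1 m by (intro mult_left_mono) auto
        moreover have "m * real (K k) * D * 1 \<le> m * real (K k) * D * real (N k)" using Nk m D0 by (intro mult_left_mono) auto
        ultimately show ?thesis by (simp add: algebra_simps)
      qed
      also have "\<dots> \<le> (s\<^sup>2 + D) * real (N (Suc k))" using NS' D0 by (intro mult_left_mono) auto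
      finally have "(real (N k) * s\<^sup>2 + real (K k) * D) / real (N (Suc k)) \<le> (s\<^sup>2 + D) * (1 / m)"
        using m pos by (simp add: field_simps)
      moreover have "expectation (f k) = expectation (\<lambda>\<omega>. (R k \<omega>)\<^sup>2) / real (N (Suc k))"
        using False unfolding f_def by simp
      moreover have "expectation (\<lambda>\<omega>. (R k \<omega>)\<^sup>2) / real (N (Suc k)) \<le> (real (N k) * s\<^sup>2 + real (K k) * D) / real (N (Suc k))"
        by (rule divide_right_mono[OF R_exp]) simp
      ultimately show ?thesis unfolding m_def by linarith
    qed (use D0 in \<open>simp add: f_def\<close>)
    show "summable (\<lambda>k. expectation (f k))"
    proof (rule summable_comparison_test_ev)
      show "summable (\<lambda>k. (s\<^sup>2 + D) * (1 / (real k + 2)\<^sup>2))"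
      proof (rule summable_mult)
        have "summable (\<lambda>k. 1 / (real (Suc k) + 1)\<^sup>2)"
          using sums_summable[OF inverse_squares_sums] by (subst summable_Suc_iff) (simp add: add.commute)
        then show "summable (\<lambda>k. 1 / (real k + 2)\<^sup>2)" by (simp add: add.commute add.left_commute)
      qed
      show "\<forall>\<^sub>F k in sequentially. norm (expectation (f k)) \<le> (s\<^sup>2 + D) * (1 / (real k + 2)\<^sup>2)"
        using bound by (auto simp: f_def integral_nonneg_AE)
    qed
  qed
  have K_pos: "\<forall>\<^sub>F k in sequentially. K k > 0"
  proof -
    have "filterlim (\<lambda>k::nat. ln (real k + 2) / rho - 1) at_top sequentially" using rho by real_asymp
    then have "\<forall>\<^sub>F k::nat in sequentially. ln (real k + 2) / rho - 1 > 0" by (rule filterlim_at_top_dense[THEN iffD1, rule_format])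
    then show ?thesis by eventually_elim (use K_ge in \<open>smt (verit) of_nat_0 gr0I\<close>)
  qed
  \<comment> \<open>N_{k+1} is at most (k+3)^(3(k+1)), so its iterated logarithm is ln k to leading
    order, the same as the budget behind \<open>K\<close>.\<close>
  have ln_N: "ln (ln (real (N (Suc k)))) \<le> ln (3 * (real k + 1) * ln (real k + 3))" if "ln (real (N (Suc k))) > 0" for k
  proof -
    have KK: "K m \<le> m + 2" for m
    proof -
      have "real (K m) \<le> ln (real m + 2) / rho" by (rule K_le)
      also have "\<dots> \<le> ln (real m + 2)" using rho by (simp add: divide_le_eq)
      also have "\<dots> \<le> real m + 2" using ln_le_minus_one[of "real m + 2"] by simp
      finally show ?thesis by linarith
    qed
    have "N (Suc k) \<le> (k + 3) ^ (3 * (k + 1))" for k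
    proof (induction k)
      case 0
      have "K 0 \<le> 2" using KK[of 0] by simp
      then show ?case by (simp add: NS N0 g_def power2_eq_square)
    next
      case (Suc k)
      have "1 + K (Suc k) * (Suc k + 2)\<^sup>2 \<le> (Suc k + 3) ^ 3"
      proof -
        have "K (Suc k) * (Suc k + 2)\<^sup>2 \<le> (Suc k + 2) * (Suc k + 2)\<^sup>2" by (rule mult_right_mono[OF KK]) simp
        moreover have "1 + (Suc k + 2) * (Suc k + 2)\<^sup>2 \<le> (Suc k + 3) ^ 3"
          by (simp add: power2_eq_square power3_eq_cube algebra_simps)
        ultimately show ?thesis by linarith
      qed
      then have "N (Suc k) * (1 + K (Suc k) * (Suc k + 2)\<^sup>2) \<le> (k + 3) ^ (3 * (k + 1)) * (Suc k + 3) ^ 3"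
        using Suc by (intro mult_mono) auto
      also have "\<dots> \<le> (Suc k + 3) ^ (3 * (k + 1)) * (Suc k + 3) ^ 3"
        by (intro mult_right_mono power_mono) auto
      also have "\<dots> = (Suc k + 3) ^ (3 * (Suc k + 1))" by (simp add: power_add[symmetric] add.commute)
      finally show ?case by (simp add: NS[of "Suc k"] g_def algebra_simps)
    qed
    then have "real (N (Suc k)) \<le> (real k + 3) ^ (3 * (k + 1))"
      by (metis of_nat_add of_nat_le_iff of_nat_numeral of_nat_power)
    then have "ln (real (N (Suc k))) \<le> ln ((real k + 3) ^ (3 * (k + 1)))"
      using N1[of "Suc k"] by (subst ln_le_cancel_iff) auto
    also have "\<dots> = 3 * (real k + 1) * ln (real k + 3)" by (subst ln_realpow) auto
    finally show ?thesis using that by (subst ln_le_cancel_iff) auto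
  qed
  \<comment> \<open>After division by sqrt(ln(k+2)) the leading terms tend to A s / sqrt rho and (1
    - \<delta>) s sqrt 2, so the choice of A decides. The -1 pays for the remainder.\<close>
  have asy: "\<forall>\<^sub>F k::nat in sequentially. (1 - \<delta>) * s * sqrt (2 * ln (3 * (real k + 1) * ln (real k + 3)))
      \<le> A * s * (sqrt (ln (real k + 2) / rho - 1) * sqrt (1 - 1 / (real k + 2)\<^sup>2)) - 1"
  proof -
    have "((\<lambda>k::nat. (A * s * (sqrt (ln (real k + 2) / rho - 1) * sqrt (1 - 1 / (real k + 2)\<^sup>2)) - 1
        - (1 - \<delta>) * s * sqrt (2 * ln (3 * (real k + 1) * ln (real k + 3)))) / sqrt (ln (real k + 2)))
        \<longlongrightarrow> A * s * (1 / sqrt rho * 1) - 0 - (1 - \<delta>) * s * sqrt 2) sequentially"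
    proof -
      have 1: "((\<lambda>k::nat. sqrt (ln (real k + 2) / rho - 1) / sqrt (ln (real k + 2))) \<longlongrightarrow> 1 / sqrt rho) sequentially"
      proof -
        have "((\<lambda>k::nat. (ln (real k + 2) / rho - 1) / ln (real k + 2)) \<longlongrightarrow> 1 / rho) sequentially"
          using rho by real_asymp (simp add: field_simps)
        then have "((\<lambda>k::nat. sqrt ((ln (real k + 2) / rho - 1) / ln (real k + 2))) \<longlongrightarrow> sqrt (1 / rho)) sequentially"
          by (rule tendsto_real_sqrt)
        then show ?thesis by (simp add: real_sqrt_divide)
      qed
      have 2: "((\<lambda>k::nat. sqrt (1 - 1 / (real k + 2)\<^sup>2)) \<longlongrightarrow> 1) sequentially" by real_asymp
      have 3: "((\<lambda>k::nat. 1 / sqrt (ln (real k + 2))) \<longlongrightarrow> 0) sequentially" by real_asymp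
      have 4: "((\<lambda>k::nat. sqrt (2 * ln (3 * (real k + 1) * ln (real k + 3))) / sqrt (ln (real k + 2))) \<longlongrightarrow> sqrt 2) sequentially"
        by real_asymp (simp add: powr_half_sqrt)
      have "((\<lambda>k::nat. A * s * (sqrt (ln (real k + 2) / rho - 1) / sqrt (ln (real k + 2)) * sqrt (1 - 1 / (real k + 2)\<^sup>2))
          - 1 / sqrt (ln (real k + 2))
          - (1 - \<delta>) * s * (sqrt (2 * ln (3 * (real k + 1) * ln (real k + 3))) / sqrt (ln (real k + 2))))
        \<longlongrightarrow> A * s * (1 / sqrt rho * 1) - 0 - (1 - \<delta>) * s * sqrt 2) sequentially"
        by (intro tendsto_intros 1 2 3 4)
      then show ?thesis by (simp add: diff_divide_distrib)
    qed
    moreover have "A * s * (1 / sqrt rho * 1) - 0 - (1 - \<delta>) * s * sqrt 2 > 0"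
      using mult_strict_right_mono[OF A(2)[folded rho_def] s] by (simp add: mult_ac)
    ultimately have "\<forall>\<^sub>F k::nat in sequentially. (A * s * (sqrt (ln (real k + 2) / rho - 1) * sqrt (1 - 1 / (real k + 2)\<^sup>2)) - 1
        - (1 - \<delta>) * s * sqrt (2 * ln (3 * (real k + 1) * ln (real k + 3)))) / sqrt (ln (real k + 2)) > 0"
      by (rule order_tendstoD(1))
    moreover have "\<forall>\<^sub>F k::nat in sequentially. sqrt (ln (real k + 2)) > 0" by real_asymp
    ultimately show ?thesis by eventually_elim (simp add: zero_less_divide_iff)
  qed
  have N_ge: "\<forall>\<^sub>F k in sequentially. N (Suc k) \<ge> k + 3 \<and> k \<ge> 3"
    using K_pos eventually_ge_at_top[of 3]
  proof eventually_elim
    case (elim k)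
    have "(k + 2) * 2 * 1 * 1 \<le> (k + 2) * (k + 2) * N k * K k" using N1[of k] elim by (intro mult_mono) auto
    then show ?case using elim by (simp add: NS g_def power2_eq_square mult_ac)
  qed
  from f_lim io show ?thesis
  proof eventually_elim
    case (elim \<omega>)
    have "\<forall>\<^sub>F k in sequentially. f k \<omega> < 1" using elim(1) by (rule order_tendstoD) simp
    with K_pos asy N_ge have ev: "\<forall>\<^sub>F k in sequentially. restrict (\<lambda>j. \<eta> j \<omega>) (B k) \<in> E k \<longrightarrow>
        (1 - \<delta>) * s * lil_scale (N (Suc k)) \<le> block_form c 0 (N (Suc k)) \<omega>"
    proof eventually_elim
      case (elim k)
      show ?case
      proof
        assume "restrict (\<lambda>j. \<eta> j \<omega>) (B k) \<in> E k"
        then have lev: "lev k \<le> block_form c (N k + l * g k) (g k) \<omega>" if "l < K k" for l using that E_iff by blast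
        let ?N = "real (N (Suc k))"
        have Np: "?N \<ge> 3" using elim(3) by linarith
        have "(\<Sum>l<K k. lev k) \<le> (\<Sum>l<K k. block_form c (N k + l * g k) (g k) \<omega>)"
          using lev by (intro sum_mono) auto
        then have 1: "real (K k) * lev k \<le> block_form c 0 (N (Suc k)) \<omega> - R k \<omega>" by (simp add: R_def)
        have "(R k \<omega>)\<^sup>2 < ?N" using elim(4,1) Np by (simp add: f_def divide_less_eq)
        then have "\<bar>R k \<omega>\<bar> < sqrt ?N" using real_sqrt_less_mono[of "(R k \<omega>)\<^sup>2" ?N] by simp
        then have 2: "R k \<omega> \<ge> - sqrt ?N" by linarith
        have lnN: "ln ?N > 0" using Np by simp
        have "exp 1 \<le> ?N" using exp_le Np by linarith
        then have lnN1: "ln ?N \<ge> 1" using Np by (subst ln_ge_iff) auto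
        \<comment> \<open>The blocks fill the gap exactly, and the past N_k is at most the fraction
          1/(k+2)^2 of the total length.\<close>
        have Kg: "real (K k) * real (g k) \<ge> ?N * (1 - 1 / (real k + 2)\<^sup>2)"
        proof -
          have "(real k + 2)\<^sup>2 * real (N k) \<le> real (K k) * real (g k)"
            using elim(1) mult_right_mono[of 1 "real (K k)" "(real k + 2)\<^sup>2 * real (N k)"] by (simp add: g_def add.commute)
          also have "\<dots> \<le> ?N" by (simp add: NS)
          finally have "real (N k) \<le> ?N / (real k + 2)\<^sup>2" by (simp add: field_simps)
          then show ?thesis by (simp add: NS algebra_simps)
        qed
        have k2: "1 / (real k + 2)\<^sup>2 \<le> 1" by (simp add: divide_le_eq)
        have "sqrt (real (K k)) * sqrt (real (K k) * real (g k)) = (sqrt (real (K k)) * sqrt (real (K k))) * sqrt (real (g k))"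
          by (simp only: real_sqrt_mult mult.assoc)
        then have lev_eq: "A * s * (sqrt (real (K k)) * sqrt (real (K k) * real (g k))) = real (K k) * lev k"
          using s by (simp add: lev_def real_sqrt_mult)
        have "sqrt ?N * (A * s * (sqrt (ln (real k + 2) / rho - 1) * sqrt (1 - 1 / (real k + 2)\<^sup>2)))
          = A * s * (sqrt (ln (real k + 2) / rho - 1) * sqrt (?N * (1 - 1 / (real k + 2)\<^sup>2)))"
          by (simp add: real_sqrt_mult mult_ac)
        also have "\<dots> \<le> A * s * (sqrt (real (K k)) * sqrt (real (K k) * real (g k)))"
        proof (rule mult_left_mono[OF mult_mono])
          show "0 \<le> sqrt (?N * (1 - 1 / (real k + 2)\<^sup>2))"
            using k2 by (intro real_sqrt_ge_zero mult_nonneg_nonneg) auto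
        qed (use A s in \<open>auto intro: real_sqrt_le_mono[OF K_ge] real_sqrt_le_mono[OF Kg] simp del: real_sqrt_le_iff\<close>)
        also have "\<dots> = real (K k) * lev k" by (rule lev_eq)
        finally have 3: "sqrt ?N * (A * s * (sqrt (ln (real k + 2) / rho - 1) * sqrt (1 - 1 / (real k + 2)\<^sup>2))) \<le> real (K k) * lev k" .
        have "lil_scale (N (Suc k)) = sqrt ?N * sqrt (2 * ln (ln ?N))"
          by (simp add: lil_scale_def real_sqrt_mult mult_ac)
        also have "\<dots> \<le> sqrt ?N * sqrt (2 * ln (3 * (real k + 1) * ln (real k + 3)))"
          using ln_N[OF lnN] by (intro mult_left_mono real_sqrt_le_mono) auto
        finally have "(1 - \<delta>) * s * lil_scale (N (Suc k)) \<le> (1 - \<delta>) * s * (sqrt ?N * sqrt (2 * ln (3 * (real k + 1) * ln (real k + 3))))"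
          using \<delta> s by (intro mult_left_mono) auto
        also have "\<dots> = sqrt ?N * ((1 - \<delta>) * s * sqrt (2 * ln (3 * (real k + 1) * ln (real k + 3))))" by simp
        also have "\<dots> \<le> sqrt ?N * (A * s * (sqrt (ln (real k + 2) / rho - 1) * sqrt (1 - 1 / (real k + 2)\<^sup>2)) - 1)"
          using elim(2) by (intro mult_left_mono) auto
        also have "\<dots> \<le> real (K k) * lev k - sqrt ?N" using 3 by (simp add: algebra_simps)
        also have "\<dots> \<le> block_form c 0 (N (Suc k)) \<omega>" using 1 2 by linarith
        finally show "(1 - \<delta>) * s * lil_scale (N (Suc k)) \<le> block_form c 0 (N (Suc k)) \<omega>" .
      qed
    qed
    have fr: "\<exists>\<^sub>F k in sequentially. (1 - \<delta>) * s * lil_scale (N (Suc k)) \<le> block_form c 0 (N (Suc k)) \<omega>"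
      using elim(2) ev by (rule frequently_rev_mp)
    have NS_top: "filterlim (\<lambda>k. N (Suc k)) at_top sequentially"
      by (rule filterlim_at_top_mono[OF filterlim_ident]) (use N_ge in \<open>auto elim: eventually_mono\<close>)
    show ?case
    proof (rule ccontr)
      assume "\<not> (\<exists>\<^sub>F n in sequentially. (1 - \<delta>) * s * lil_scale n \<le> block_form c 0 n \<omega>)"
      then have "\<forall>\<^sub>F n in sequentially. \<not> (1 - \<delta>) * s * lil_scale n \<le> block_form c 0 n \<omega>"
        by (simp add: not_frequently)
      from eventually_compose_filterlim[OF this NS_top] show False using fr by (simp add: frequently_def)
    qed
  qed
qed

theorem lower_lil:
  assumes s2: "\<And>r. (\<Sum>d<r. (c d)\<^sup>2) \<le> s\<^sup>2" and s: "s > 0"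
    and D: "\<And>L. real L * s\<^sup>2 - (\<Sum>r<L. \<Sum>d<r. (c d)\<^sup>2) \<le> D"
  shows "AE \<omega> in M. \<forall>\<delta>>0. \<exists>\<^sub>F n in sequentially. (s - \<delta>) * lil_scale n \<le> block_form c 0 n \<omega>"
proof -
  define b where "b = (\<lambda>m::nat. 1 / (real m + 2))"
  have b: "0 < b m" "b m < 1" for m by (simp_all add: b_def)
  have "AE \<omega> in M. \<exists>\<^sub>F n in sequentially. (1 - b m) * s * lil_scale n \<le> block_form c 0 n \<omega>" for m
    by (rule lower_lil_aux[OF s2 s D b])
  then have "AE \<omega> in M. \<forall>m. \<exists>\<^sub>F n in sequentially. (1 - b m) * s * lil_scale n \<le> block_form c 0 n \<omega>"
    by (simp add: AE_all_countable)
  then show ?thesis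
  proof eventually_elim
    case (elim \<omega>)
    show ?case
    proof (intro allI impI)
      fix \<delta> :: real assume "\<delta> > 0"
      have "(\<lambda>m. b m * s) \<longlonglongrightarrow> 0" unfolding b_def by real_asymp
      then have "\<forall>\<^sub>F m in sequentially. b m * s < \<delta>" using \<open>\<delta> > 0\<close> by (intro order_tendstoD) auto
      then obtain m where m: "b m * s < \<delta>" by (auto simp: eventually_sequentially)
      show "\<exists>\<^sub>F n in sequentially. (s - \<delta>) * lil_scale n \<le> block_form c 0 n \<omega>"
        using elim[rule_format, of m]
      proof (rule frequently_rev_mp)
        show "\<forall>\<^sub>F n in sequentially. (1 - b m) * s * lil_scale n \<le> block_form c 0 n \<omega> \<longrightarrow> (s - \<delta>) * lil_scale n \<le> block_form c 0 n \<omega>"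
          using lil_scale_pos_ev
        proof eventually_elim
          case (elim n)
          have "(s - \<delta>) * lil_scale n \<le> (1 - b m) * s * lil_scale n"
            using m elim by (intro mult_right_mono) (auto simp: algebra_simps)
          then show ?case by linarith
        qed
      qed
    qed
  qed
qed

end

section \<open>Sample path averages\<close>

lemma L2_set_scale: "L2_set (\<lambda>i. c * f i) A = \<bar>c\<bar> * L2_set f A" for c :: real
  unfolding L2_set_def by (simp add: power_mult_distrib sum_distrib_left[symmetric] real_sqrt_mult)

lemma L2_set_sum_le: "finite D \<Longrightarrow> L2_set (\<lambda>i. \<Sum>d\<in>D. f d i) A \<le> (\<Sum>d\<in>D. L2_set (f d) A)"
proof (induction D rule: finite_induct)
  case empty
  then show ?case by (simp add: L2_set_def)
next
  case (insert d D)
  have "L2_set (\<lambda>i. f d i + (\<Sum>d\<in>D. f d i)) A \<le> L2_set (f d) A + L2_set (\<lambda>i. \<Sum>d\<in>D. f d i) A"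
    by (rule L2_set_triangle_ineq)
  then show ?case using insert by simp
qed

lemma L2_set_abs_mono:
  fixes f g :: "nat \<Rightarrow> real"
  assumes "finite A" "\<And>i. i \<in> A \<Longrightarrow> \<bar>f i\<bar> \<le> \<bar>g i\<bar>"
  shows "L2_set f A \<le> L2_set g A"
  unfolding L2_set_def using assms by (intro real_sqrt_le_mono sum_mono) (auto simp: abs_le_square_iff)

lemma L2_set_square: "(L2_set f A)\<^sup>2 = (\<Sum>i\<in>A. (f i)\<^sup>2)"
  unfolding L2_set_def by (simp add: sum_nonneg)

definition lag :: "(nat \<Rightarrow> real) \<Rightarrow> nat \<Rightarrow> nat \<Rightarrow> real" where
  "lag e d i = (if d < i then e (i - 1 - d) else 0)"

lemma L2_set_lag: "L2_set (lag e d) {..<n} \<le> L2_set e {..<n}"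
proof -
  have "(\<Sum>i<n. (lag e d i)\<^sup>2) = (\<Sum>i\<in>{d<..<n}. (e (i - 1 - d))\<^sup>2)"
    unfolding lag_def by (rule sum.mono_neutral_cong_right) auto
  also have "\<dots> = (\<Sum>i<n - 1 - d. (e i)\<^sup>2)"
    by (rule sum.reindex_bij_witness[of _ "\<lambda>i. i + 1 + d" "\<lambda>i. i - 1 - d"]) auto
  also have "\<dots> \<le> (\<Sum>i<n. (e i)\<^sup>2)" by (rule sum_mono2) auto
  finally show ?thesis unfolding L2_set_def by (rule real_sqrt_le_mono)
qed

lemma lin_proc_lag:
  assumes "\<And>d. m \<le> d \<Longrightarrow> d < i \<Longrightarrow> c d = 0"
  shows "lin_proc c e i = (\<Sum>d<m. c d * lag e d i)"
proof -
  have "lin_proc c e i = (\<Sum>d<i. c d * e (i - 1 - d))"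
    unfolding lin_proc_def by (rule sum.reindex_bij_witness[of _ "\<lambda>d. i - 1 - d" "\<lambda>j. i - 1 - j"]) auto
  also have "\<dots> = (\<Sum>d<i. c d * lag e d i)" by (rule sum.cong) (auto simp: lag_def)
  also have "\<dots> = (\<Sum>d<m. c d * lag e d i)"
    by (rule sum.mono_neutral_cong) (use assms in \<open>auto simp: lag_def\<close>)
  finally show ?thesis .
qed

text \<open>Young's inequality for convolutions: a filter is a superposition of shifts, none of
  which increases the norm.\<close>

lemma lin_proc_L2_bound:
  assumes "\<And>r. (\<Sum>d<r. \<bar>c d\<bar>) \<le> C"
  shows "L2_set (lin_proc c e) {..<n} \<le> C * L2_set e {..<n}"
proof -
  have "L2_set (lin_proc c e) {..<n} = L2_set (\<lambda>i. \<Sum>d<n. c d * lag e d i) {..<n}"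
    by (rule L2_set_cong) (auto intro: lin_proc_lag)
  also have "\<dots> \<le> (\<Sum>d<n. L2_set (\<lambda>i. c d * lag e d i) {..<n})" by (rule L2_set_sum_le) simp
  also have "\<dots> \<le> (\<Sum>d<n. \<bar>c d\<bar> * L2_set e {..<n})"
    unfolding L2_set_scale by (intro sum_mono mult_left_mono L2_set_lag) auto
  also have "\<dots> \<le> C * L2_set e {..<n}"
    unfolding sum_distrib_right[symmetric] by (intro mult_right_mono assms) (simp add: L2_set_nonneg)
  finally show ?thesis .
qed

lemma lin_proc_add: "lin_proc (\<lambda>d. c d + c' d) e i = lin_proc c e i + lin_proc c' e i"
  and lin_proc_diff: "lin_proc (\<lambda>d. c d - c' d) e i = lin_proc c e i - lin_proc c' e i"
  and lin_proc_scale: "lin_proc (\<lambda>d. a * c d) e i = a * lin_proc c e i"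
  and lin_proc_sum: "lin_proc (\<lambda>d. \<Sum>k\<in>B. f k d) e i = (\<Sum>k\<in>B. lin_proc (f k) e i)"
  unfolding lin_proc_def
  by (simp_all add: algebra_simps sum.distrib sum_subtractf sum_distrib_left sum_distrib_right sum.swap[of _ B])

lemma lin_proc_add_noise: "lin_proc c (\<lambda>j. e j + e' j) i = lin_proc c e i + lin_proc c e' i"
  and lin_proc_diff_noise: "lin_proc c (\<lambda>j. e j - e' j) i = lin_proc c e i - lin_proc c e' i"
  and lin_proc_scale_noise: "lin_proc c (\<lambda>j. a * e j) i = a * lin_proc c e i"
  unfolding lin_proc_def by (simp_all add: algebra_simps sum.distrib sum_subtractf sum_distrib_left)

section \<open>Quadratic means along a path and negligible sequences\<close>

definition rms :: "(nat \<Rightarrow> real) \<Rightarrow> nat \<Rightarrow> real" where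
  "rms x n = L2_set x {..<n} / sqrt (real n)"

text \<open>The squares sum to o(n), which is what \<open>upper_lil\<close> with s = 0 asks of an
  integrand.\<close>

definition negligible_seq :: "(nat \<Rightarrow> real) \<Rightarrow> bool" where
  "negligible_seq x \<longleftrightarrow> rms x \<longlonglongrightarrow> 0"

lemma rms_nonneg: "rms x n \<ge> 0"
  by (simp add: rms_def L2_set_nonneg)

lemma rms_square: "(rms x n)\<^sup>2 = (\<Sum>i<n. (x i)\<^sup>2) / real n"
  by (simp add: rms_def power_divide L2_set_square)

lemma rms_eq: "rms x n = sqrt ((\<Sum>i<n. (x i)\<^sup>2) / real n)"
  by (simp add: rms_def L2_set_def real_sqrt_divide)

lemma rms_triangle: "rms (\<lambda>i. x i + y i) n \<le> rms x n + rms y n"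
  unfolding rms_def add_divide_distrib[symmetric] by (intro divide_right_mono L2_set_triangle_ineq) simp

lemma rms_scale: "rms (\<lambda>i. c * x i) n = \<bar>c\<bar> * rms x n"
  by (simp add: rms_def L2_set_scale)

lemma rms_mono: "(\<And>i. \<bar>x i\<bar> \<le> \<bar>y i\<bar>) \<Longrightarrow> rms x n \<le> rms y n"
  unfolding rms_def by (intro divide_right_mono L2_set_abs_mono) auto

lemma rms_lin_proc: "(\<And>r. (\<Sum>d<r. \<bar>c d\<bar>) \<le> C) \<Longrightarrow> rms (lin_proc c e) n \<le> C * rms e n"
  unfolding rms_def times_divide_eq_right by (intro divide_right_mono lin_proc_L2_bound) auto

lemma rms_diff_le: "\<bar>rms x n - rms y n\<bar> \<le> rms (\<lambda>i. x i - y i) n"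
proof -
  have "rms x n \<le> rms y n + rms (\<lambda>i. x i - y i) n" using rms_triangle[of y "\<lambda>i. x i - y i" n] by simp
  moreover have "rms y n \<le> rms x n + rms (\<lambda>i. y i - x i) n" using rms_triangle[of x "\<lambda>i. y i - x i" n] by simp
  moreover have "rms (\<lambda>i. y i - x i) n = rms (\<lambda>i. x i - y i) n" unfolding rms_eq by (simp add: power2_commute)
  ultimately show ?thesis by linarith
qed

lemma negligible_seq_bound:
  assumes "negligible_seq x" "\<And>n. rms y n \<le> C * rms x n"
  shows "negligible_seq y"
  unfolding negligible_seq_def
proof (rule tendsto_sandwich[of "\<lambda>_. 0"])
  show "(\<lambda>n. C * rms x n) \<longlonglongrightarrow> 0" using assms(1) unfolding negligible_seq_def by (rule tendsto_mult_right_zero)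
qed (use assms rms_nonneg in auto)

lemma negligible_seq_add: "negligible_seq x \<Longrightarrow> negligible_seq y \<Longrightarrow> negligible_seq (\<lambda>i. x i + y i)"
  unfolding negligible_seq_def
  by (rule tendsto_sandwich[of "\<lambda>_. 0" _ _ "\<lambda>n. rms x n + rms y n"])
    (auto intro: tendsto_add_zero simp: rms_nonneg rms_triangle)

lemma negligible_seq_scale: "negligible_seq x \<Longrightarrow> negligible_seq (\<lambda>i. c * x i)"
  by (rule negligible_seq_bound[where C = "\<bar>c\<bar>"]) (auto simp: rms_scale)

lemma negligible_seq_0: "negligible_seq (\<lambda>i. 0)"
  by (simp add: negligible_seq_def rms_def[abs_def] L2_set_def)

lemma negligible_seq_sum: "(\<And>b. b \<in> B \<Longrightarrow> negligible_seq (x b)) \<Longrightarrow> negligible_seq (\<lambda>i. \<Sum>b\<in>B. x b i)"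
  by (induction B rule: infinite_finite_induct) (auto intro: negligible_seq_add negligible_seq_0)

lemma negligible_seq_bounded_mult:
  assumes "negligible_seq x" "\<And>i. \<bar>c i\<bar> \<le> C"
  shows "negligible_seq (\<lambda>i. c i * x i)"
proof (rule negligible_seq_bound[OF assms(1)])
  fix n
  have "C \<ge> 0" using assms(2)[of 0] by linarith
  then have "rms (\<lambda>i. c i * x i) n \<le> rms (\<lambda>i. C * x i) n"
    using assms(2) by (intro rms_mono) (auto simp: abs_mult intro!: mult_right_mono)
  also have "\<dots> = C * rms x n" using \<open>C \<ge> 0\<close> by (simp add: rms_scale)
  finally show "rms (\<lambda>i. c i * x i) n \<le> C * rms x n" .
qed

lemma negligible_seq_lin_proc:
  "negligible_seq e \<Longrightarrow> (\<And>r. (\<Sum>d<r. \<bar>c d\<bar>) \<le> C) \<Longrightarrow> negligible_seq (lin_proc c e)"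
  by (erule negligible_seq_bound) (rule rms_lin_proc)

text \<open>Toeplitz's argument: the first m terms are a fixed amount, and beyond them t is small
  while the weights add up to at most C n.\<close>

lemma cesaro_weighted:
  fixes t h :: "nat \<Rightarrow> real"
  assumes t: "t \<longlonglongrightarrow> 0" and h: "\<And>i. h i \<ge> 0" and C: "\<And>n. (\<Sum>i<n. h i) \<le> C * real n"
  shows "(\<lambda>n. (\<Sum>i<n. t i * h i) / real n) \<longlonglongrightarrow> 0"
proof (rule LIMSEQ_I)
  fix r :: real assume "r > 0"
  have C0: "C \<ge> 0" using C[of 1] h[of 0] by simp
  define \<delta> where "\<delta> = r / (2 * (C + 1))"
  have \<delta>: "\<delta> > 0" using \<open>r > 0\<close> C0 by (simp add: \<delta>_def)
  from LIMSEQ_D[OF t \<delta>] obtain m where m: "\<And>i. i \<ge> m \<Longrightarrow> \<bar>t i\<bar> < \<delta>" by auto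
  define B where "B = (\<Sum>i<m. \<bar>t i * h i\<bar>)"
  obtain n0 where n0: "real n0 > 2 * B / r" using reals_Archimedean2 by blast
  show "\<exists>no. \<forall>n\<ge>no. norm ((\<Sum>i<n. t i * h i) / real n - 0) < r"
  proof (intro exI allI impI)
    fix n assume n: "n \<ge> max (Suc n0) m"
    then have np: "real n > 0" by auto
    have "(\<Sum>i<n. \<bar>t i * h i\<bar>) = B + (\<Sum>i\<in>{m..<n}. \<bar>t i * h i\<bar>)"
      unfolding B_def using sum.atLeastLessThan_concat[of 0 m n "\<lambda>i. \<bar>t i * h i\<bar>"] n by (simp add: lessThan_atLeast0)
    also have "(\<Sum>i\<in>{m..<n}. \<bar>t i * h i\<bar>) \<le> (\<Sum>i\<in>{m..<n}. \<delta> * h i)"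
    proof (rule sum_mono)
      fix i assume "i \<in> {m..<n}"
      then have "\<bar>t i\<bar> \<le> \<delta>" using m[of i] by simp
      then show "\<bar>t i * h i\<bar> \<le> \<delta> * h i" using h[of i] by (simp add: abs_mult mult_right_mono)
    qed
    also have "\<dots> \<le> (\<Sum>i<n. \<delta> * h i)" by (rule sum_mono2) (use h \<delta> in auto)
    also have "\<dots> \<le> \<delta> * (C * real n)" unfolding sum_distrib_left[symmetric] using C \<delta> by (intro mult_left_mono) auto
    also have "\<dots> \<le> r / 2 * real n"
    proof -
      have "\<delta> * C \<le> r / 2" unfolding \<delta>_def using C0 \<open>r > 0\<close> by (simp add: field_simps)
      then have "\<delta> * C * real n \<le> r / 2 * real n" using np by (intro mult_right_mono) auto
      then show ?thesis by (simp add: mult.assoc)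
    qed
    finally have "\<bar>\<Sum>i<n. t i * h i\<bar> \<le> B + r / 2 * real n" using sum_abs[of "\<lambda>i. t i * h i" "{..<n}"] by linarith
    moreover have "B < r / 2 * real n"
    proof -
      have "2 * B / r < real n" using n0 n by auto
      then show ?thesis using \<open>r > 0\<close> by (simp add: field_simps)
    qed
    ultimately have "\<bar>\<Sum>i<n. t i * h i\<bar> < r * real n" by simp
    then show "norm ((\<Sum>i<n. t i * h i) / real n - 0) < r" using np by (simp add: divide_less_eq)
  qed
qed

lemma negligible_seq_weighted:
  assumes t: "t \<longlonglongrightarrow> 0" and C: "\<And>n. rms x n \<le> C"
  shows "negligible_seq (\<lambda>i. t i * x i)"
proof -
  have "(\<lambda>n. (\<Sum>i<n. (t i)\<^sup>2 * (x i)\<^sup>2) / real n) \<longlonglongrightarrow> 0"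
  proof (rule cesaro_weighted)
    show "(\<lambda>i. (t i)\<^sup>2) \<longlonglongrightarrow> 0" using tendsto_power[OF t, of 2] by simp
    show "(\<Sum>i<n. (x i)\<^sup>2) \<le> C\<^sup>2 * real n" for n
    proof (cases "n = 0")
      case False
      have "(rms x n)\<^sup>2 \<le> C\<^sup>2" using C rms_nonneg by (intro power_mono) auto
      then show ?thesis using False by (simp add: rms_square divide_le_eq)
    qed simp
  qed simp
  then have "(\<lambda>n. sqrt ((\<Sum>i<n. (t i)\<^sup>2 * (x i)\<^sup>2) / real n)) \<longlonglongrightarrow> sqrt 0" by (rule tendsto_real_sqrt)
  then show ?thesis by (simp add: negligible_seq_def rms_eq[abs_def] power_mult_distrib)
qed

lemma rms_bounded_of_limit: "rms x \<longlonglongrightarrow> a \<Longrightarrow> \<exists>C. \<forall>n. rms x n \<le> C"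
  using convergent_imp_Bseq[of "rms x"] unfolding Bseq_def convergent_def by (auto intro: order_trans[OF abs_ge_self])

lemma rms_limit_of_negligible:
  assumes "negligible_seq (\<lambda>i. x i - y i)" "rms y \<longlonglongrightarrow> a"
  shows "rms x \<longlonglongrightarrow> a"
proof -
  have "(\<lambda>n. rms x n - rms y n) \<longlonglongrightarrow> 0"
    by (rule Lim_null_comparison[OF _ assms(1)[unfolded negligible_seq_def]]) (auto simp: rms_diff_le)
  from tendsto_add[OF this assms(2)] show ?thesis by simp
qed

text \<open>The empirical autocovariances are those of white noise. The approximation of the
  regressor and the limits of its quadratic averages are deterministic consequences on such a
  path.\<close>

definition ergodic_path :: "(nat \<Rightarrow> real) \<Rightarrow> bool" where
  "ergodic_path e \<longleftrightarrow> (\<lambda>n. (\<Sum>i<n. (e i)\<^sup>2) / real n) \<longlonglongrightarrow> 1 \<and>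
     (\<forall>d>0. (\<lambda>n. (\<Sum>i<n. (if d \<le> i then e (i - d) else 0) * e i) / real n) \<longlonglongrightarrow> 0)"

text \<open>Lags d \<le> d' differ from the lags 0 and d' - d only by a time shift of d + 1, which
  disappears in the average.\<close>

lemma ergodic_path_lags:
  assumes "ergodic_path e"
  shows "(\<lambda>n. (\<Sum>i<n. lag e d i * lag e d' i) / real n) \<longlonglongrightarrow> (if d = d' then 1 else 0)"
proof -
  have *: "(\<lambda>n. (\<Sum>i<n. lag e d i * lag e d' i) / real n) \<longlonglongrightarrow> (if d = d' then 1 else 0)" if "d \<le> d'" for d d'
  proof -
    define \<tau> where "\<tau> = d' - d"
    define P where "P = (\<lambda>n. \<Sum>i<n. (if \<tau> \<le> i then e (i - \<tau>) else 0) * e i)"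
    have lim: "(\<lambda>n. P n / real n) \<longlonglongrightarrow> (if d = d' then 1 else 0)"
    proof (cases "d = d'")
      case True
      then show ?thesis using assms by (simp add: P_def \<tau>_def ergodic_path_def power2_eq_square)
    next
      case False
      then have "\<tau> > 0" using that by (simp add: \<tau>_def)
      then show ?thesis using assms False by (simp add: P_def ergodic_path_def)
    qed
    have "(\<lambda>n. P (n - 1 - d) / real (n - 1 - d)) \<longlonglongrightarrow> (if d = d' then 1 else 0)"
      by (rule filterlim_compose[OF lim]) real_asymp
    moreover have "(\<lambda>n. real (n - 1 - d) / real n) \<longlonglongrightarrow> 1" by real_asymp
    ultimately have A: "(\<lambda>n. P (n - 1 - d) / real (n - 1 - d) * (real (n - 1 - d) / real n)) \<longlonglongrightarrow> (if d = d' then 1 else 0) * 1"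
      by (rule tendsto_mult)
    have B: "\<forall>\<^sub>F n in sequentially. P (n - 1 - d) / real (n - 1 - d) * (real (n - 1 - d) / real n) = (\<Sum>i<n. lag e d i * lag e d' i) / real n"
      using eventually_gt_at_top[of "d + 1"]
    proof eventually_elim
      case (elim n)
      have "(\<Sum>i<n. lag e d i * lag e d' i) = (\<Sum>i\<in>{d<..<n}. lag e d i * lag e d' i)"
        by (rule sum.mono_neutral_right) (auto simp: lag_def)
      also have "\<dots> = P (n - 1 - d)"
        unfolding P_def
        by (rule sum.reindex_bij_witness[of _ "\<lambda>i. i + 1 + d" "\<lambda>i. i - 1 - d"]) (use that in \<open>auto simp: lag_def \<tau>_def\<close>)
      finally show ?case using elim by simp
    qed
    from Lim_transform_eventually[OF A B] show ?thesis by simp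
  qed
  show ?thesis using *[of d d'] *[of d' d] by (cases "d \<le> d'") (auto simp: mult.commute)
qed

lemma ergodic_path_rms_finite:
  assumes e: "ergodic_path e" and c: "\<And>d. m \<le> d \<Longrightarrow> c d = 0"
  shows "rms (lin_proc c e) \<longlonglongrightarrow> sqrt (\<Sum>d<m. (c d)\<^sup>2)"
proof -
  have "(\<lambda>n. \<Sum>d<m. \<Sum>d'<m. c d * c d' * ((\<Sum>i<n. lag e d i * lag e d' i) / real n)) \<longlonglongrightarrow> (\<Sum>d<m. \<Sum>d'<m. c d * c d' * (if d = d' then 1 else 0))"
    by (intro tendsto_sum tendsto_mult tendsto_const ergodic_path_lags[OF e])
  also have "(\<Sum>d<m. \<Sum>d'<m. c d * c d' * (if d = d' then 1 else 0)) = (\<Sum>d<m. (c d)\<^sup>2)"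
  proof (rule sum.cong)
    fix d assume "d \<in> {..<m}"
    have "(\<Sum>d'<m. c d * c d' * (if d = d' then 1 else 0)) = (\<Sum>d'\<in>{..<m}. if d = d' then (c d)\<^sup>2 else 0)"
      by (rule sum.cong) (auto simp: power2_eq_square)
    then show "(\<Sum>d'<m. c d * c d' * (if d = d' then 1 else 0)) = (c d)\<^sup>2" using \<open>d \<in> {..<m}\<close> by simp
  qed simp
  also have "(\<lambda>n. \<Sum>d<m. \<Sum>d'<m. c d * c d' * ((\<Sum>i<n. lag e d i * lag e d' i) / real n)) = (\<lambda>n. (\<Sum>i<n. (lin_proc c e i)\<^sup>2) / real n)"
  proof
    fix n
    have "(\<Sum>i<n. (lin_proc c e i)\<^sup>2) = (\<Sum>i<n. \<Sum>d<m. \<Sum>d'<m. c d * c d' * (lag e d i * lag e d' i))"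
      by (rule sum.cong) (use c in \<open>auto simp: lin_proc_lag[of m] power2_eq_square sum_product mult_ac\<close>)
    also have "\<dots> = (\<Sum>d<m. \<Sum>d'<m. \<Sum>i<n. c d * c d' * (lag e d i * lag e d' i))"
      by (simp add: sum.swap[of _ "{..<n}"])
    finally show "(\<Sum>d<m. \<Sum>d'<m. c d * c d' * ((\<Sum>i<n. lag e d i * lag e d' i) / real n)) = (\<Sum>i<n. (lin_proc c e i)\<^sup>2) / real n"
      by (simp add: sum_divide_distrib sum_distrib_left)
  qed
  finally show ?thesis unfolding rms_eq[abs_def] by (rule tendsto_real_sqrt)
qed

lemma ergodic_path_rms_self: "ergodic_path e \<Longrightarrow> rms e \<longlonglongrightarrow> 1"
  unfolding ergodic_path_def rms_eq[abs_def] using tendsto_real_sqrt[of _ 1] by auto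

lemma summable_square_of_abs: "summable (\<lambda>d. \<bar>c d\<bar>) \<Longrightarrow> summable (\<lambda>d. (c d)\<^sup>2)" for c :: "nat \<Rightarrow> real"
proof (rule summable_comparison_test_ev)
  assume c: "summable (\<lambda>d. \<bar>c d\<bar>)"
  have "(\<lambda>d. \<bar>c d\<bar>) \<longlonglongrightarrow> 0" by (rule summable_LIMSEQ_zero[OF c])
  then have "\<forall>\<^sub>F d in sequentially. \<bar>c d\<bar> < 1" by (rule order_tendstoD) simp
  then show "\<forall>\<^sub>F d in sequentially. norm ((c d)\<^sup>2) \<le> \<bar>c d\<bar>"
  proof eventually_elim
    case (elim d)
    have "\<bar>c d\<bar> * \<bar>c d\<bar> \<le> \<bar>c d\<bar> * 1" by (rule mult_left_mono) (use elim in auto)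
    then show ?case by (simp add: power2_eq_square)
  qed
qed

text \<open>Truncating c at m changes the quadratic mean by at most the l1 tail of c times a bound
  for e, uniformly in n by Young's inequality. This allows the limits in n and m to be
  exchanged.\<close>

theorem ergodic_path_rms:
  assumes e: "ergodic_path e" and c: "summable (\<lambda>d. \<bar>c d\<bar>)"
  shows "rms (lin_proc c e) \<longlonglongrightarrow> sqrt (\<Sum>d. (c d)\<^sup>2)"
proof -
  have c2: "summable (\<lambda>d. (c d)\<^sup>2)" by (rule summable_square_of_abs[OF c])
  from rms_bounded_of_limit[OF ergodic_path_rms_self[OF e]] obtain E where E: "\<And>n. rms e n \<le> E" by blast
  have E0: "E \<ge> 0" using E[of 0] rms_nonneg[of e 0] by linarith
  define T where "T = (\<lambda>m. (\<Sum>d. \<bar>c (d + m)\<bar>))"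
  have T_lim: "T \<longlonglongrightarrow> 0" unfolding T_def by (rule suminf_exist_split2[OF c])
  have approx: "\<bar>rms (lin_proc c e) n - rms (lin_proc (\<lambda>d. if d < m then c d else 0) e) n\<bar> \<le> T m * E" for n m
  proof -
    have "\<bar>rms (lin_proc c e) n - rms (lin_proc (\<lambda>d. if d < m then c d else 0) e) n\<bar>
        \<le> rms (\<lambda>i. lin_proc c e i - lin_proc (\<lambda>d. if d < m then c d else 0) e i) n" by (rule rms_diff_le)
    also have "\<dots> = rms (lin_proc (\<lambda>d. c d - (if d < m then c d else 0)) e) n"
      by (simp add: lin_proc_diff[abs_def])
    also have "\<dots> \<le> T m * rms e n"
    proof (rule rms_lin_proc)
      fix r
      have "(\<Sum>d<r. \<bar>c d - (if d < m then c d else 0)\<bar>) \<le> (\<Sum>d<r + m. \<bar>c d - (if d < m then c d else 0)\<bar>)"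
        by (rule sum_mono2) auto
      also have "\<dots> = (\<Sum>d\<in>{m..<r + m}. \<bar>c d\<bar>)"
        by (rule sum.mono_neutral_cong_right) auto
      also have "\<dots> = (\<Sum>d<r. \<bar>c (d + m)\<bar>)"
        by (rule sum.reindex_bij_witness[of _ "\<lambda>d. d + m" "\<lambda>d. d - m"]) auto
      also have "\<dots> \<le> T m" unfolding T_def
        by (rule sum_le_suminf) (use summable_ignore_initial_segment[OF c] in auto)
      finally show "(\<Sum>d<r. \<bar>c d - (if d < m then c d else 0)\<bar>) \<le> T m" .
    qed
    also have "\<dots> \<le> T m * E"
      by (intro mult_left_mono E) (auto simp: T_def intro!: suminf_nonneg summable_ignore_initial_segment[OF c])
    finally show ?thesis .
  qed
  have fin: "rms (lin_proc (\<lambda>d. if d < m then c d else 0) e) \<longlonglongrightarrow> sqrt (\<Sum>d<m. (c d)\<^sup>2)" for m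
  proof -
    have "(\<Sum>d<m. (if d < m then c d else 0)\<^sup>2) = (\<Sum>d<m. (c d)\<^sup>2)" by (rule sum.cong) auto
    then show ?thesis using ergodic_path_rms_finite[OF e, of m "\<lambda>d. if d < m then c d else 0"] by simp
  qed
  have part: "(\<lambda>m. sqrt (\<Sum>d<m. (c d)\<^sup>2)) \<longlonglongrightarrow> sqrt (\<Sum>d. (c d)\<^sup>2)"
    by (intro tendsto_real_sqrt summable_LIMSEQ c2)
  show ?thesis
  proof (rule LIMSEQ_I)
    fix r :: real assume "r > 0"
    then have r3: "r / 3 > 0" by simp
    have "(\<lambda>m. T m * E) \<longlonglongrightarrow> 0" using tendsto_mult_left_zero[OF T_lim] .
    from LIMSEQ_D[OF this r3] obtain m1 where m1: "\<And>m. m \<ge> m1 \<Longrightarrow> \<bar>T m * E\<bar> < r / 3" by auto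
    from LIMSEQ_D[OF part r3] obtain m2 where m2: "\<And>m. m \<ge> m2 \<Longrightarrow> \<bar>sqrt (\<Sum>d<m. (c d)\<^sup>2) - sqrt (\<Sum>d. (c d)\<^sup>2)\<bar> < r / 3" by auto
    define m where "m = max m1 m2"
    from LIMSEQ_D[OF fin[of m] r3] obtain n0 where
      n0: "\<And>n. n \<ge> n0 \<Longrightarrow> \<bar>rms (lin_proc (\<lambda>d. if d < m then c d else 0) e) n - sqrt (\<Sum>d<m. (c d)\<^sup>2)\<bar> < r / 3" by auto
    show "\<exists>no. \<forall>n\<ge>no. norm (rms (lin_proc c e) n - sqrt (\<Sum>d. (c d)\<^sup>2)) < r"
    proof (intro exI allI impI)
      fix n assume "n \<ge> n0"
      from n0[OF this] m1[of m] m2[of m] approx[of n m]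
      show "norm (rms (lin_proc c e) n - sqrt (\<Sum>d. (c d)\<^sup>2)) < r" unfolding m_def real_norm_def by linarith
    qed
  qed
qed

text \<open>For d > 0 the lagged products form a martingale with integrand
  \<open>\<eta> (i - d)\<close>; by the upper half of the iterated logarithm it is O(lil_scale),
  hence o(n).\<close>

lemma (in gaussian_noise) AE_ergodic_path: "AE \<omega> in M. ergodic_path (\<lambda>i. \<eta> i \<omega>)"
proof -
  have "AE \<omega> in M. (\<lambda>n. (\<Sum>i<n. (if d \<le> i then \<eta> (i - d) \<omega> else 0) * \<eta> i \<omega>) / real n) \<longlonglongrightarrow> 0" if "d > 0" for d
  proof -
    let ?u = "\<lambda>i \<omega>. if d \<le> i then \<eta> (i - d) \<omega> else 0"
    have "AE \<omega> in M. \<forall>\<delta>>0. \<forall>\<^sub>F n in sequentially. \<bar>\<Sum>i<n. ?u i \<omega> * \<eta> i \<omega>\<bar> \<le> (1 + \<delta>) * lil_scale n"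
    proof (rule upper_lil)
      show "?u i \<in> borel_measurable (past i)" for i
        using noise_past_measurable[of "i - d" i] that by (cases "d \<le> i") auto
      show "AE \<omega> in M. \<forall>\<delta>>0. \<forall>\<^sub>F n in sequentially. (\<Sum>i<n. (?u i \<omega>)\<^sup>2) \<le> (1\<^sup>2 + \<delta>) * real n"
        using noise_square_lln
      proof eventually_elim
        case (elim \<omega>)
        show ?case
        proof (intro allI impI)
          fix \<delta> :: real assume "\<delta> > 0"
          then have "\<forall>\<^sub>F n in sequentially. (\<Sum>i<n. (\<eta> i \<omega>)\<^sup>2) / real n < 1 + \<delta>"
            by (intro order_tendstoD[OF elim]) auto
          then show "\<forall>\<^sub>F n in sequentially. (\<Sum>i<n. (?u i \<omega>)\<^sup>2) \<le> (1\<^sup>2 + \<delta>) * real n"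
            using eventually_gt_at_top[of 0]
          proof eventually_elim
            case (elim n)
            have "(\<Sum>i<n. (?u i \<omega>)\<^sup>2) = (\<Sum>i\<in>{d..<n}. (\<eta> (i - d) \<omega>)\<^sup>2)"
              by (rule sum.mono_neutral_cong_right) auto
            also have "\<dots> = (\<Sum>i<n - d. (\<eta> i \<omega>)\<^sup>2)"
              by (rule sum.reindex_bij_witness[of _ "\<lambda>i. i + d" "\<lambda>i. i - d"]) auto
            also have "\<dots> \<le> (\<Sum>i<n. (\<eta> i \<omega>)\<^sup>2)" by (rule sum_mono2) auto
            finally show ?case using elim by (simp add: divide_less_eq)
          qed
        qed
      qed
    qed simp
    then show ?thesis
    proof eventually_elim
      case (elim \<omega>)
      show ?case
      proof (rule Lim_null_comparison)
        show "(\<lambda>n. 2 * (lil_scale n / real n)) \<longlonglongrightarrow> 0"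
          using tendsto_mult_right_zero[OF lil_scale_less_n] .
        show "\<forall>\<^sub>F n in sequentially. norm ((\<Sum>i<n. ?u i \<omega> * \<eta> i \<omega>) / real n) \<le> 2 * (lil_scale n / real n)"
          using elim[THEN spec, of 1, simplified] by eventually_elim (simp add: divide_right_mono)
      qed
    qed
  qed
  then have "AE \<omega> in M. d > 0 \<longrightarrow> (\<lambda>n. (\<Sum>i<n. (if d \<le> i then \<eta> (i - d) \<omega> else 0) * \<eta> i \<omega>) / real n) \<longlonglongrightarrow> 0" for d
    by (cases "d > 0") auto
  then have "AE \<omega> in M. \<forall>d>0. (\<lambda>n. (\<Sum>i<n. (if d \<le> i then \<eta> (i - d) \<omega> else 0) * \<eta> i \<omega>) / real n) \<longlonglongrightarrow> 0"
    by (simp add: AE_all_countable)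
  with noise_square_lln show ?thesis
    unfolding ergodic_path_def by eventually_elim auto
qed

section \<open>The perturbed autoregression\<close>

text \<open>The partial products of 1 + b satisfy the recursion with equality. Only times up to N
  are involved, so D may depend on the horizon, as it does in \<open>energy_bound\<close>.\<close>

lemma discrete_gronwall:
  fixes y b :: "nat \<Rightarrow> real"
  assumes le: "\<And>n. n \<le> N \<Longrightarrow> y n \<le> D + (\<Sum>j<n. b j * y j)" and b: "\<And>j. b j \<ge> 0" and "n \<le> N"
  shows "y n \<le> D * (\<Prod>j<n. 1 + b j)"
  using \<open>n \<le> N\<close>
proof (induction n rule: less_induct)
  case (less n)
  have key: "D + (\<Sum>j<m. b j * (D * (\<Prod>i<j. 1 + b i))) = D * (\<Prod>j<m. 1 + b j)" for m
    by (induction m) (auto simp: algebra_simps)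
  have "y n \<le> D + (\<Sum>j<n. b j * y j)" by (rule le[OF less.prems])
  also have "\<dots> \<le> D + (\<Sum>j<n. b j * (D * (\<Prod>i<j. 1 + b i)))"
    using less b by (intro add_left_mono sum_mono mult_left_mono) auto
  finally show ?case unfolding key .
qed

lemma square_sum_le_card: "(\<Sum>a\<in>I. x a)\<^sup>2 \<le> real (card I) * (\<Sum>a\<in>I. (x a)\<^sup>2)" for x :: "'b \<Rightarrow> real"
  using sum_squared_le_sum_of_squares[of x I] by (cases "finite I") (auto simp: mult.commute)

lemma square_add_le: "(x + y)\<^sup>2 \<le> 2 * x\<^sup>2 + 2 * y\<^sup>2" for x y :: real
  using sum_squares_bound[of x y] by (simp add: power2_eq_square algebra_simps)

text \<open>The recursion satisfied by \<open>Z\<^sub>n\<close>: in the notation of the paper \<open>z n\<close>, \<open>S n\<close>, \<open>w n\<close> are \<open>Z\<^sub>n\<close>,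
  \<open>\<Sum>\<^sub>m \<beta>\<^sub>m Z\<^sub>m\<close> and the regressor \<open>Z\<^sub>n + \<beta>\<^sub>n S\<^sub>n\<close>, and \<open>G d\<close> is the \<open>d\<close>-th power of the matrix \<open>A\<close>.
  The noise \<open>e n\<close> is \<open>\<epsilon>\<^sub>n\<^sub>+\<^sub>1\<close> with standard deviation \<open>sd n\<close>.\<close>

locale perturbed_ar =
  fixes p :: nat and A :: "nat \<Rightarrow> nat \<Rightarrow> real" and G :: "nat \<Rightarrow> nat \<Rightarrow> nat \<Rightarrow> real"
    and \<beta> :: "nat \<Rightarrow> real" and sd :: "nat \<Rightarrow> real" and sd_lim :: real and e :: "nat \<Rightarrow> real"
    and z S w :: "nat \<Rightarrow> nat \<Rightarrow> real" and K :: real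
  assumes z_0: "\<And>a. z 0 a = 0"
    and z_Suc: "\<And>n a. a < p \<Longrightarrow> z (Suc n) a = (\<Sum>b<p. A a b * w n b) + (if a = 0 then sd n * e n else 0)"
    and w_def: "\<And>n a. w n a = z n a + \<beta> n * S n a"
    and S_def: "\<And>n a. S n a = (\<Sum>m<n. \<beta> m * z m a)"
    and G_0: "\<And>a b. a < p \<Longrightarrow> b < p \<Longrightarrow> G 0 a b = (if a = b then 1 else 0)"
    and G_Suc: "\<And>d a b. a < p \<Longrightarrow> b < p \<Longrightarrow> G (Suc d) a b = (\<Sum>c<p. A a c * G d c b)"
    and G_summable: "\<And>a b r. a < p \<Longrightarrow> b < p \<Longrightarrow> (\<Sum>d<r. \<bar>G d a b\<bar>) \<le> K"
    and \<beta>_summable: "summable (\<lambda>n. (\<beta> n)\<^sup>2)"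
    and sd_lim: "sd \<longlonglongrightarrow> sd_lim" and sd_lim_pos: "sd_lim > 0" and sd_pos: "\<And>n. sd n > 0"
    and p_pos: "p > 0"
begin

text \<open>What the recursion contains besides A z: the feedback through
  \<open>\<beta> j * S j\<close> and the noise.\<close>

definition forcing :: "nat \<Rightarrow> nat \<Rightarrow> real" where
  "forcing b j = (\<Sum>c<p. A b c * (\<beta> j * S j c)) + (if b = 0 then sd j * e j else 0)"

text \<open>Variation of constants for z_{n+1} = A z_n + forcing_n started at 0.\<close>

lemma z_solution: "a < p \<Longrightarrow> z n a = (\<Sum>b<p. lin_proc (\<lambda>d. G d a b) (forcing b) n)"
proof (induction n arbitrary: a)
  case 0
  then show ?case by (simp add: z_0 lin_proc_def)
next
  case (Suc n)
  have step: "lin_proc (\<lambda>d. G d a b) (forcing b) (Suc n)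
      = (if a = b then forcing b n else 0) + (\<Sum>c<p. A a c * lin_proc (\<lambda>d. G d c b) (forcing b) n)" if "b < p" for b
  proof -
    have "lin_proc (\<lambda>d. G d a b) (forcing b) (Suc n) = (\<Sum>j<n. G (n - j) a b * forcing b j) + G 0 a b * forcing b n"
      unfolding lin_proc_def by simp
    also have "(\<Sum>j<n. G (n - j) a b * forcing b j) = (\<Sum>j<n. \<Sum>c<p. A a c * (G (n - 1 - j) c b * forcing b j))"
    proof (rule sum.cong)
      fix j assume "j \<in> {..<n}"
      then have "n - j = Suc (n - 1 - j)" by auto
      then show "G (n - j) a b * forcing b j = (\<Sum>c<p. A a c * (G (n - 1 - j) c b * forcing b j))"
        using G_Suc[OF Suc.prems that, of "n - 1 - j"] by (simp add: sum_distrib_right mult.assoc)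
    qed simp
    also have "\<dots> = (\<Sum>c<p. A a c * lin_proc (\<lambda>d. G d c b) (forcing b) n)"
      unfolding lin_proc_def by (subst sum.swap) (simp add: sum_distrib_left)
    finally show ?thesis using G_0[OF Suc.prems that] by simp
  qed
  have "z (Suc n) a = (\<Sum>c<p. A a c * z n c) + forcing a n"
    unfolding z_Suc[OF Suc.prems] forcing_def w_def by (simp add: algebra_simps sum.distrib)
  also have "(\<Sum>c<p. A a c * z n c) = (\<Sum>c<p. \<Sum>b<p. A a c * lin_proc (\<lambda>d. G d c b) (forcing b) n)"
    using Suc.IH by (simp add: sum_distrib_left)
  also have "\<dots> = (\<Sum>b<p. \<Sum>c<p. A a c * lin_proc (\<lambda>d. G d c b) (forcing b) n)" by (rule sum.swap)
  also have "forcing a n = (\<Sum>b<p. if a = b then forcing b n else 0)" using Suc.prems by simp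
  finally show ?case using Suc.prems by (simp add: step sum.distrib)
qed

lemma K_nonneg: "K \<ge> 0"
  using G_summable[of 0 0 0] p_pos by simp

lemma sd_bounded: "\<exists>C>0. \<forall>n. sd n \<le> C"
proof -
  have "Bseq sd" using convergent_imp_Bseq sd_lim convergent_def by blast
  then obtain C where "C > 0" "\<And>n. norm (sd n) \<le> C" unfolding Bseq_def by auto
  then show ?thesis by (intro exI[of _ C]) (auto simp: abs_le_iff)
qed

definition energy :: "nat \<Rightarrow> real" where
  "energy n = (\<Sum>a<p. \<Sum>i<n. (z i a)\<^sup>2)"

definition \<beta>_total :: real where "\<beta>_total = (\<Sum>n. (\<beta> n)\<^sup>2)"

lemma \<beta>_partial: "(\<Sum>i<n. (\<beta> i)\<^sup>2) \<le> \<beta>_total"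
  unfolding \<beta>_total_def by (rule sum_le_suminf[OF \<beta>_summable]) auto

lemma S_square_le: "a < p \<Longrightarrow> (S n a)\<^sup>2 \<le> \<beta>_total * energy n"
proof -
  assume "a < p"
  have "(S n a)\<^sup>2 \<le> (\<Sum>i<n. (\<beta> i)\<^sup>2) * (\<Sum>i<n. (z i a)\<^sup>2)"
    unfolding S_def by (rule Cauchy_Schwarz_ineq_sum)
  also have "\<dots> \<le> \<beta>_total * energy n"
  proof (rule mult_mono)
    show "(\<Sum>i<n. (z i a)\<^sup>2) \<le> energy n"
      unfolding energy_def using \<open>a < p\<close> by (intro member_le_sum) (auto intro: sum_nonneg)
    show "0 \<le> \<beta>_total" using \<beta>_partial[of 0] by simp
  qed (auto intro: \<beta>_partial sum_nonneg)
  finally show ?thesis .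
qed

text \<open>By Cauchy-Schwarz the squared feedback at j is at most a constant times (\<beta>_j)^2
  \<open>energy j\<close>, and the stable filters G are bounded in quadratic norm. The energy thus
  satisfies a linear inequality with summable weights, and the Gronwall factor stays below exp(c1
  \<open>\<beta>_total\<close>).\<close>

lemma energy_bound:
  "\<exists>C. \<forall>n. energy n \<le> C * (\<Sum>i<n. (e i)\<^sup>2)"
proof -
  obtain C where C: "C > 0" "\<And>n. sd n \<le> C" using sd_bounded by blast
  define Am where "Am = (\<Sum>b<p. \<Sum>c<p. (A b c)\<^sup>2)"
  \<comment> \<open>One factor p is the Cauchy-Schwarz cost of the sum over b in
    \<open>z_solution\<close>, the others count components; K^2 is the filter bound, and 2 comes
    from splitting the forcing into feedback and noise.\<close>
  define c1 where "c1 = real p * (real p * K\<^sup>2) * (2 * real p * (Am * (real p * \<beta>_total)))"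
  define c2 where "c2 = real p * (real p * K\<^sup>2) * (2 * real p * C\<^sup>2)"
  have \<beta>0: "\<beta>_total \<ge> 0" using \<beta>_partial[of 0] by simp
  have Am0: "Am \<ge> 0" unfolding Am_def by (intro sum_nonneg) auto
  have en0: "energy n \<ge> 0" for n unfolding energy_def by (intro sum_nonneg) auto
  have f: "(\<Sum>i<n. (forcing b i)\<^sup>2) \<le> 2 * (Am * (real p * \<beta>_total)) * (\<Sum>j<n. (\<beta> j)\<^sup>2 * energy j) + 2 * C\<^sup>2 * (\<Sum>i<n. (e i)\<^sup>2)"
    if "b < p" for b n
  proof -
    have "(forcing b j)\<^sup>2 \<le> 2 * ((Am * (real p * \<beta>_total)) * ((\<beta> j)\<^sup>2 * energy j)) + 2 * (C\<^sup>2 * (e j)\<^sup>2)" for j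
    proof -
      have "(\<Sum>c<p. A b c * (\<beta> j * S j c))\<^sup>2 \<le> (\<Sum>c<p. (A b c)\<^sup>2) * (\<Sum>c<p. (\<beta> j * S j c)\<^sup>2)"
        by (rule Cauchy_Schwarz_ineq_sum)
      also have "\<dots> \<le> Am * (\<Sum>c<p. (\<beta> j)\<^sup>2 * (\<beta>_total * energy j))"
      proof (rule mult_mono)
        show "(\<Sum>c<p. (A b c)\<^sup>2) \<le> Am"
          unfolding Am_def using that by (intro member_le_sum[of b "{..<p}" "\<lambda>b. \<Sum>c<p. (A b c)\<^sup>2"]) (auto intro: sum_nonneg)
        show "(\<Sum>c<p. (\<beta> j * S j c)\<^sup>2) \<le> (\<Sum>c<p. (\<beta> j)\<^sup>2 * (\<beta>_total * energy j))"
          unfolding power_mult_distrib by (intro sum_mono mult_left_mono S_square_le) auto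
      qed (auto intro: Am0 sum_nonneg)
      also have "\<dots> = (Am * (real p * \<beta>_total)) * ((\<beta> j)\<^sup>2 * energy j)" by simp
      finally have 1: "(\<Sum>c<p. A b c * (\<beta> j * S j c))\<^sup>2 \<le> (Am * (real p * \<beta>_total)) * ((\<beta> j)\<^sup>2 * energy j)" .
      have 2: "(if b = 0 then sd j * e j else 0)\<^sup>2 \<le> C\<^sup>2 * (e j)\<^sup>2"
      proof -
        have "(sd j)\<^sup>2 \<le> C\<^sup>2" using C(2)[of j] sd_pos[of j] by (intro power_mono) auto
        then have "(sd j)\<^sup>2 * (e j)\<^sup>2 \<le> C\<^sup>2 * (e j)\<^sup>2" by (rule mult_right_mono) simp
        then show ?thesis by (simp add: power_mult_distrib)
      qed
      show ?thesis using square_add_le[of "\<Sum>c<p. A b c * (\<beta> j * S j c)" "if b = 0 then sd j * e j else 0"] 1 2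
        unfolding forcing_def by linarith
    qed
    then have "(\<Sum>i<n. (forcing b i)\<^sup>2) \<le> (\<Sum>j<n. 2 * ((Am * (real p * \<beta>_total)) * ((\<beta> j)\<^sup>2 * energy j)) + 2 * (C\<^sup>2 * (e j)\<^sup>2))"
      by (intro sum_mono) auto
    then show ?thesis by (simp add: sum.distrib sum_distrib_left mult.assoc)
  qed
  have rec: "energy n \<le> c2 * (\<Sum>i<n. (e i)\<^sup>2) + (\<Sum>j<n. c1 * (\<beta> j)\<^sup>2 * energy j)" for n
  proof -
    have za: "(\<Sum>i<n. (z i a)\<^sup>2) \<le> real p * K\<^sup>2 * (\<Sum>b<p. \<Sum>i<n. (forcing b i)\<^sup>2)" if "a < p" for a
    proof -
      have "(\<Sum>i<n. (lin_proc (\<lambda>d. G d a b) (forcing b) i)\<^sup>2) \<le> K\<^sup>2 * (\<Sum>i<n. (forcing b i)\<^sup>2)" if "b < p" for b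
      proof -
        have "(L2_set (lin_proc (\<lambda>d. G d a b) (forcing b)) {..<n})\<^sup>2 \<le> (K * L2_set (forcing b) {..<n})\<^sup>2"
          using lin_proc_L2_bound[OF G_summable[OF \<open>a < p\<close> that]] by (intro power_mono) (auto simp: L2_set_nonneg)
        then show ?thesis by (simp add: L2_set_square power_mult_distrib)
      qed
      then have "(\<Sum>b<p. \<Sum>i<n. (lin_proc (\<lambda>d. G d a b) (forcing b) i)\<^sup>2) \<le> K\<^sup>2 * (\<Sum>b<p. \<Sum>i<n. (forcing b i)\<^sup>2)"
        by (subst sum_distrib_left) (intro sum_mono, auto)
      moreover have "(\<Sum>i<n. (z i a)\<^sup>2) \<le> (\<Sum>i<n. real p * (\<Sum>b<p. (lin_proc (\<lambda>d. G d a b) (forcing b) i)\<^sup>2))"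
        unfolding z_solution[OF that] by (intro sum_mono) (use square_sum_le_card[of _ "{..<p}"] in auto)
      moreover have "(\<Sum>i<n. real p * (\<Sum>b<p. (lin_proc (\<lambda>d. G d a b) (forcing b) i)\<^sup>2)) = real p * (\<Sum>b<p. \<Sum>i<n. (lin_proc (\<lambda>d. G d a b) (forcing b) i)\<^sup>2)"
        unfolding sum_distrib_left[symmetric] by (subst sum.swap) (rule refl)
      ultimately show ?thesis
        using mult_left_mono[of "\<Sum>b<p. \<Sum>i<n. (lin_proc (\<lambda>d. G d a b) (forcing b) i)\<^sup>2" "K\<^sup>2 * (\<Sum>b<p. \<Sum>i<n. (forcing b i)\<^sup>2)" "real p"]
        by (simp add: mult.assoc)
    qed
    let ?X = "2 * (Am * (real p * \<beta>_total)) * (\<Sum>j<n. (\<beta> j)\<^sup>2 * energy j) + 2 * C\<^sup>2 * (\<Sum>i<n. (e i)\<^sup>2)"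
    have "energy n \<le> (\<Sum>a<p. real p * K\<^sup>2 * (\<Sum>b<p. \<Sum>i<n. (forcing b i)\<^sup>2))"
      unfolding energy_def by (intro sum_mono za) auto
    also have "\<dots> \<le> (\<Sum>a<p. real p * K\<^sup>2 * (\<Sum>b<p. ?X))"
      by (intro sum_mono mult_left_mono f) auto
    also have "\<dots> = real p * (real p * K\<^sup>2) * (real p * ?X)" by simp
    also have "\<dots> = c2 * (\<Sum>i<n. (e i)\<^sup>2) + c1 * (\<Sum>j<n. (\<beta> j)\<^sup>2 * energy j)"
      unfolding c1_def c2_def by (simp add: algebra_simps)
    finally show ?thesis by (simp add: sum_distrib_left mult.assoc)
  qed
  have c12: "c1 \<ge> 0" "c2 \<ge> 0" unfolding c1_def c2_def using \<beta>0 Am0 K_nonneg by auto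
  have "energy n \<le> (c2 * exp (c1 * \<beta>_total)) * (\<Sum>i<n. (e i)\<^sup>2)" for n
  proof -
    let ?D = "c2 * (\<Sum>i<n. (e i)\<^sup>2)"
    have D0: "?D \<ge> 0" using c12 by (intro mult_nonneg_nonneg sum_nonneg) auto
    have "energy n \<le> ?D * (\<Prod>j<n. 1 + c1 * (\<beta> j)\<^sup>2)"
    proof (rule discrete_gronwall[of n])
      fix m assume "m \<le> n"
      then have "c2 * (\<Sum>i<m. (e i)\<^sup>2) \<le> ?D" using c12 by (intro mult_left_mono sum_mono2) auto
      then show "energy m \<le> ?D + (\<Sum>j<m. c1 * (\<beta> j)\<^sup>2 * energy j)" using rec[of m] by linarith
    qed (use c12 in auto)
    also have "\<dots> \<le> ?D * exp (c1 * \<beta>_total)"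
    proof (rule mult_left_mono[OF _ D0])
      have "(\<Prod>j<n. 1 + c1 * (\<beta> j)\<^sup>2) \<le> (\<Prod>j<n. exp (c1 * (\<beta> j)\<^sup>2))"
        using c12 by (intro prod_mono) auto
      also have "\<dots> = exp (c1 * (\<Sum>j<n. (\<beta> j)\<^sup>2))" by (simp add: exp_sum sum_distrib_left)
      also have "\<dots> \<le> exp (c1 * \<beta>_total)" using c12 \<beta>_partial by (simp add: mult_left_mono)
      finally show "(\<Prod>j<n. 1 + c1 * (\<beta> j)\<^sup>2) \<le> exp (c1 * \<beta>_total)" .
    qed
    finally show ?thesis by (simp add: mult_ac)
  qed
  then show ?thesis by blast
qed

text \<open>The energy is O(n), so S_j^2 is O(j) and (\<beta>_j S_j)^2 is O(j (\<beta>_j)^2). The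
  latter tends to 0, and so do its Cesaro means.\<close>

lemma perturbation_negligible:
  assumes e: "ergodic_path e" and j\<beta>: "(\<lambda>j. real j * (\<beta> j)\<^sup>2) \<longlonglongrightarrow> 0" and a: "a < p"
  shows "negligible_seq (\<lambda>j. \<beta> j * S j a)"
proof -
  from rms_bounded_of_limit[OF ergodic_path_rms_self[OF e]] obtain E where E: "\<And>n. rms e n \<le> E" by blast
  obtain C where C: "\<And>n. energy n \<le> C * (\<Sum>i<n. (e i)\<^sup>2)" using energy_bound by blast
  have E2: "(\<Sum>i<n. (e i)\<^sup>2) \<le> E\<^sup>2 * real n" for n
  proof (cases "n = 0")
    case False
    have "(rms e n)\<^sup>2 \<le> E\<^sup>2" using E rms_nonneg by (intro power_mono) auto
    then show ?thesis using False by (simp add: rms_square divide_le_eq)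
  qed simp
  have en: "energy n \<le> \<bar>C\<bar> * E\<^sup>2 * real n" for n
  proof -
    have "energy n \<le> \<bar>C\<bar> * (\<Sum>i<n. (e i)\<^sup>2)"
      using C[of n] mult_right_mono[OF abs_ge_self[of C], of "\<Sum>i<n. (e i)\<^sup>2"] by (auto simp: sum_nonneg)
    also have "\<dots> \<le> \<bar>C\<bar> * (E\<^sup>2 * real n)" by (intro mult_left_mono E2) auto
    finally show ?thesis by (simp add: mult.assoc)
  qed
  define L where "L = \<beta>_total * (\<bar>C\<bar> * E\<^sup>2)"
  have \<beta>0: "\<beta>_total \<ge> 0" using \<beta>_partial[of 0] by simp
  have bS: "(\<beta> j * S j a)\<^sup>2 \<le> (real j * (\<beta> j)\<^sup>2) * L" for j
  proof -
    have "(S j a)\<^sup>2 \<le> \<beta>_total * (\<bar>C\<bar> * E\<^sup>2 * real j)"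
      by (rule order_trans[OF S_square_le[OF a] mult_left_mono[OF en \<beta>0]])
    then have "(\<beta> j)\<^sup>2 * (S j a)\<^sup>2 \<le> (\<beta> j)\<^sup>2 * (\<beta>_total * (\<bar>C\<bar> * E\<^sup>2 * real j))" by (rule mult_left_mono) simp
    then show ?thesis by (simp add: L_def power_mult_distrib mult_ac)
  qed
  have "(\<lambda>n. (\<Sum>j<n. (real j * (\<beta> j)\<^sup>2) * L) / real n) \<longlonglongrightarrow> 0"
    by (rule cesaro_weighted[OF j\<beta>, of _ L]) (use \<beta>0 in \<open>auto simp: L_def\<close>)
  then have "(\<lambda>n. sqrt ((\<Sum>j<n. (real j * (\<beta> j)\<^sup>2) * L) / real n)) \<longlonglongrightarrow> sqrt 0" by (rule tendsto_real_sqrt)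
  then have lim: "(\<lambda>n. sqrt ((\<Sum>j<n. (real j * (\<beta> j)\<^sup>2) * L) / real n)) \<longlonglongrightarrow> 0" by simp
  show ?thesis unfolding negligible_seq_def
  proof (rule tendsto_sandwich[OF _ _ tendsto_const lim])
    show "\<forall>\<^sub>F n in sequentially. rms (\<lambda>j. \<beta> j * S j a) n \<le> sqrt ((\<Sum>j<n. (real j * (\<beta> j)\<^sup>2) * L) / real n)"
      unfolding rms_eq by (intro always_eventually allI real_sqrt_le_mono divide_right_mono sum_mono bS) auto
  qed (simp add: rms_nonneg)
qed

text \<open>The standard deviation is replaced by its limit both inside the filter and in the
  denominator, where the two cancel. This is why the limiting filter is free of
  \<open>sd_lim\<close>.\<close>

theorem normalized_regressor_approx:
  assumes e: "ergodic_path e" and j\<beta>: "(\<lambda>j. real j * (\<beta> j)\<^sup>2) \<longlonglongrightarrow> 0" and a: "a < p"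
  shows "negligible_seq (\<lambda>i. w i a / sd i - lin_proc (\<lambda>d. G d a 0) e i)"
proof -
  note pert = perturbation_negligible[OF e j\<beta>]
  from rms_bounded_of_limit[OF ergodic_path_rms_self[OF e]] obtain E where E: "\<And>n. rms e n \<le> E" by blast
  let ?g = "\<lambda>d. G d a 0"
  have g: "\<And>r. (\<Sum>d<r. \<bar>?g d\<bar>) \<le> K" using G_summable[OF a p_pos] .
  have n1: "negligible_seq (\<lambda>i. \<Sum>b<p. lin_proc (\<lambda>d. G d a b) (\<lambda>j. \<Sum>c<p. A b c * (\<beta> j * S j c)) i)"
    by (intro negligible_seq_sum negligible_seq_lin_proc[OF _ G_summable[OF a]] negligible_seq_scale pert) auto
  have "negligible_seq (\<lambda>j. (sd j - sd_lim) * e j)"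
  proof (rule negligible_seq_weighted[OF _ E])
    show "(\<lambda>j. sd j - sd_lim) \<longlonglongrightarrow> 0" using sd_lim by (simp add: LIM_zero_iff)
  qed
  then have n2: "negligible_seq (lin_proc ?g (\<lambda>j. (sd j - sd_lim) * e j))"
    by (rule negligible_seq_lin_proc[OF _ g])
  \<comment> \<open>Three errors: the feedback within the forcing, the drift of the standard
    deviation, and the feedback in w itself.\<close>
  have dec: "w i a - sd_lim * lin_proc ?g e i
      = (\<Sum>b<p. lin_proc (\<lambda>d. G d a b) (\<lambda>j. \<Sum>c<p. A b c * (\<beta> j * S j c)) i)
        + lin_proc ?g (\<lambda>j. (sd j - sd_lim) * e j) i + \<beta> i * S i a" for i
  proof -
    have fb: "forcing b = (\<lambda>j. (\<Sum>c<p. A b c * (\<beta> j * S j c)) + (if b = 0 then sd j * e j else 0))" for b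
      unfolding forcing_def by simp
    have "(\<Sum>b<p. lin_proc (\<lambda>d. G d a b) (\<lambda>j. if b = 0 then sd j * e j else 0) i)
        = (\<Sum>b<p. if b = 0 then lin_proc ?g (\<lambda>j. sd j * e j) i else 0)"
      by (rule sum.cong) (auto simp: lin_proc_def)
    also have "\<dots> = lin_proc ?g (\<lambda>j. sd j * e j) i" using p_pos by simp
    finally have "z i a = (\<Sum>b<p. lin_proc (\<lambda>d. G d a b) (\<lambda>j. \<Sum>c<p. A b c * (\<beta> j * S j c)) i) + lin_proc ?g (\<lambda>j. sd j * e j) i"
      unfolding z_solution[OF a] fb lin_proc_add_noise sum.distrib by simp
    moreover have "lin_proc ?g (\<lambda>j. (sd j - sd_lim) * e j) i = lin_proc ?g (\<lambda>j. sd j * e j) i - sd_lim * lin_proc ?g e i"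
      by (simp add: left_diff_distrib lin_proc_diff_noise lin_proc_scale_noise)
    ultimately show ?thesis by (simp add: w_def)
  qed
  have n3: "negligible_seq (\<lambda>i. w i a - sd_lim * lin_proc ?g e i)"
    unfolding dec by (intro negligible_seq_add n1 n2 pert a)
  have inv: "(\<lambda>i. 1 / sd i) \<longlonglongrightarrow> 1 / sd_lim" using sd_lim sd_lim_pos by (intro tendsto_intros) auto
  then have "Bseq (\<lambda>i. 1 / sd i)" using convergent_imp_Bseq convergent_def by blast
  then obtain C where C: "\<And>i. \<bar>1 / sd i\<bar> \<le> C" unfolding Bseq_def by auto
  have n4: "negligible_seq (\<lambda>i. 1 / sd i * (w i a - sd_lim * lin_proc ?g e i))"
    by (rule negligible_seq_bounded_mult[OF n3 C])
  have n5: "negligible_seq (\<lambda>i. (sd_lim * (1 / sd i) - 1) * lin_proc ?g e i)"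
  proof (rule negligible_seq_weighted)
    have "(\<lambda>i. sd_lim * (1 / sd i) - 1) \<longlonglongrightarrow> sd_lim * (1 / sd_lim) - 1" by (intro tendsto_intros inv)
    then show "(\<lambda>i. sd_lim * (1 / sd i) - 1) \<longlonglongrightarrow> 0" using sd_lim_pos by simp
    show "rms (lin_proc ?g e) n \<le> K * E" for n
      by (rule order_trans[OF rms_lin_proc[OF g] mult_left_mono[OF E K_nonneg]])
  qed
  have "w i a / sd i - lin_proc ?g e i = 1 / sd i * (w i a - sd_lim * lin_proc ?g e i) + (sd_lim * (1 / sd i) - 1) * lin_proc ?g e i" for i
    using sd_pos[of i] by (simp add: field_simps)
  then show ?thesis using negligible_seq_add[OF n4 n5] by simp
qed

end

section \<open>The Levinson-Durbin recursion\<close>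

locale gaussian_innovations = prob_space M for M :: "'a measure" +
  fixes \<xi> :: "nat \<Rightarrow> 'a \<Rightarrow> real" and \<sigma> :: "nat \<Rightarrow> real" and \<epsilon> :: "nat \<Rightarrow> 'a \<Rightarrow> real"
    and k :: "nat \<Rightarrow> nat \<Rightarrow> real"
  assumes xi_measurable: "\<And>n. 1 \<le> n \<Longrightarrow> \<xi> n \<in> borel_measurable M"
    and stationary: "stationary_process M \<xi>"
    and innov: "innovations M \<xi> \<sigma> \<epsilon>"
    and coeffs: "innovation_coeffs M \<xi> \<sigma> \<epsilon> k"
begin

text \<open>An index shift: the noise \<open>\<eta> i\<close> is \<open>\<epsilon> (Suc i)\<close>,
  so \<open>past n\<close> is generated by the first n innovations.\<close>

sublocale gaussian_noise M "\<lambda>i. \<epsilon> (Suc i)"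
proof
  have ind: "indep_vars (\<lambda>_. borel) \<epsilon> {1..}" using innov by (simp add: innovations_def)
  have "indep_vars (\<lambda>i. PiM {Suc i} (\<lambda>_. borel)) (\<lambda>i \<omega>. restrict (\<lambda>j. \<epsilon> j \<omega>) {Suc i}) UNIV"
    by (rule indep_vars_restrict[OF ind]) (auto simp: disjoint_family_on_def)
  from indep_vars_compose2[OF this, of "\<lambda>i x. x (Suc i)" "\<lambda>_. borel"]
  show "indep_vars (\<lambda>_. borel) (\<lambda>i. \<epsilon> (Suc i)) UNIV" by (simp add: measurable_component_singleton)
  show "distributed M lborel (\<epsilon> (Suc n)) std_normal_density" for n
    using innov by (simp add: innovations_def)
qed

lemma sigma_pos: "1 \<le> n \<Longrightarrow> \<sigma> n > 0"
  using innov by (simp add: innovations_def)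

lemma k_diag: "1 \<le> n \<Longrightarrow> k n n = 1"
  using coeffs by (simp add: innovation_coeffs_def)

lemma AE_innovation: "1 \<le> n \<Longrightarrow> AE \<omega> in M. \<sigma> n * \<epsilon> n \<omega> = (\<Sum>i=1..n. k n i * \<xi> i \<omega>)"
  using coeffs by (simp add: innovation_coeffs_def)

lemma eps_measurable: "1 \<le> n \<Longrightarrow> \<epsilon> n \<in> borel_measurable M"
  using noise_measurable[of "n - 1"] by simp

lemma eps_square_integrable: "1 \<le> n \<Longrightarrow> integrable M (\<lambda>\<omega>. (\<epsilon> n \<omega>)\<^sup>2)"
  using noise_square_integrable[of "n - 1"] by simp

lemma eps_orthonormal:
  assumes "1 \<le> m" "1 \<le> n"
  shows "expectation (\<lambda>\<omega>. \<epsilon> m \<omega> * \<epsilon> n \<omega>) = (if m = n then 1 else 0)"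
proof -
  have lt: "expectation (\<lambda>\<omega>. \<epsilon> m \<omega> * \<epsilon> n \<omega>) = 0" if "m < n" "1 \<le> m" for m n
  proof -
    have "\<epsilon> (Suc (m - 1)) \<in> borel_measurable (past (n - 1))"
      by (rule noise_past_measurable) (use that in auto)
    from integral_past_noise(2)[OF this noise_integrable, of "\<lambda>x. x"]
    show ?thesis using that noise_integrable[of "n - 1"] noise_mean[of "n - 1"] by simp
  qed
  show ?thesis
    using lt[of m n] lt[of n m] noise_second_moment[of "n - 1"] assms
    by (cases m n rule: linorder_cases) (auto simp: power2_eq_square mult.commute)
qed

lemma AE_xi: "1 \<le> n \<Longrightarrow> AE \<omega> in M. \<xi> n \<omega> = \<sigma> n * \<epsilon> n \<omega> - (\<Sum>i\<in>{1..<n}. k n i * \<xi> i \<omega>)"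
proof -
  assume n: "1 \<le> n"
  then have "{1..n} = insert n {1..<n}" by auto
  then have "(\<Sum>i=1..n. k n i * \<xi> i \<omega>) = \<xi> n \<omega> + (\<Sum>i\<in>{1..<n}. k n i * \<xi> i \<omega>)" for \<omega>
    using k_diag[OF n] by simp
  then show ?thesis using AE_innovation[OF n] by auto
qed

text \<open>By \<open>AE_xi\<close>, \<xi>_n is \<sigma>_n \<epsilon>_n plus a combination of
  earlier values, so by induction integrability and orthogonality to later innovations come from the
  innovations alone.\<close>

lemma xi_moments:
  "1 \<le> n \<Longrightarrow> integrable M (\<lambda>\<omega>. (\<xi> n \<omega>)\<^sup>2) \<and>
    (\<forall>m\<ge>n. integrable M (\<lambda>\<omega>. \<epsilon> m \<omega> * \<xi> n \<omega>) \<and> expectation (\<lambda>\<omega>. \<epsilon> m \<omega> * \<xi> n \<omega>) = (if m = n then \<sigma> n else 0))"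
proof (induction n rule: less_induct)
  case (less n)
  note n = less.prems
  have IH: "integrable M (\<lambda>\<omega>. (\<xi> i \<omega>)\<^sup>2)" "integrable M (\<lambda>\<omega>. \<epsilon> m \<omega> * \<xi> i \<omega>)" "expectation (\<lambda>\<omega>. \<epsilon> m \<omega> * \<xi> i \<omega>) = 0"
    if "i \<in> {1..<n}" "n \<le> m" for i m using less.IH[of i] that by auto
  let ?R = "\<lambda>\<omega>. \<sigma> n * \<epsilon> n \<omega> - (\<Sum>i\<in>{1..<n}. k n i * \<xi> i \<omega>)"
  have meas: "\<xi> i \<in> borel_measurable M" if "i \<in> {1..<n}" for i using that by (intro xi_measurable) auto
  have R_meas: "?R \<in> borel_measurable M"
    using meas eps_measurable[OF n] by (intro borel_measurable_diff borel_measurable_sum borel_measurable_times) auto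
  have prods: "integrable M (\<lambda>\<omega>. \<xi> i \<omega> * \<xi> j \<omega>)" if "i \<in> {1..<n}" "j \<in> {1..<n}" for i j
    by (rule integrable_mult_of_square) (use that meas IH(1) in auto)
  have "integrable M (\<lambda>\<omega>. (?R \<omega>)\<^sup>2)"
  proof -
    have "(\<lambda>\<omega>. (?R \<omega>)\<^sup>2) = (\<lambda>\<omega>. (\<sigma> n)\<^sup>2 * (\<epsilon> n \<omega>)\<^sup>2 - 2 * \<sigma> n * (\<Sum>i\<in>{1..<n}. k n i * (\<epsilon> n \<omega> * \<xi> i \<omega>))
        + (\<Sum>i\<in>{1..<n}. \<Sum>j\<in>{1..<n}. k n i * k n j * (\<xi> i \<omega> * \<xi> j \<omega>)))"
      by (rule ext) (simp add: power2_eq_square sum_product sum_distrib_left algebra_simps)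
    then show ?thesis
      using IH(2) prods eps_square_integrable[OF n]
      by (auto intro!: Bochner_Integration.integrable_add Bochner_Integration.integrable_diff
          Bochner_Integration.integrable_sum integrable_mult_right)
  qed
  then have "integrable M (\<lambda>\<omega>. (\<xi> n \<omega>)\<^sup>2)"
    by (subst integrable_cong_AE[of _ _ "\<lambda>\<omega>. (?R \<omega>)\<^sup>2"])
      (use AE_xi[OF n] xi_measurable[OF n] R_meas in \<open>auto elim: eventually_mono\<close>)
  moreover have "integrable M (\<lambda>\<omega>. \<epsilon> m \<omega> * \<xi> n \<omega>) \<and> expectation (\<lambda>\<omega>. \<epsilon> m \<omega> * \<xi> n \<omega>) = (if m = n then \<sigma> n else 0)"
    if m: "n \<le> m" for m
  proof -
    have m1: "1 \<le> m" using n m by simp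
    have eq: "AE \<omega> in M. \<epsilon> m \<omega> * \<xi> n \<omega> = \<sigma> n * (\<epsilon> m \<omega> * \<epsilon> n \<omega>) - (\<Sum>i\<in>{1..<n}. k n i * (\<epsilon> m \<omega> * \<xi> i \<omega>))"
      using AE_xi[OF n]
    proof eventually_elim
      case (elim \<omega>)
      show ?case unfolding elim by (simp add: right_diff_distrib sum_distrib_left mult_ac)
    qed
    have me: "(\<lambda>\<omega>. \<epsilon> m \<omega> * \<xi> n \<omega>) \<in> borel_measurable M"
      "(\<lambda>\<omega>. \<sigma> n * (\<epsilon> m \<omega> * \<epsilon> n \<omega>) - (\<Sum>i\<in>{1..<n}. k n i * (\<epsilon> m \<omega> * \<xi> i \<omega>))) \<in> borel_measurable M"
      using meas eps_measurable n m1 xi_measurable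
      by (intro borel_measurable_diff borel_measurable_sum borel_measurable_times; auto)+
    have ee: "integrable M (\<lambda>\<omega>. \<epsilon> m \<omega> * \<epsilon> n \<omega>)"
      by (rule integrable_mult_of_square) (use eps_measurable eps_square_integrable n m1 in auto)
    have ii: "integrable M (\<lambda>\<omega>. \<Sum>i\<in>{1..<n}. k n i * (\<epsilon> m \<omega> * \<xi> i \<omega>))"
      using IH(2) m by (intro Bochner_Integration.integrable_sum integrable_mult_right) auto
    have "expectation (\<lambda>\<omega>. \<Sum>i\<in>{1..<n}. k n i * (\<epsilon> m \<omega> * \<xi> i \<omega>)) = 0"
      using IH(2,3) m by (subst Bochner_Integration.integral_sum) (auto intro!: integrable_mult_right)
    then show ?thesis
      using integrable_cong_AE[OF me eq] integral_cong_AE[OF me eq] ee ii eps_orthonormal[OF m1 n] by auto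
  qed
  ultimately show ?case by blast
qed

section \<open>Toeplitz covariances and the normal equations\<close>

lemma xi_products: "1 \<le> i \<Longrightarrow> 1 \<le> j \<Longrightarrow> integrable M (\<lambda>\<omega>. \<xi> i \<omega> * \<xi> j \<omega>)"
  by (rule integrable_mult_of_square) (use xi_measurable xi_moments in auto)

definition cov :: "nat \<Rightarrow> nat \<Rightarrow> real" where
  "cov i j = expectation (\<lambda>\<omega>. \<xi> i \<omega> * \<xi> j \<omega>)"

lemma cov_commute: "cov i j = cov j i"
  by (simp add: cov_def mult.commute)

lemma cov_shift: "cov (Suc h) (Suc h + d) = cov 1 (1 + d)"
proof -
  have m: "(\<lambda>\<omega> n. \<xi> (n + 1 + h) \<omega>) \<in> measurable M (PiM UNIV (\<lambda>_. borel))" for h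
    by (rule measurable_PiM_single') (auto intro: xi_measurable)
  have f: "(\<lambda>x. x 0 * x d) \<in> borel_measurable (PiM UNIV (\<lambda>_. borel :: real measure))"
    by (intro borel_measurable_times measurable_component_singleton) auto
  have "cov (Suc h) (Suc h + d) = integral\<^sup>L (distr M (PiM UNIV (\<lambda>_. borel)) (\<lambda>\<omega> n. \<xi> (n + 1 + h) \<omega>)) (\<lambda>x. x 0 * x d)" for h
    unfolding cov_def by (subst integral_distr[OF m f]) (simp add: add_ac)
  from this[of h] this[of 0] show ?thesis
    using stationary unfolding stationary_process_def by simp
qed

definition acf :: "nat \<Rightarrow> real" where "acf d = cov 1 (1 + d)"

lemma cov_acf: "1 \<le> i \<Longrightarrow> i \<le> j \<Longrightarrow> cov i j = acf (j - i)"
  using cov_shift[of "i - 1" "j - i"] by (simp add: acf_def)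

lemma cov_Suc: "1 \<le> i \<Longrightarrow> 1 \<le> j \<Longrightarrow> cov (Suc i) (Suc j) = cov i j"
proof -
  assume ij: "1 \<le> i" "1 \<le> j"
  have *: "cov (Suc i) (Suc j) = cov i j" if "i \<le> j" "1 \<le> i" for i j
    using cov_acf[of i j] cov_acf[of "Suc i" "Suc j"] that by simp
  show ?thesis using *[of i j] *[of j i] ij cov_commute[of i j] cov_commute[of "Suc i" "Suc j"] by (cases "i \<le> j") auto
qed

text \<open>Both sides depend only on |n + 1 - i - j|: the time reversal symmetry of a Toeplitz
  matrix.\<close>

lemma cov_reflect:
  assumes "1 \<le> i" "i \<le> n" "1 \<le> j" "j \<le> n"
  shows "cov (n + 1 - i) j = cov i (n + 1 - j)"
proof (cases "n + 1 - i \<le> j")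
  case True
  then have "cov (n + 1 - i) j = acf (j - (n + 1 - i))" using assms by (intro cov_acf) auto
  moreover have "cov (n + 1 - j) i = acf (i - (n + 1 - j))" using assms True by (intro cov_acf) auto
  moreover have "j - (n + 1 - i) = i - (n + 1 - j)" using assms True by auto
  ultimately show ?thesis using cov_commute by metis
next
  case False
  then have "cov j (n + 1 - i) = acf (n + 1 - i - j)" using assms by (intro cov_acf) auto
  moreover have "cov i (n + 1 - j) = acf (n + 1 - j - i)" using assms False by (intro cov_acf) auto
  moreover have "n + 1 - i - j = n + 1 - j - i" by auto
  ultimately show ?thesis using cov_commute by metis
qed

text \<open>Yule-Walker: the prediction error \<sigma>_n \<epsilon>_n is orthogonal to the earlier
  values and has covariance \<sigma>_n^2 with \<xi>_n.\<close>

lemma normal_equations: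
  assumes "1 \<le> j" "j \<le> n"
  shows "(\<Sum>i=1..n. k n i * cov i j) = (if j = n then (\<sigma> n)\<^sup>2 else 0)"
proof -
  have n: "1 \<le> n" using assms by simp
  have "(\<Sum>i=1..n. k n i * cov i j) = expectation (\<lambda>\<omega>. \<Sum>i=1..n. k n i * (\<xi> i \<omega> * \<xi> j \<omega>))"
    unfolding cov_def using xi_products assms
    by (subst Bochner_Integration.integral_sum) (auto intro!: integrable_mult_right)
  also have "\<dots> = expectation (\<lambda>\<omega>. \<sigma> n * (\<epsilon> n \<omega> * \<xi> j \<omega>))"
  proof (rule integral_cong_AE)
    show "AE \<omega> in M. (\<Sum>i=1..n. k n i * (\<xi> i \<omega> * \<xi> j \<omega>)) = \<sigma> n * (\<epsilon> n \<omega> * \<xi> j \<omega>)"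
      using AE_innovation[OF n]
    proof eventually_elim
      case (elim \<omega>)
      have "\<sigma> n * (\<epsilon> n \<omega> * \<xi> j \<omega>) = (\<Sum>i=1..n. k n i * \<xi> i \<omega>) * \<xi> j \<omega>" unfolding elim[symmetric] by simp
      then show ?case by (simp add: sum_distrib_right mult.assoc)
    qed
    show "(\<lambda>\<omega>. \<Sum>i=1..n. k n i * (\<xi> i \<omega> * \<xi> j \<omega>)) \<in> borel_measurable M"
      using xi_measurable assms by (intro borel_measurable_sum borel_measurable_times) auto
    show "(\<lambda>\<omega>. \<sigma> n * (\<epsilon> n \<omega> * \<xi> j \<omega>)) \<in> borel_measurable M"
      using xi_measurable[OF assms(1)] eps_measurable[OF n] by (intro borel_measurable_times) auto
  qed
  also have "\<dots> = \<sigma> n * expectation (\<lambda>\<omega>. \<epsilon> n \<omega> * \<xi> j \<omega>)" by simp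
  also have "\<dots> = (if j = n then (\<sigma> n)\<^sup>2 else 0)" using xi_moments[OF assms(1)] assms(2) by (auto simp: power2_eq_square)
  finally show ?thesis .
qed

text \<open>The covariance matrices are nonsingular because \<open>\<xi>\<^sub>j\<close> has the component \<open>\<sigma>\<^sub>j\<close> along \<open>\<epsilon>\<^sub>j\<close>.\<close>

lemma cov_nondegenerate:
  assumes zero: "(\<Sum>j=1..N. d j * (\<Sum>i=1..N. d i * cov i j)) = 0" and "i \<in> {1..N}"
  shows "d i = 0"
proof (rule ccontr)
  assume "d i \<noteq> 0"
  \<comment> \<open>At the last nonzero coefficient, testing the combination with \<epsilon>_j
    isolates d_j \<sigma>_j.\<close>
  define j where "j = Max {i\<in>{1..N}. d i \<noteq> 0}"
  have ne: "{i\<in>{1..N}. d i \<noteq> 0} \<noteq> {}" using \<open>d i \<noteq> 0\<close> assms(2) by auto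
  have j: "j \<in> {1..N}" "d j \<noteq> 0" using Max_in[OF _ ne] unfolding j_def by auto
  have gt: "d i = 0" if "i \<in> {1..N}" "j < i" for i
  proof (rule ccontr)
    assume "d i \<noteq> 0"
    then have "i \<le> j" unfolding j_def using that by (intro Max_ge) auto
    then show False using that by simp
  qed
  let ?D = "\<lambda>\<omega>. \<Sum>i=1..N. d i * \<xi> i \<omega>"
  have Dm: "?D \<in> borel_measurable M" using xi_measurable by (intro borel_measurable_sum borel_measurable_times) auto
  have D2: "(\<lambda>\<omega>. (?D \<omega>)\<^sup>2) = (\<lambda>\<omega>. \<Sum>j=1..N. \<Sum>i=1..N. d j * (d i * (\<xi> i \<omega> * \<xi> j \<omega>)))"
    by (rule ext) (simp add: power2_eq_square sum_product sum_distrib_left algebra_simps)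
  have Di: "integrable M (\<lambda>\<omega>. (?D \<omega>)\<^sup>2)"
    unfolding D2 using xi_products by (intro Bochner_Integration.integrable_sum integrable_mult_right) auto
  have "expectation (\<lambda>\<omega>. (?D \<omega>)\<^sup>2) = (\<Sum>j=1..N. d j * (\<Sum>i=1..N. d i * cov i j))"
  proof -
    have int: "integrable M (\<lambda>\<omega>. d j * (d i * (\<xi> i \<omega> * \<xi> j \<omega>)))" if "i \<in> {1..N}" "j \<in> {1..N}" for i j
      using xi_products that by (intro integrable_mult_right) auto
    have "expectation (\<lambda>\<omega>. (?D \<omega>)\<^sup>2) = (\<Sum>j=1..N. expectation (\<lambda>\<omega>. \<Sum>i=1..N. d j * (d i * (\<xi> i \<omega> * \<xi> j \<omega>))))"
      unfolding D2 by (rule Bochner_Integration.integral_sum) (use int in \<open>auto intro!: Bochner_Integration.integrable_sum\<close>)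
    also have "\<dots> = (\<Sum>j=1..N. \<Sum>i=1..N. expectation (\<lambda>\<omega>. d j * (d i * (\<xi> i \<omega> * \<xi> j \<omega>))))"
      by (intro sum.cong refl Bochner_Integration.integral_sum int)
    finally show ?thesis by (simp add: cov_def sum_distrib_left)
  qed
  then have "AE \<omega> in M. (?D \<omega>)\<^sup>2 = 0"
    using zero integral_nonneg_eq_0_iff_AE[OF Di] by simp
  then have D0: "AE \<omega> in M. ?D \<omega> = 0" by simp
  have j1: "1 \<le> j" using j by simp
  have "expectation (\<lambda>\<omega>. \<epsilon> j \<omega> * ?D \<omega>) = expectation (\<lambda>\<omega>. 0)"
  proof (rule integral_cong_AE)
    show "AE \<omega> in M. \<epsilon> j \<omega> * ?D \<omega> = 0" using D0 by eventually_elim simp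
    show "(\<lambda>\<omega>. \<epsilon> j \<omega> * ?D \<omega>) \<in> borel_measurable M" using Dm eps_measurable[OF j1] by (rule borel_measurable_times[rotated])
  qed simp
  moreover have "(\<lambda>\<omega>. \<epsilon> j \<omega> * ?D \<omega>) = (\<lambda>\<omega>. \<Sum>i\<in>{1..j}. d i * (\<epsilon> j \<omega> * \<xi> i \<omega>))"
  proof
    fix \<omega>
    have "?D \<omega> = (\<Sum>i\<in>{1..j}. d i * \<xi> i \<omega>)"
      by (rule sum.mono_neutral_right) (use j gt in auto)
    then show "\<epsilon> j \<omega> * ?D \<omega> = (\<Sum>i\<in>{1..j}. d i * (\<epsilon> j \<omega> * \<xi> i \<omega>))" by (simp add: sum_distrib_left mult_ac)
  qed
  moreover have "expectation (\<lambda>\<omega>. \<Sum>i\<in>{1..j}. d i * (\<epsilon> j \<omega> * \<xi> i \<omega>)) = (\<Sum>i\<in>{1..j}. d i * (if j = i then \<sigma> i else 0))"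
    using xi_moments by (subst Bochner_Integration.integral_sum) (auto intro!: integrable_mult_right sum.cong)
  moreover have "(\<Sum>i\<in>{1..j}. d i * (if j = i then \<sigma> i else 0)) = (\<Sum>i\<in>{1..j}. if j = i then d j * \<sigma> j else 0)"
    by (rule sum.cong) auto
  moreover have "\<dots> = d j * \<sigma> j" using j1 by simp
  ultimately have "d j * \<sigma> j = 0" by simp
  then show False using j sigma_pos[OF j1] by simp
qed

abbreviation \<beta> :: "nat \<Rightarrow> real" where "\<beta> \<equiv> pacf k"

text \<open>The index 0 is included so that the Levinson-Durbin recursion holds at the boundary.\<close>

definition k0 :: "nat \<Rightarrow> nat \<Rightarrow> real" where
  "k0 n i = (if i = 0 then 0 else k n i)"

text \<open>By stationarity the predictor of order n moved one step on still solves the normal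
  equations, now in rows 2 to n + 1.\<close>

lemma sum_k0_forward:
  assumes "1 \<le> n" "2 \<le> j" "j \<le> n + 1"
  shows "(\<Sum>i=1..n+1. k0 n (i - 1) * cov i j) = (if j = n + 1 then (\<sigma> n)\<^sup>2 else 0)"
proof -
  have "(\<Sum>i=1..n+1. k0 n (i - 1) * cov i j) = (\<Sum>i=2..n+1. k n (i - 1) * cov i j)"
    by (rule sum.mono_neutral_cong_right) (auto simp: k0_def)
  also have "\<dots> = (\<Sum>i=1..n. k n i * cov i (j - 1))"
  proof (rule sum.reindex_bij_witness[of _ Suc "\<lambda>i. i - 1"])
    fix i assume "i \<in> {2..n+1}"
    then show "k n (i - 1) * cov (i - 1) (j - 1) = k n (i - 1) * cov i j"
      using cov_Suc[of "i - 1" "j - 1", OF _ _] assms by (cases i; cases j) auto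
  qed auto
  also have "\<dots> = (if j - 1 = n then (\<sigma> n)\<^sup>2 else 0)" by (rule normal_equations) (use assms in auto)
  finally show ?thesis using assms by auto
qed

text \<open>The backward predictor: time reversal carries the normal equations over to the reversed
  coefficients, in rows 1 to n.\<close>

lemma sum_k0_backward:
  assumes "1 \<le> n" "1 \<le> j" "j \<le> n"
  shows "(\<Sum>i=1..n+1. k0 n (n + 1 - i) * cov i j) = (if j = 1 then (\<sigma> n)\<^sup>2 else 0)"
proof -
  have "(\<Sum>i=1..n+1. k0 n (n + 1 - i) * cov i j) = (\<Sum>i=1..n. k n (n + 1 - i) * cov i j)"
    by (rule sum.mono_neutral_cong_right) (auto simp: k0_def)
  also have "\<dots> = (\<Sum>i=1..n. k n i * cov (n + 1 - i) j)"
    by (rule sum.reindex_bij_witness[of _ "\<lambda>i. n + 1 - i" "\<lambda>i. n + 1 - i"]) auto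
  also have "\<dots> = (\<Sum>i=1..n. k n i * cov i (n + 1 - j))"
    by (rule sum.cong) (use assms cov_reflect in auto)
  also have "\<dots> = (if n + 1 - j = n then (\<sigma> n)\<^sup>2 else 0)" by (rule normal_equations) (use assms in auto)
  finally show ?thesis using assms by auto
qed

text \<open>The defect d of the identity vanishes at 1 by the choice of \<beta>_n and at n + 1
  because leading coefficients are 1, and in between it solves the homogeneous normal equations. Its
  quadratic form is therefore 0, and nondegeneracy forces d = 0.\<close>

theorem levinson_durbin:
  assumes n: "1 \<le> n" and i: "1 \<le> i" "i \<le> n + 1"
  shows "k (n + 1) i = k0 n (i - 1) - \<beta> n * k0 n (n + 1 - i)"
proof -
  define d where "d = (\<lambda>i. k (n + 1) i - k0 n (i - 1) + \<beta> n * k0 n (n + 1 - i))"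
  have b: "\<beta> n = - k (n + 1) 1" using n by (simp add: pacf_def)
  have d1: "d 1 = 0" using n b k_diag[of n] by (simp add: d_def k0_def)
  have dn: "d (n + 1) = 0" using n k_diag[of n] k_diag[of "n + 1"] by (simp add: d_def k0_def)
  have "(\<Sum>j=1..n+1. d j * (\<Sum>i=1..n+1. d i * cov i j)) = 0"
  proof (rule sum.neutral, rule ballI)
    fix j assume j: "j \<in> {1..n+1}"
    show "d j * (\<Sum>i=1..n+1. d i * cov i j) = 0"
    proof (cases "j = 1 \<or> j = n + 1")
      case False
      have "(\<Sum>i=1..n+1. d i * cov i j) = (\<Sum>i=1..n+1. k (n + 1) i * cov i j) - (\<Sum>i=1..n+1. k0 n (i - 1) * cov i j)
          + \<beta> n * (\<Sum>i=1..n+1. k0 n (n + 1 - i) * cov i j)"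
        unfolding d_def by (simp only: sum_subtractf[symmetric] sum.distrib[symmetric] sum_distrib_left) (rule sum.cong, auto simp: algebra_simps)
      also have "\<dots> = 0"
        using normal_equations[of j "n + 1"] sum_k0_forward[of n j] sum_k0_backward[of n j] False j n by auto
      finally show ?thesis by simp
    qed (use d1 dn in auto)
  qed
  then have "d i = 0" by (rule cov_nondegenerate) (use i in auto)
  then show ?thesis by (simp add: d_def)
qed

text \<open>The first row of the normal equations gives \<tau> = \<beta>_n \<sigma>_n^2 and the last
  one gives \<sigma>_{n+1}^2 = \<sigma>_n^2 - \<beta>_n \<tau>. Time reversal makes the same \<tau>
  appear in both.\<close>

lemma sigma_recursion: "1 \<le> n \<Longrightarrow> (\<sigma> (n + 1))\<^sup>2 = (\<sigma> n)\<^sup>2 * (1 - (\<beta> n)\<^sup>2)"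
proof -
  assume n: "1 \<le> n"
  have split: "(\<Sum>i=1..n+1. k (n + 1) i * cov i j) = (\<Sum>i=1..n+1. k0 n (i - 1) * cov i j) - \<beta> n * (\<Sum>i=1..n+1. k0 n (n + 1 - i) * cov i j)" for j
  proof -
    have "(\<Sum>i=1..n+1. k (n + 1) i * cov i j) = (\<Sum>i=1..n+1. (k0 n (i - 1) - \<beta> n * k0 n (n + 1 - i)) * cov i j)"
      by (rule sum.cong) (use levinson_durbin[OF n] in auto)
    then show ?thesis by (simp only: left_diff_distrib sum_subtractf sum_distrib_left mult.assoc)
  qed
  define \<tau> where "\<tau> = (\<Sum>i=1..n+1. k0 n (i - 1) * cov i 1)"
  have t2: "(\<Sum>i=1..n+1. k0 n (n + 1 - i) * cov i (n + 1)) = \<tau>"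
    unfolding \<tau>_def
  proof (rule sum.reindex_bij_witness[of _ "\<lambda>i. n + 2 - i" "\<lambda>i. n + 2 - i"])
    fix i assume i: "i \<in> {1..n+1}"
    then have "cov (n + 2 - i) 1 = cov i (n + 1)"
      using cov_reflect[of i "n + 1" 1] by simp
    moreover have "n + 2 - i - 1 = n + 1 - i" by simp
    ultimately show "k0 n (n + 2 - i - 1) * cov (n + 2 - i) 1 = k0 n (n + 1 - i) * cov i (n + 1)" by simp
  qed auto
  have "0 = \<tau> - \<beta> n * (\<sigma> n)\<^sup>2"
    using split[of 1] normal_equations[of 1 "n + 1"] sum_k0_backward[of n 1] n by (simp add: \<tau>_def)
  moreover have "(\<sigma> (n + 1))\<^sup>2 = (\<sigma> n)\<^sup>2 - \<beta> n * \<tau>"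
    using split[of "n + 1"] normal_equations[of "n + 1" "n + 1"] sum_k0_forward[of n "n + 1"] n t2 by simp
  ultimately show ?thesis by (simp add: algebra_simps power2_eq_square)
qed

text \<open>At the mirrored index each step of the recursion contributes the single term \<beta>_n
  k(n,i); the sum starts at n = i, where \<open>k0 i 0 = 0\<close>.\<close>

lemma backward_coefficients:
  assumes "1 \<le> i" "i \<le> n"
  shows "- k0 n (n - i) = (\<Sum>m\<in>{i..<n}. \<beta> m * k m i)"
  using \<open>i \<le> n\<close>
proof (induction n rule: dec_induct)
  case base
  then show ?case by (simp add: k0_def)
next
  case (step n)
  have "k (n + 1) (n + 1 - i) = k0 n (n + 1 - i - 1) - \<beta> n * k0 n (n + 1 - (n + 1 - i))"
    by (rule levinson_durbin) (use assms step in auto)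
  moreover have "n + 1 - i - 1 = n - i" "n + 1 - (n + 1 - i) = i" using step by auto
  ultimately have "k0 (Suc n) (Suc n - i) = k0 n (n - i) - \<beta> n * k n i"
    using assms step by (simp add: k0_def)
  then show ?case using step by simp
qed

lemma forward_coefficients:
  assumes "1 \<le> i" "i \<le> n"
  shows "k (n + 1) (i + 1) = k n i + \<beta> n * (\<Sum>m\<in>{i..<n}. \<beta> m * k m i)"
proof -
  have "k (n + 1) (i + 1) = k0 n i - \<beta> n * k0 n (n - i)"
    using levinson_durbin[of n "i + 1"] assms by simp
  also have "\<dots> = k n i + \<beta> n * (- k0 n (n - i))" using assms by (simp add: k0_def)
  finally show ?thesis unfolding backward_coefficients[OF assms] .
qed

text \<open>The origin of the second half of \<zeta>: filtering the series lagged by one with row n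
  + 1 leaves the filtered series at n and a feedback \<beta>_n times its weighted past. The
  assumption \<open>y 0 = 0\<close> is the start of the model at rest.\<close>

lemma filtered_lag:
  fixes y :: "nat \<Rightarrow> real"
  assumes "y 0 = 0"
  defines "zz \<equiv> \<lambda>n. \<Sum>i=1..n. k n i * y i"
  shows "(\<Sum>i=1..n+1. k (n + 1) i * y (i - 1)) = zz n + \<beta> n * (\<Sum>m<n. \<beta> m * zz m)"
proof -
  have "(\<Sum>i=1..n+1. k (n + 1) i * y (i - 1)) = (\<Sum>i=2..n+1. k (n + 1) i * y (i - 1))"
  proof (rule sum.mono_neutral_right)
    show "\<forall>i\<in>{1..n+1} - {2..n+1}. k (n + 1) i * y (i - 1) = 0"
    proof
      fix i assume "i \<in> {1..n+1} - {2..n+1}"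
      then have "i = 1" by auto
      then show "k (n + 1) i * y (i - 1) = 0" using assms(1) by simp
    qed
  qed auto
  also have "\<dots> = (\<Sum>i=1..n. k (n + 1) (i + 1) * y i)"
    by (rule sum.reindex_bij_witness[of _ Suc "\<lambda>i. i - 1"]) auto
  also have "\<dots> = (\<Sum>i=1..n. k n i * y i + \<beta> n * (\<Sum>m\<in>{i..<n}. \<beta> m * (k m i * y i)))"
    by (rule sum.cong) (auto simp: forward_coefficients[unfolded Suc_eq_plus1[symmetric]] algebra_simps sum_distrib_left)
  also have "\<dots> = zz n + \<beta> n * (\<Sum>i=1..n. \<Sum>m\<in>{i..<n}. \<beta> m * (k m i * y i))"
    by (simp add: zz_def sum.distrib sum_distrib_left)
  also have "(\<Sum>i=1..n. \<Sum>m\<in>{i..<n}. \<beta> m * (k m i * y i)) = (\<Sum>m<n. \<Sum>i=1..m. \<beta> m * (k m i * y i))"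
    unfolding sum.Sigma[OF finite_atLeastAtMost ballI[OF finite_atLeastLessThan]] sum.Sigma[OF finite_lessThan ballI[OF finite_atLeastAtMost]]
    by (rule sum.reindex_bij_witness[of _ prod.swap prod.swap]) auto
  also have "\<dots> = (\<Sum>m<n. \<beta> m * zz m)" by (simp add: zz_def sum_distrib_left)
  finally show ?thesis .
qed

end

section \<open>Companion matrices and the asymptotic information\<close>

text \<open>Powers of a p by p matrix, kept as functions of the indices so that sums, series and
  limits apply entrywise.\<close>

primrec mpow :: "nat \<Rightarrow> (nat \<Rightarrow> nat \<Rightarrow> real) \<Rightarrow> nat \<Rightarrow> nat \<Rightarrow> nat \<Rightarrow> real" where
  "mpow p A 0 a b = (if a = b then 1 else 0)"
| "mpow p A (Suc d) a b = (\<Sum>c<p. A a c * mpow p A d c b)"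

lemma pow_mat_Suc_left:
  assumes A: "A \<in> carrier_mat n n"
  shows "A ^\<^sub>m Suc k = A * A ^\<^sub>m k"
proof (induction k)
  case 0
  then show ?case using A by simp
next
  case (Suc k)
  have Ak: "A ^\<^sub>m k \<in> carrier_mat n n" using A by simp
  have "A ^\<^sub>m Suc (Suc k) = A ^\<^sub>m Suc k * A" by simp
  also have "\<dots> = (A * A ^\<^sub>m k) * A" unfolding Suc.IH ..
  also have "\<dots> = A * (A ^\<^sub>m k * A)" by (rule assoc_mult_mat[OF A Ak A])
  finally show ?case by simp
qed

lemma mult_mat_entry:
  assumes "A \<in> carrier_mat n m" "B \<in> carrier_mat m q" "i < n" "j < q"
  shows "(A * B) $$ (i, j) = (\<Sum>c<m. A $$ (i, c) * B $$ (c, j))"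
  using assms by (simp add: scalar_prod_def lessThan_atLeast0)

lemma mult_mat_vec_entry:
  assumes "A \<in> carrier_mat n m" "v \<in> carrier_vec m" "i < n"
  shows "(A *\<^sub>v v) $ i = (\<Sum>c<m. A $$ (i, c) * v $ c)"
  using assms by (simp add: scalar_prod_def lessThan_atLeast0)

lemma smult_pow_entry:
  fixes A :: "real Matrix.mat" and r :: real
  assumes A: "A \<in> carrier_mat p p" and "a < p" "b < p"
  shows "((complex_of_real r \<cdot>\<^sub>m map_mat complex_of_real A) ^\<^sub>m d) $$ (a, b) = complex_of_real (r ^ d * mpow p (\<lambda>i j. A $$ (i, j)) d a b)"
  using assms(2)
proof (induction d arbitrary: a)
  case 0
  then show ?case using A assms(3) by simp
next
  case (Suc d)
  let ?B = "complex_of_real r \<cdot>\<^sub>m map_mat complex_of_real A"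
  have B: "?B \<in> carrier_mat p p" using A by simp
  have Bd: "?B ^\<^sub>m d \<in> carrier_mat p p" using B by simp
  have "(?B ^\<^sub>m Suc d) $$ (a, b) = (\<Sum>c<p. ?B $$ (a, c) * (?B ^\<^sub>m d) $$ (c, b))"
    unfolding pow_mat_Suc_left[OF B] by (rule mult_mat_entry[OF B Bd Suc.prems assms(3)])
  also have "\<dots> = (\<Sum>c<p. complex_of_real (r * A $$ (a, c)) * complex_of_real (r ^ d * mpow p (\<lambda>i j. A $$ (i, j)) d c b))"
    by (rule sum.cong) (use A Suc in auto)
  also have "\<dots> = complex_of_real (r ^ Suc d * mpow p (\<lambda>i j. A $$ (i, j)) (Suc d) a b)"
    by (simp add: sum_distrib_left mult_ac)
  finally show ?case .
qed

text \<open>An eigenvalue l of B / r yields the eigenvalue r l of B.\<close>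

lemma spectral_radius_scaled:
  fixes B :: "complex Matrix.mat"
  assumes B: "B \<in> carrier_mat p p" and p: "p > 0" and r: "r > 0" "spectral_radius B < r"
  shows "spectral_radius (complex_of_real (1 / r) \<cdot>\<^sub>m B) < 1"
proof -
  let ?B = "complex_of_real (1 / r) \<cdot>\<^sub>m B"
  have B': "?B \<in> carrier_mat p p" using B by simp
  obtain l where l: "l \<in> spectrum ?B" "spectral_radius ?B = norm l"
    using spectral_radius_mem_max(1)[OF B' p] by auto
  then obtain v where v: "v \<in> carrier_vec p" "v \<noteq> 0\<^sub>v p" "?B *\<^sub>v v = l \<cdot>\<^sub>v v"
    using B by (auto simp: spectrum_def eigenvalue_def eigenvector_def)
  have "B *\<^sub>v v = (complex_of_real r * l) \<cdot>\<^sub>v v"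
  proof (rule eq_vecI)
    fix i assume i: "i < dim_vec ((complex_of_real r * l) \<cdot>\<^sub>v v)"
    then have ip: "i < p" using v by simp
    have "(?B *\<^sub>v v) $ i = complex_of_real (1 / r) * (B *\<^sub>v v) $ i"
    proof -
      have "(?B *\<^sub>v v) $ i = (\<Sum>c<p. complex_of_real (1 / r) * (B $$ (i, c) * v $ c))"
        unfolding mult_mat_vec_entry[OF B' v(1) ip] by (rule sum.cong) (use B ip in \<open>auto simp: mult.assoc\<close>)
      then show ?thesis unfolding mult_mat_vec_entry[OF B v(1) ip] sum_distrib_left .
    qed
    then have "complex_of_real (1 / r) * (B *\<^sub>v v) $ i = l * v $ i" using v ip by simp
    then have "complex_of_real r * (complex_of_real (1 / r) * (B *\<^sub>v v) $ i) = complex_of_real r * (l * v $ i)" by simp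
    moreover have "complex_of_real r * complex_of_real (1 / r) = 1" using r by (simp flip: of_real_mult)
    ultimately have "(B *\<^sub>v v) $ i = complex_of_real r * (l * v $ i)" by (metis mult.assoc mult_1)
    then show "(B *\<^sub>v v) $ i = ((complex_of_real r * l) \<cdot>\<^sub>v v) $ i" using ip v by (simp add: mult.assoc)
  qed (use B v in auto)
  then have "complex_of_real r * l \<in> spectrum B"
    using v B by (auto simp: spectrum_def eigenvalue_def eigenvector_def)
  then have "norm (complex_of_real r * l) \<le> spectral_radius B"
    by (intro spectral_radius_mem_max(2)[OF B p]) auto
  then have "r * norm l \<le> spectral_radius B" using r by (simp add: norm_mult)
  then have "r * norm l < r * 1" using r by linarith
  then show ?thesis unfolding l(2) using r(1) by (simp only: mult_less_cancel_left_pos)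
qed

text \<open>For r between the spectral radius and 1 the matrix A / r still has spectral radius below
  1, so its powers are bounded and those of A are O(r^d).\<close>

lemma mpow_geometric:
  fixes A :: "real Matrix.mat"
  assumes A: "A \<in> carrier_mat p p" and p: "p > 0" and sr: "spectral_radius (map_mat complex_of_real A) < 1"
  shows "\<exists>C \<rho>. 0 \<le> C \<and> 0 < \<rho> \<and> \<rho> < 1 \<and> (\<forall>d a b. a < p \<longrightarrow> b < p \<longrightarrow> \<bar>mpow p (\<lambda>i j. A $$ (i, j)) d a b\<bar> \<le> C * \<rho> ^ d)"
proof -
  let ?B = "map_mat complex_of_real A"
  have B: "?B \<in> carrier_mat p p" using A by simp
  obtain r where r: "max 0 (spectral_radius ?B) < r" "r < 1" using dense[of "max 0 (spectral_radius ?B)" 1] sr by auto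
  then have r0: "r > 0" by simp
  have "spectral_radius (complex_of_real (1 / r) \<cdot>\<^sub>m ?B) < 1"
    by (rule spectral_radius_scaled[OF B p]) (use r in auto)
  from spectral_radius_jnf_norm_bound_less_1_upper_triangular[OF _ this, of p] B
  obtain c where c: "\<And>k. norm_bound ((complex_of_real (1 / r) \<cdot>\<^sub>m ?B) ^\<^sub>m k) c" by auto
  have "\<bar>mpow p (\<lambda>i j. A $$ (i, j)) d a b\<bar> \<le> \<bar>c\<bar> * r ^ d" if "a < p" "b < p" for d a b
  proof -
    have "norm (((complex_of_real (1 / r) \<cdot>\<^sub>m ?B) ^\<^sub>m d) $$ (a, b)) \<le> c"
      using c[of d] that A unfolding norm_bound_def by simp
    then have "\<bar>(1 / r) ^ d * mpow p (\<lambda>i j. A $$ (i, j)) d a b\<bar> \<le> c"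
      unfolding smult_pow_entry[OF A that] norm_of_real .
    then have "\<bar>mpow p (\<lambda>i j. A $$ (i, j)) d a b\<bar> \<le> c * r ^ d"
      using r0 by (simp add: abs_mult power_one_over field_simps)
    also have "\<dots> \<le> \<bar>c\<bar> * r ^ d" using r0 by (intro mult_right_mono) auto
    finally show ?thesis .
  qed
  then show ?thesis using r r0 by (intro exI[of _ "\<bar>c\<bar>"] exI[of _ r]) auto
qed

section \<open>Continuity of the matrix inverse\<close>

lemma mat_inv_props:
  fixes A :: "real Matrix.mat"
  assumes A: "A \<in> carrier_mat n n" and d: "Determinant.det A \<noteq> 0"
  shows "mat_inv A \<in> carrier_mat n n" "A * mat_inv A = 1\<^sub>m n" "mat_inv A * A = 1\<^sub>m n"
proof -
  have "mat_inverse A \<noteq> None"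
    using mat_inverse(1)[OF A, of undefined] det_non_zero_imp_unit[OF A d, of undefined] by auto
  then obtain B where "mat_inverse A = Some B" by auto
  with mat_inverse(2)[OF A this]
  show "mat_inv A \<in> carrier_mat n n" "A * mat_inv A = 1\<^sub>m n" "mat_inv A * A = 1\<^sub>m n"
    by (auto simp: mat_inv_def)
qed

lemma invertible_mat_of_det:
  fixes A :: "real Matrix.mat"
  assumes A: "A \<in> carrier_mat n n" and d: "Determinant.det A \<noteq> 0"
  shows "invertible_mat A"
  using mat_inv_props[OF assms] A unfolding invertible_mat_def inverts_mat_def
  by (intro conjI exI[of _ "mat_inv A"]) auto

text \<open>Cramer's rule. It reduces convergence of inverses to that of determinants, which are
  polynomials in the entries.\<close>

lemma mat_inv_adj:
  fixes A :: "real Matrix.mat"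
  assumes A: "A \<in> carrier_mat n n" and d: "Determinant.det A \<noteq> 0" and ij: "i < n" "j < n"
  shows "mat_inv A $$ (i, j) = cofactor A j i / Determinant.det A"
proof -
  note inv = mat_inv_props[OF A d]
  have aA: "adj_mat A \<in> carrier_mat n n" by (rule adj_mat(1)[OF A])
  have "adj_mat A = (mat_inv A * A) * adj_mat A" using inv(3) aA by simp
  also have "\<dots> = mat_inv A * (A * adj_mat A)" by (rule assoc_mult_mat[OF inv(1) A aA])
  also have "\<dots> = mat_inv A * (Determinant.det A \<cdot>\<^sub>m 1\<^sub>m n)" unfolding adj_mat(2)[OF A] ..
  also have "\<dots> = Determinant.det A \<cdot>\<^sub>m mat_inv A"
    using inv(1) by (simp add: mult_smult_distrib[OF inv(1) one_carrier_mat])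
  finally have "adj_mat A $$ (i, j) = Determinant.det A * mat_inv A $$ (i, j)" using inv(1) ij by simp
  then show ?thesis using A ij d by (simp add: adj_mat_def field_simps)
qed

lemma det_tendsto:
  fixes B :: "nat \<Rightarrow> real Matrix.mat"
  assumes B: "\<And>m. B m \<in> carrier_mat n n" and C: "C \<in> carrier_mat n n"
    and lim: "\<And>i j. i < n \<Longrightarrow> j < n \<Longrightarrow> (\<lambda>m. B m $$ (i, j)) \<longlonglongrightarrow> C $$ (i, j)"
  shows "(\<lambda>m. Determinant.det (B m)) \<longlonglongrightarrow> Determinant.det C"
proof -
  have "q i < n" if "q permutes {0..<n}" "i < n" for q i
    using permutes_in_image[OF that(1), of i] that(2) by auto
  then show ?thesis
    unfolding det_def'[OF B] det_def'[OF C]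
    by (intro tendsto_sum tendsto_mult tendsto_const tendsto_prod lim) auto
qed

lemma mat_inv_tendsto:
  fixes B :: "nat \<Rightarrow> real Matrix.mat"
  assumes B: "\<And>m. B m \<in> carrier_mat n n" and C: "C \<in> carrier_mat n n" and d: "Determinant.det C \<noteq> 0"
    and lim: "\<And>i j. i < n \<Longrightarrow> j < n \<Longrightarrow> (\<lambda>m. B m $$ (i, j)) \<longlonglongrightarrow> C $$ (i, j)" and ij: "i < n" "j < n"
  shows "(\<lambda>m. mat_inv (B m) $$ (i, j)) \<longlonglongrightarrow> mat_inv C $$ (i, j)"
proof -
  have dl: "(\<lambda>m. Determinant.det (B m)) \<longlonglongrightarrow> Determinant.det C" by (rule det_tendsto[OF B C lim])
  have "(\<lambda>m. Determinant.det (mat_delete (B m) j i)) \<longlonglongrightarrow> Determinant.det (mat_delete C j i)"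
  proof (rule det_tendsto[of _ "n - 1"])
    fix k l assume kl: "k < n - 1" "l < n - 1"
    have e: "mat_delete D j i $$ (k, l) = D $$ (if k < j then k else Suc k, if l < i then l else Suc l)"
      if "D \<in> carrier_mat n n" for D :: "real Matrix.mat"
      using that kl unfolding mat_delete_def by simp
    show "(\<lambda>m. mat_delete (B m) j i $$ (k, l)) \<longlonglongrightarrow> mat_delete C j i $$ (k, l)"
      unfolding e[OF B] e[OF C] by (rule lim) (use kl in auto)
  qed (rule mat_delete_carrier[OF B], rule mat_delete_carrier[OF C])
  then have "(\<lambda>m. cofactor (B m) j i / Determinant.det (B m)) \<longlonglongrightarrow> cofactor C j i / Determinant.det C"
    unfolding cofactor_def by (intro tendsto_intros dl d)
  moreover have "\<forall>\<^sub>F m in sequentially. cofactor (B m) j i / Determinant.det (B m) = mat_inv (B m) $$ (i, j)"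
    using tendsto_imp_eventually_ne[OF dl d] by eventually_elim (simp add: mat_inv_adj[OF B _ ij])
  ultimately show ?thesis unfolding mat_inv_adj[OF C d ij] by (rule Lim_transform_eventually)
qed

lemma mat_inv_smult:
  fixes B :: "real Matrix.mat"
  assumes B: "B \<in> carrier_mat n n" and d: "Determinant.det B \<noteq> 0" and c: "c \<noteq> 0" and ij: "i < n" "j < n"
  shows "c * mat_inv (c \<cdot>\<^sub>m B) $$ (i, j) = mat_inv B $$ (i, j)"
proof -
  have cB: "c \<cdot>\<^sub>m B \<in> carrier_mat n n" using B by simp
  have dc: "Determinant.det (c \<cdot>\<^sub>m B) \<noteq> 0" using d c B by (simp add: det_smult)
  note inv = mat_inv_props[OF B d] and invc = mat_inv_props[OF cB dc]
  have "c \<cdot>\<^sub>m mat_inv (c \<cdot>\<^sub>m B) = (mat_inv B * B) * (c \<cdot>\<^sub>m mat_inv (c \<cdot>\<^sub>m B))"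
    using inv invc by simp
  also have "\<dots> = mat_inv B * (B * (c \<cdot>\<^sub>m mat_inv (c \<cdot>\<^sub>m B)))"
    by (rule assoc_mult_mat[OF inv(1) B, of _ n]) (use invc in simp)
  also have "B * (c \<cdot>\<^sub>m mat_inv (c \<cdot>\<^sub>m B)) = (c \<cdot>\<^sub>m B) * mat_inv (c \<cdot>\<^sub>m B)"
    using B invc(1) by (simp add: mult_smult_distrib mult_smult_assoc_mat)
  also have "mat_inv B * \<dots> = mat_inv B" using inv(1) invc(2) by simp
  finally have "c \<cdot>\<^sub>m mat_inv (c \<cdot>\<^sub>m B) = mat_inv B" .
  then have "(c \<cdot>\<^sub>m mat_inv (c \<cdot>\<^sub>m B)) $$ (i, j) = mat_inv B $$ (i, j)" by simp
  then show ?thesis using invc(1) ij by simp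
qed

section \<open>The Lyapunov equation and positivity of the information\<close>

locale stable_ar =
  fixes p :: nat and \<theta> :: "real Matrix.vec"
  assumes p_ge: "p \<ge> 1" and stable: "\<theta> \<in> stable_params p"
begin

lemma theta_dim: "\<theta> \<in> carrier_vec p" "dim_vec \<theta> = p"
  using stable by (auto simp: stable_params_def)

abbreviation A :: "nat \<Rightarrow> nat \<Rightarrow> real" where "A \<equiv> \<lambda>i j. companion \<theta> $$ (i, j)"
abbreviation G :: "nat \<Rightarrow> nat \<Rightarrow> nat \<Rightarrow> real" where "G \<equiv> mpow p A"

lemma companion_carrier: "companion \<theta> \<in> carrier_mat p p"
  by (simp add: companion_def theta_dim)

lemma A_first: "j < p \<Longrightarrow> A 0 j = \<theta> $ j"
  and A_sub: "i < p \<Longrightarrow> j < p \<Longrightarrow> 0 < i \<Longrightarrow> A i j = (if i = j + 1 then 1 else 0)"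
  using p_ge by (auto simp: companion_def theta_dim)

lemma A_sum_sub: "0 < i \<Longrightarrow> i < p \<Longrightarrow> (\<Sum>c<p. A i c * f c) = f (i - 1)"
proof -
  assume i: "0 < i" "i < p"
  have "(\<Sum>c<p. A i c * f c) = (\<Sum>c<p. if c = i - 1 then f c else 0)"
    by (rule sum.cong) (use i in \<open>auto simp: A_sub\<close>)
  then show ?thesis using i by simp
qed

lemma G_geometric: "\<exists>C \<rho>. 0 \<le> C \<and> 0 < \<rho> \<and> \<rho> < 1 \<and> (\<forall>d a b. a < p \<longrightarrow> b < p \<longrightarrow> \<bar>G d a b\<bar> \<le> C * \<rho> ^ d)"
  by (rule mpow_geometric[OF companion_carrier]) (use p_ge stable in \<open>auto simp: stable_params_def\<close>)

text \<open>Fixed witnesses of \<open>G_geometric\<close>, so that all later bounds share one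
  constant and one rate.\<close>

definition GC :: real where "GC = (SOME C. \<exists>\<rho>. 0 \<le> C \<and> 0 < \<rho> \<and> \<rho> < 1 \<and> (\<forall>d a b. a < p \<longrightarrow> b < p \<longrightarrow> \<bar>G d a b\<bar> \<le> C * \<rho> ^ d))"
definition Gr :: real where "Gr = (SOME \<rho>. 0 \<le> GC \<and> 0 < \<rho> \<and> \<rho> < 1 \<and> (\<forall>d a b. a < p \<longrightarrow> b < p \<longrightarrow> \<bar>G d a b\<bar> \<le> GC * \<rho> ^ d))"

lemma G_bound: "0 \<le> GC" "0 < Gr" "Gr < 1" "a < p \<Longrightarrow> b < p \<Longrightarrow> \<bar>G d a b\<bar> \<le> GC * Gr ^ d"
proof -
  have "\<exists>\<rho>. 0 \<le> GC \<and> 0 < \<rho> \<and> \<rho> < 1 \<and> (\<forall>d a b. a < p \<longrightarrow> b < p \<longrightarrow> \<bar>G d a b\<bar> \<le> GC * \<rho> ^ d)"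
    unfolding GC_def by (rule someI_ex[OF G_geometric])
  then have "0 \<le> GC \<and> 0 < Gr \<and> Gr < 1 \<and> (\<forall>d a b. a < p \<longrightarrow> b < p \<longrightarrow> \<bar>G d a b\<bar> \<le> GC * Gr ^ d)"
    unfolding Gr_def by (rule someI_ex)
  then show "0 \<le> GC" "0 < Gr" "Gr < 1" "a < p \<Longrightarrow> b < p \<Longrightarrow> \<bar>G d a b\<bar> \<le> GC * Gr ^ d" by auto
qed

lemma G_abs_summable: "a < p \<Longrightarrow> b < p \<Longrightarrow> summable (\<lambda>d. \<bar>G d a b\<bar>)"
  by (rule summable_comparison_test[of _ "\<lambda>d. GC * Gr ^ d"])
    (use G_bound in \<open>auto intro!: summable_mult summable_geometric\<close>)

lemma G_abs_sum: "a < p \<Longrightarrow> b < p \<Longrightarrow> (\<Sum>d<r. \<bar>G d a b\<bar>) \<le> GC / (1 - Gr)"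
proof -
  assume ab: "a < p" "b < p"
  have "(\<Sum>d<r. \<bar>G d a b\<bar>) \<le> (\<Sum>d<r. GC * Gr ^ d)" using G_bound ab by (intro sum_mono) auto
  also have "\<dots> \<le> (\<Sum>d. GC * Gr ^ d)"
    by (rule sum_le_suminf) (use G_bound in \<open>auto intro!: summable_mult summable_geometric\<close>)
  also have "\<dots> = GC / (1 - Gr)" using G_bound by (simp add: suminf_mult summable_geometric suminf_geometric)
  finally show ?thesis .
qed

lemma G_product_summable:
  assumes "a < p" "b < p" "a' < p" "b' < p"
  shows "summable (\<lambda>d. G d a b * G d a' b')"
proof (rule summable_comparison_test)
  have "norm (G d a b * G d a' b') \<le> GC * \<bar>G d a' b'\<bar>" for d
  proof -
    have "Gr ^ d \<le> 1" using G_bound by (intro power_le_one) auto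
    then have "\<bar>G d a b\<bar> \<le> GC" using G_bound(4)[OF assms(1,2), of d] mult_left_mono[of "Gr ^ d" 1 GC] G_bound(1) by simp
    then show ?thesis by (simp add: abs_mult mult_right_mono)
  qed
  then show "\<exists>N. \<forall>d\<ge>N. norm (G d a b * G d a' b') \<le> GC * \<bar>G d a' b'\<bar>" by blast
  show "summable (\<lambda>d. GC * \<bar>G d a' b'\<bar>)" using G_abs_summable assms by (intro summable_mult)
qed

text \<open>Entry (a, b) of the sum over d of x_d times its transpose, where x_d is A^d applied to
  the first unit vector: the series solution of the Lyapunov equation, and the stationary covariance
  of the autoregression driven by unit white noise.\<close>

definition info :: "nat \<Rightarrow> nat \<Rightarrow> real" where
  "info a b = (\<Sum>d. G d a 0 * G d b 0)"

definition info_mat :: "real Matrix.mat" where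
  "info_mat = Matrix.mat p p (\<lambda>(a, b). info a b)"

lemma info_mat_carrier: "info_mat \<in> carrier_mat p p"
  by (simp add: info_mat_def)

lemma info_equation:
  assumes "a < p" "b < p"
  shows "info a b = (\<Sum>c<p. \<Sum>c'<p. A a c * info c c' * A b c') + (if a = 0 \<and> b = 0 then 1 else 0)"
proof -
  have "info a b = G 0 a 0 * G 0 b 0 + (\<Sum>d. G (Suc d) a 0 * G (Suc d) b 0)"
    unfolding info_def using G_product_summable[of a 0 b 0] assms p_ge by (subst suminf_split_head) auto
  also have "(\<lambda>d. G (Suc d) a 0 * G (Suc d) b 0) = (\<lambda>d. \<Sum>c<p. \<Sum>c'<p. A a c * (G d c 0 * G d c' 0) * A b c')"
  proof
    fix d
    have "G (Suc d) a 0 * G (Suc d) b 0 = (\<Sum>c<p. \<Sum>c'<p. (A a c * G d c 0) * (A b c' * G d c' 0))"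
      unfolding mpow.simps by (rule sum_product)
    then show "G (Suc d) a 0 * G (Suc d) b 0 = (\<Sum>c<p. \<Sum>c'<p. A a c * (G d c 0 * G d c' 0) * A b c')"
      by (simp only: mult_ac)
  qed
  also have "(\<Sum>d. \<Sum>c<p. \<Sum>c'<p. A a c * (G d c 0 * G d c' 0) * A b c') = (\<Sum>c<p. \<Sum>c'<p. A a c * info c c' * A b c')"
    unfolding info_def using G_product_summable p_ge
    by (intro sums_unique[symmetric] sums_sum sums_mult sums_mult2 summable_sums) auto
  finally show ?thesis by auto
qed

text \<open>Iterating the homogeneous equation expresses D through A^n on both sides, and A^n tends
  to 0.\<close>

lemma lyapunov_unique:
  assumes D: "\<And>a b. a < p \<Longrightarrow> b < p \<Longrightarrow> D a b = (\<Sum>c<p. \<Sum>c'<p. A a c * D c c' * A b c')" and ab: "a < p" "b < p"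
  shows "D a b = 0"
proof -
  have iter: "D a b = (\<Sum>c<p. \<Sum>c'<p. G n a c * D c c' * G n b c')" if "a < p" "b < p" for n a b
    using that
  proof (induction n arbitrary: a b)
    case 0
    have "(\<Sum>c<p. \<Sum>c'<p. G 0 a c * D c c' * G 0 b c') = (\<Sum>c<p. \<Sum>c'<p. if c' = b then (if c = a then D c c' else 0) else 0)"
      by (intro sum.cong refl) auto
    then show ?case using 0 by simp
  next
    case (Suc n)
    have "D a b = (\<Sum>c<p. \<Sum>c'<p. A a c * (\<Sum>i<p. \<Sum>j<p. G n c i * D i j * G n c' j) * A b c')"
      unfolding D[OF Suc.prems]
    proof (intro sum.cong refl)
      fix c c' assume "c \<in> {..<p}" "c' \<in> {..<p}"
      then have "D c c' = (\<Sum>i<p. \<Sum>j<p. G n c i * D i j * G n c' j)" by (intro Suc.IH) auto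
      then show "A a c * D c c' * A b c' = A a c * (\<Sum>i<p. \<Sum>j<p. G n c i * D i j * G n c' j) * A b c'" by (rule arg_cong[where f = "\<lambda>x. A a c * x * A b c'"])
    qed
    also have "\<dots> = (\<Sum>c<p. \<Sum>c'<p. \<Sum>i<p. \<Sum>j<p. A a c * G n c i * D i j * (A b c' * G n c' j))"
      unfolding sum_distrib_left sum_distrib_right by (intro sum.cong refl) (simp only: mult_ac)
    also have "\<dots> = (\<Sum>i<p. \<Sum>j<p. \<Sum>c<p. \<Sum>c'<p. A a c * G n c i * D i j * (A b c' * G n c' j))"
    proof -
      have "(\<Sum>c<p. \<Sum>c'<p. \<Sum>i<p. \<Sum>j<p. f c c' i j) = (\<Sum>i<p. \<Sum>j<p. \<Sum>c<p. \<Sum>c'<p. f c c' i j)" for f :: "nat \<Rightarrow> nat \<Rightarrow> nat \<Rightarrow> nat \<Rightarrow> real"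
      proof -
        have "(\<Sum>c<p. \<Sum>c'<p. \<Sum>i<p. \<Sum>j<p. f c c' i j) = (\<Sum>c<p. \<Sum>i<p. \<Sum>c'<p. \<Sum>j<p. f c c' i j)"
          by (intro sum.cong refl sum.swap)
        also have "\<dots> = (\<Sum>i<p. \<Sum>c<p. \<Sum>c'<p. \<Sum>j<p. f c c' i j)" by (rule sum.swap)
        also have "\<dots> = (\<Sum>i<p. \<Sum>c<p. \<Sum>j<p. \<Sum>c'<p. f c c' i j)" by (intro sum.cong refl sum.swap)
        also have "\<dots> = (\<Sum>i<p. \<Sum>j<p. \<Sum>c<p. \<Sum>c'<p. f c c' i j)" by (intro sum.cong refl sum.swap)
        finally show ?thesis .
      qed
      then show ?thesis .
    qed
    also have "\<dots> = (\<Sum>i<p. \<Sum>j<p. G (Suc n) a i * D i j * G (Suc n) b j)"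
    proof (intro sum.cong refl)
      fix i j
      have "(\<Sum>c<p. \<Sum>c'<p. A a c * G n c i * D i j * (A b c' * G n c' j)) = (\<Sum>c<p. A a c * G n c i * D i j) * (\<Sum>c'<p. A b c' * G n c' j)"
        by (rule sum_product[symmetric])
      then show "(\<Sum>c<p. \<Sum>c'<p. A a c * G n c i * D i j * (A b c' * G n c' j)) = G (Suc n) a i * D i j * G (Suc n) b j"
        by (simp only: mpow.simps sum_distrib_right)
    qed
    finally show ?case .
  qed
  have G0: "(\<lambda>n. G n a c) \<longlonglongrightarrow> 0" if "a < p" "c < p" for a c
    using summable_LIMSEQ_zero[OF G_abs_summable[OF that]] by (simp add: tendsto_rabs_zero_iff)
  have "(\<lambda>n. \<Sum>c<p. \<Sum>c'<p. G n a c * D c c' * G n b c') \<longlonglongrightarrow> (\<Sum>c<p. \<Sum>c'<p. 0 * D c c' * 0)"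
    by (intro tendsto_sum tendsto_mult tendsto_const G0 ab) auto
  then have "(\<lambda>n. D a b) \<longlonglongrightarrow> 0" unfolding iter[OF ab, symmetric] by simp
  then show ?thesis by (simp add: LIMSEQ_const_iff)
qed

lemma lyapunov_entry:
  assumes J: "J \<in> carrier_mat p p" and ab: "a < p" "b < p"
  shows "(companion \<theta> * J * transpose_mat (companion \<theta>) + Matrix.mat p p (\<lambda>(i, j). if i = 0 \<and> j = 0 then 1 else 0)) $$ (a, b)
    = (\<Sum>c<p. \<Sum>c'<p. A a c * J $$ (c, c') * A b c') + (if a = 0 \<and> b = 0 then 1 else 0)"
proof -
  have "(companion \<theta> * J * transpose_mat (companion \<theta>)) $$ (a, b) = (\<Sum>c'\<in>{0..<p}. (\<Sum>c\<in>{0..<p}. A a c * J $$ (c, c')) * A b c')"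
    using companion_carrier J ab by (simp add: times_mat_def scalar_prod_def)
  also have "\<dots> = (\<Sum>c<p. \<Sum>c'<p. A a c * J $$ (c, c') * A b c')"
    unfolding lessThan_atLeast0[symmetric] by (subst sum.swap) (simp add: sum_distrib_right)
  finally show ?thesis using companion_carrier J ab by simp
qed

lemma asymptotic_info_eq: "asymptotic_info \<theta> = info_mat"
  unfolding asymptotic_info_def theta_dim(2)
proof (rule the_equality)
  show "info_mat \<in> carrier_mat p p \<and> info_mat = companion \<theta> * info_mat * transpose_mat (companion \<theta>) + Matrix.mat p p (\<lambda>(i, j). if i = 0 \<and> j = 0 then 1 else 0)"
  proof
    show "info_mat = companion \<theta> * info_mat * transpose_mat (companion \<theta>) + Matrix.mat p p (\<lambda>(i, j). if i = 0 \<and> j = 0 then 1 else 0)" (is "_ = ?R")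
    proof (rule eq_matI)
      have dims: "dim_row ?R = p" "dim_col ?R = p" by simp_all
      fix a b assume "a < dim_row ?R" "b < dim_col ?R"
      then have ab: "a < p" "b < p" using dims by auto
      show "info_mat $$ (a, b) = ?R $$ (a, b)"
        unfolding lyapunov_entry[OF info_mat_carrier ab] using ab info_equation[OF ab]
        by (simp add: info_mat_def)
    qed (auto simp: info_mat_def)
  qed (rule info_mat_carrier)
next
  fix J assume J: "J \<in> carrier_mat p p \<and> J = companion \<theta> * J * transpose_mat (companion \<theta>) + Matrix.mat p p (\<lambda>(i, j). if i = 0 \<and> j = 0 then 1 else 0)"
  then have Jc: "J \<in> carrier_mat p p" by simp
  have Je: "J $$ (a, b) = (\<Sum>c<p. \<Sum>c'<p. A a c * J $$ (c, c') * A b c') + (if a = 0 \<and> b = 0 then 1 else 0)"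
    if "a < p" "b < p" for a b
    using lyapunov_entry[OF Jc that] J by metis
  show "J = info_mat"
  proof (rule eq_matI)
    fix a b assume "a < dim_row info_mat" "b < dim_col info_mat"
    then have ab: "a < p" "b < p" by (auto simp: info_mat_def)
    have "J $$ (a, b) - info a b = 0"
    proof (rule lyapunov_unique[OF _ ab])
      fix a b assume "a < p" "b < p"
      then show "J $$ (a, b) - info a b = (\<Sum>c<p. \<Sum>c'<p. A a c * (J $$ (c, c') - info c c') * A b c')"
        using Je[of a b] info_equation[of a b] by (simp add: algebra_simps sum_subtractf)
    qed
    then show "J $$ (a, b) = info_mat $$ (a, b)" using ab by (simp add: info_mat_def)
  qed (use Jc in \<open>auto simp: info_mat_def\<close>)
qed

text \<open>The subdiagonal of the companion matrix moves every coordinate down by one place per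
  step.\<close>

lemma G_controllable: "a < p \<Longrightarrow> G d a 0 = (if a \<le> d then G (d - a) 0 0 else 0)"
proof (induction a arbitrary: d)
  case (Suc a)
  show ?case
  proof (cases d)
    case (Suc d')
    have "G d (Suc a) 0 = G d' a 0"
      unfolding Suc mpow.simps using A_sum_sub[of "Suc a" "\<lambda>c. G d' c 0"] Suc.prems by simp
    then show ?thesis using Suc.IH[of d'] Suc.prems Suc by simp
  qed simp
qed simp

text \<open>The filter that produces, from the noise, the component along y of the limiting
  autoregression. Its squared norm is the quadratic form of the information at y.\<close>

definition combo :: "(nat \<Rightarrow> real) \<Rightarrow> nat \<Rightarrow> real" where
  "combo y d = (\<Sum>a<p. y a * G d a 0)"

lemma combo_abs_summable: "summable (\<lambda>d. \<bar>combo y d\<bar>)"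
proof (rule summable_comparison_test)
  show "summable (\<lambda>d. \<Sum>a<p. \<bar>y a\<bar> * \<bar>G d a 0\<bar>)"
    using G_abs_summable p_ge by (intro summable_sum summable_mult) auto
  show "\<exists>N. \<forall>d\<ge>N. norm \<bar>combo y d\<bar> \<le> (\<Sum>a<p. \<bar>y a\<bar> * \<bar>G d a 0\<bar>)"
    unfolding combo_def by (intro exI[of _ 0] allI impI) (use sum_abs[of "\<lambda>a. y a * G _ a 0" "{..<p}"] in \<open>simp add: abs_mult\<close>)
qed

lemma combo_bound: "\<bar>combo y d\<bar> \<le> ((\<Sum>a<p. \<bar>y a\<bar>) * GC) * Gr ^ d"
proof -
  have "\<bar>combo y d\<bar> \<le> (\<Sum>a<p. \<bar>y a\<bar> * \<bar>G d a 0\<bar>)"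
    unfolding combo_def abs_mult[symmetric] by (rule sum_abs)
  also have "\<dots> \<le> (\<Sum>a<p. \<bar>y a\<bar> * (GC * Gr ^ d))"
    using G_bound(4) p_ge by (intro sum_mono mult_left_mono) auto
  finally show ?thesis by (simp add: sum_distrib_right mult.assoc)
qed

lemma combo_square_sums: "(\<lambda>d. (combo y d)\<^sup>2) sums (\<Sum>a<p. \<Sum>b<p. y a * info a b * y b)"
proof -
  have "(\<lambda>d. \<Sum>a<p. \<Sum>b<p. y a * (G d a 0 * G d b 0) * y b) sums (\<Sum>a<p. \<Sum>b<p. y a * info a b * y b)"
    unfolding info_def using G_product_summable p_ge
    by (intro sums_sum sums_mult sums_mult2 summable_sums) auto
  moreover have "(\<lambda>d. \<Sum>a<p. \<Sum>b<p. y a * (G d a 0 * G d b 0) * y b) = (\<lambda>d. (combo y d)\<^sup>2)"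
    by (rule ext) (simp add: combo_def power2_eq_square sum_product mult_ac)
  ultimately show ?thesis by simp
qed

text \<open>Controllability: at d = a the coordinates beyond a are still 0, those below a drop out
  by induction, and \<open>G a a 0 = G 0 0 0 = 1\<close> isolates \<open>y a\<close>.\<close>

lemma combo_eq_0:
  assumes "\<And>d. combo y d = 0" "a < p"
  shows "y a = 0"
  using assms(2)
proof (induction a rule: less_induct)
  case (less a)
  have "combo y a = (\<Sum>b<p. if b = a then y a else 0)"
    unfolding combo_def
  proof (rule sum.cong)
    fix b assume "b \<in> {..<p}"
    then show "y b * G a b 0 = (if b = a then y a else 0)"
      using less.IH[of b] G_controllable[of b a] by (cases "b < a") auto
  qed simp
  then show ?case using assms(1) less.prems by simp
qed

lemma info_positive:
  assumes "\<not> (\<forall>a<p. y a = 0)"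
  shows "(\<Sum>a<p. \<Sum>b<p. y a * info a b * y b) > 0"
proof -
  obtain d where d: "combo y d \<noteq> 0" using combo_eq_0 assms by blast
  have "(\<Sum>d. (combo y d)\<^sup>2) > 0"
    using combo_square_sums[of y] d by (intro suminf_pos2[where i = d]) (auto simp: sums_iff)
  then show ?thesis using combo_square_sums[of y] by (simp add: sums_iff)
qed

lemma det_info: "Determinant.det info_mat \<noteq> 0"
proof
  assume "Determinant.det info_mat = 0"
  then obtain v where v: "v \<in> carrier_vec p" "v \<noteq> 0\<^sub>v p" "info_mat *\<^sub>v v = 0\<^sub>v p"
    using det_0_iff_vec_prod_zero[OF info_mat_carrier] by auto
  have z: "(\<Sum>b<p. info a b * v $ b) = 0" if "a < p" for a
  proof -
    have "(info_mat *\<^sub>v v) $ a = (\<Sum>b<p. info a b * v $ b)"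
      unfolding mult_mat_vec_entry[OF info_mat_carrier v(1) that] using that by (simp add: info_mat_def)
    then show ?thesis using v that by simp
  qed
  have "(\<Sum>a<p. \<Sum>b<p. v $ a * info a b * v $ b) = (\<Sum>a<p. v $ a * (\<Sum>b<p. info a b * v $ b))"
    by (simp add: sum_distrib_left mult.assoc)
  also have "\<dots> = 0" using z by simp
  finally have "\<forall>a<p. v $ a = 0" using info_positive[of "\<lambda>a. v $ a"] by fastforce
  then have "v = 0\<^sub>v p" using v by (intro eq_vecI) auto
  then show False using v by simp
qed

end

section \<open>The score\<close>

text \<open>Polarisation of the quadratic limit in \<open>ergodic_path_rms\<close>, which is stable
  under negligible perturbations.\<close>

lemma ergodic_path_cross:
  assumes e: "ergodic_path e" and c: "summable (\<lambda>d. \<bar>c d\<bar>)" "summable (\<lambda>d. \<bar>c' d\<bar>)"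
    and x: "negligible_seq (\<lambda>i. x i - lin_proc c e i)" and x': "negligible_seq (\<lambda>i. x' i - lin_proc c' e i)"
  shows "(\<lambda>n. (\<Sum>i<n. x i * x' i) / real n) \<longlonglongrightarrow> (\<Sum>d. c d * c' d)"
proof -
  have sq: "(\<lambda>n. (\<Sum>i<n. (y i)\<^sup>2) / real n) \<longlonglongrightarrow> (\<Sum>d. (b d)\<^sup>2)"
    if "summable (\<lambda>d. \<bar>b d\<bar>)" "negligible_seq (\<lambda>i. y i - lin_proc b e i)" for y b
  proof -
    have "rms y \<longlonglongrightarrow> sqrt (\<Sum>d. (b d)\<^sup>2)"
      by (rule rms_limit_of_negligible[OF that(2) ergodic_path_rms[OF e that(1)]])
    then have "(\<lambda>n. (rms y n)\<^sup>2) \<longlonglongrightarrow> (sqrt (\<Sum>d. (b d)\<^sup>2))\<^sup>2" by (rule tendsto_power)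
    then show ?thesis
      using suminf_nonneg[OF summable_square_of_abs[OF that(1)]] by (simp add: rms_square)
  qed
  have sp: "summable (\<lambda>d. \<bar>c d + c' d\<bar>)" "summable (\<lambda>d. \<bar>c d - c' d\<bar>)"
    by (rule summable_comparison_test[OF _ summable_add[OF c]], intro exI[of _ 0] allI impI, simp)+
  have "(\<lambda>n. (\<Sum>i<n. (x i + x' i)\<^sup>2) / real n) \<longlonglongrightarrow> (\<Sum>d. (c d + c' d)\<^sup>2)"
    by (rule sq[OF sp(1)]) (use negligible_seq_add[OF x x'] in \<open>simp add: lin_proc_add algebra_simps\<close>)
  moreover have "(\<lambda>n. (\<Sum>i<n. (x i - x' i)\<^sup>2) / real n) \<longlonglongrightarrow> (\<Sum>d. (c d - c' d)\<^sup>2)"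
    by (rule sq[OF sp(2)]) (use negligible_seq_add[OF x negligible_seq_scale[OF x', of "-1"]] in \<open>simp add: lin_proc_diff algebra_simps\<close>)
  ultimately have "(\<lambda>n. ((\<Sum>i<n. (x i + x' i)\<^sup>2) / real n - (\<Sum>i<n. (x i - x' i)\<^sup>2) / real n) / 4)
      \<longlonglongrightarrow> ((\<Sum>d. (c d + c' d)\<^sup>2) - (\<Sum>d. (c d - c' d)\<^sup>2)) / 4"
    by (intro tendsto_intros) auto
  moreover have "((\<Sum>i<n. (x i + x' i)\<^sup>2) / real n - (\<Sum>i<n. (x i - x' i)\<^sup>2) / real n) / 4 = (\<Sum>i<n. x i * x' i) / real n" for n
  proof -
    have "(\<Sum>i<n. (x i + x' i)\<^sup>2) - (\<Sum>i<n. (x i - x' i)\<^sup>2) = 4 * (\<Sum>i<n. x i * x' i)"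
      unfolding sum_subtractf[symmetric] sum_distrib_left
      by (rule sum.cong) (auto simp: power2_eq_square algebra_simps)
    then show ?thesis by (simp add: diff_divide_distrib[symmetric])
  qed
  moreover have "((\<Sum>d. (c d + c' d)\<^sup>2) - (\<Sum>d. (c d - c' d)\<^sup>2)) / 4 = (\<Sum>d. c d * c' d)"
  proof -
    have "(\<Sum>d. (c d + c' d)\<^sup>2) - (\<Sum>d. (c d - c' d)\<^sup>2) = (\<Sum>d. (c d + c' d)\<^sup>2 - (c d - c' d)\<^sup>2)"
      by (rule suminf_diff[OF summable_square_of_abs[OF sp(1)] summable_square_of_abs[OF sp(2)]])
    then have "((\<Sum>d. (c d + c' d)\<^sup>2) - (\<Sum>d. (c d - c' d)\<^sup>2)) / 4 = (\<Sum>d. ((c d + c' d)\<^sup>2 - (c d - c' d)\<^sup>2) / 4)"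
      using suminf_divide[OF summable_diff[OF summable_square_of_abs[OF sp(1)] summable_square_of_abs[OF sp(2)]], of 4] by simp
    also have "(\<lambda>d. ((c d + c' d)\<^sup>2 - (c d - c' d)\<^sup>2) / 4) = (\<lambda>d. c d * c' d)"
      by (rule ext) (simp add: power2_eq_square algebra_simps)
    finally show ?thesis .
  qed
  ultimately show ?thesis by simp
qed

text \<open>The pair consists of \<open>Z\<^sub>n\<close> and \<open>\<Sum>\<^sub>m \<beta>\<^sub>m Z\<^sub>m\<close>, the two halves of \<open>\<zeta>\<^sub>n\<close>, as functions of the innovations.\<close>

primrec ar_state :: "nat \<Rightarrow> (nat \<Rightarrow> nat \<Rightarrow> real) \<Rightarrow> (nat \<Rightarrow> real) \<Rightarrow> (nat \<Rightarrow> real) \<Rightarrow> (nat \<Rightarrow> real) \<Rightarrow> nat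
    \<Rightarrow> (nat \<Rightarrow> real) \<times> (nat \<Rightarrow> real)" where
  "ar_state p A \<beta> sd e 0 = (\<lambda>a. 0, \<lambda>a. 0)"
| "ar_state p A \<beta> sd e (Suc n) =
    (\<lambda>a. (\<Sum>b<p. A a b * (fst (ar_state p A \<beta> sd e n) b + \<beta> n * snd (ar_state p A \<beta> sd e n) b)) + (if a = 0 then sd n * e n else 0),
     \<lambda>a. snd (ar_state p A \<beta> sd e n) a + \<beta> n * fst (ar_state p A \<beta> sd e n) a)"

lemma ar_state_sum: "snd (ar_state p A \<beta> sd e n) a = (\<Sum>m<n. \<beta> m * fst (ar_state p A \<beta> sd e m) a)"
  by (induction n) auto

lemma limsup_eqI:
  fixes r :: "nat \<Rightarrow> real"
  assumes up: "\<And>\<delta>. \<delta> > 0 \<Longrightarrow> \<forall>\<^sub>F n in sequentially. r n \<le> s + \<delta>"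
    and lo: "\<And>\<delta>. \<delta> > 0 \<Longrightarrow> \<exists>\<^sub>F n in sequentially. s - \<delta> \<le> r n"
  shows "limsup (\<lambda>n. ereal (r n)) = ereal s"
proof (rule antisym)
  have *: "limsup (\<lambda>n. ereal (r n)) \<le> ereal (s + \<delta>)" if "\<delta> > 0" for \<delta>
    by (rule Limsup_bounded) (use up[OF that] in simp)
  show "limsup (\<lambda>n. ereal (r n)) \<le> ereal s"
    by (rule ereal_le_epsilon2) (use * in auto)
  have **: "ereal s \<le> limsup (\<lambda>n. ereal (r n)) + ereal \<delta>" if "\<delta> > 0" for \<delta>
  proof -
    have "ereal (s - \<delta>) \<le> limsup (\<lambda>n. ereal (r n))"
    proof (rule ccontr)
      assume "\<not> ereal (s - \<delta>) \<le> limsup (\<lambda>n. ereal (r n))"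
      then have "\<forall>\<^sub>F n in sequentially. ereal (r n) < ereal (s - \<delta>)" by (intro Limsup_lessD) auto
      then have "\<forall>\<^sub>F n in sequentially. \<not> s - \<delta> \<le> r n" by (rule eventually_mono) auto
      then show False using lo[OF that] by (simp add: frequently_def)
    qed
    then have "ereal (s - \<delta>) + ereal \<delta> \<le> limsup (\<lambda>n. ereal (r n)) + ereal \<delta>" by (rule add_right_mono)
    then show ?thesis by simp
  qed
  show "ereal s \<le> limsup (\<lambda>n. ereal (r n))"
    by (rule ereal_le_epsilon2[OF **])
qed

locale ar_mle = gaussian_innovations M \<xi> \<sigma> \<epsilon> k + stable_ar p \<theta>
  for M :: "'a measure" and \<xi> \<sigma> \<epsilon> k p \<theta> +
  fixes X :: "int \<Rightarrow> 'a \<Rightarrow> real" and \<alpha>\<^sub>2 :: real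
  assumes model: "ar_model M \<xi> \<theta> X"
    and alpha2: "\<alpha>\<^sub>2 > 1"
    and pacf_decay: "(\<lambda>n. (pacf k n)\<^sup>2) \<in> O(\<lambda>n. real n powr (- \<alpha>\<^sub>2))"
begin

lemma beta_summable: "summable (\<lambda>n. (\<beta> n)\<^sup>2)"
  and n_beta_tendsto: "(\<lambda>n. real n * (\<beta> n)\<^sup>2) \<longlonglongrightarrow> 0"
proof -
  obtain c where c: "c > 0" "\<forall>\<^sub>F n in sequentially. norm ((\<beta> n)\<^sup>2) \<le> c * norm (real n powr (- \<alpha>\<^sub>2))"
    using landau_o.bigE[OF pacf_decay] by blast
  show "summable (\<lambda>n. (\<beta> n)\<^sup>2)"
  proof (rule summable_comparison_test_ev)
    show "summable (\<lambda>n. c * real n powr (- \<alpha>\<^sub>2))"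
      using alpha2 by (intro summable_mult) (simp add: summable_real_powr_iff)
    show "\<forall>\<^sub>F n in sequentially. norm ((\<beta> n)\<^sup>2) \<le> c * real n powr (- \<alpha>\<^sub>2)" using c(2) by simp
  qed
  show "(\<lambda>n. real n * (\<beta> n)\<^sup>2) \<longlonglongrightarrow> 0"
  proof (rule Lim_null_comparison)
    show "(\<lambda>n. c * (real n * real n powr (- \<alpha>\<^sub>2))) \<longlonglongrightarrow> 0"
      using alpha2 by (intro tendsto_mult_right_zero) real_asymp
    show "\<forall>\<^sub>F n in sequentially. norm (real n * (\<beta> n)\<^sup>2) \<le> c * (real n * real n powr (- \<alpha>\<^sub>2))"
      using c(2)
    proof eventually_elim
      case (elim n)
      then have "real n * (\<beta> n)\<^sup>2 \<le> real n * (c * real n powr (- \<alpha>\<^sub>2))" by (intro mult_left_mono) auto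
      then show ?case by (simp add: mult_ac)
    qed
  qed
qed

abbreviation sd :: "nat \<Rightarrow> real" where "sd n \<equiv> \<sigma> (Suc n)"

lemma sd_pos': "sd n > 0"
  by (rule sigma_pos) simp

lemma sd_square_Suc: "(sd (Suc n))\<^sup>2 = (sd n)\<^sup>2 * (1 - (\<beta> (Suc n))\<^sup>2)"
  using sigma_recursion[of "Suc n"] by simp

lemma beta_less_1: "(\<beta> (Suc n))\<^sup>2 < 1"
proof -
  have "(sd n)\<^sup>2 * (1 - (\<beta> (Suc n))\<^sup>2) > 0" unfolding sd_square_Suc[symmetric] using sd_pos'[of "Suc n"] by simp
  then show ?thesis using sd_pos'[of n] by (simp add: zero_less_mult_iff)
qed

text \<open>The squares of \<open>sd\<close> are partial products of 1 - \<beta>^2. They decrease,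
  and from an m with tail sum of \<beta>^2 below 1/2 on, the inequality prod (1 - x) \<ge> 1 - sum x
  keeps them above half of their value at m.\<close>

lemma sd_convergent: "\<exists>L>0. sd \<longlonglongrightarrow> L"
proof -
  obtain m where m: "(\<Sum>i. (\<beta> (i + m))\<^sup>2) < 1 / 2"
  proof -
    have "(\<lambda>m. \<Sum>i. (\<beta> (i + m))\<^sup>2) \<longlonglongrightarrow> 0" by (rule suminf_exist_split2[OF beta_summable])
    then have "\<forall>\<^sub>F m in sequentially. (\<Sum>i. (\<beta> (i + m))\<^sup>2) < 1 / 2" by (rule order_tendstoD) simp
    then show ?thesis using that by (auto simp: eventually_sequentially)
  qed
  have lower: "(sd m)\<^sup>2 * (1 - (\<Sum>i<j. (\<beta> (m + Suc i))\<^sup>2)) \<le> (sd (m + j))\<^sup>2" for j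
  proof (induction j)
    case (Suc j)
    let ?S = "\<Sum>i<j. (\<beta> (m + Suc i))\<^sup>2" and ?b = "(\<beta> (m + Suc j))\<^sup>2"
    have b: "0 \<le> ?b" "?b \<le> 1" using beta_less_1[of "m + j"] by auto
    have "1 - (?S + ?b) \<le> (1 - ?S) * (1 - ?b)"
      using mult_nonneg_nonneg[of ?S ?b] b by (simp add: algebra_simps sum_nonneg)
    then have "(sd m)\<^sup>2 * (1 - (?S + ?b)) \<le> (sd m)\<^sup>2 * ((1 - ?S) * (1 - ?b))" by (rule mult_left_mono) simp
    also have "\<dots> = ((sd m)\<^sup>2 * (1 - ?S)) * (1 - ?b)" by simp
    also have "\<dots> \<le> (sd (m + j))\<^sup>2 * (1 - ?b)" using Suc b by (intro mult_right_mono) auto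
    also have "\<dots> = (sd (m + Suc j))\<^sup>2" using sd_square_Suc[of "m + j"] by simp
    finally show ?case by simp
  qed simp
  have dec: "decseq (\<lambda>n. (sd n)\<^sup>2)"
  proof (rule decseq_SucI)
    fix n show "(sd (Suc n))\<^sup>2 \<le> (sd n)\<^sup>2"
      unfolding sd_square_Suc using mult_left_mono[of "1 - (\<beta> (Suc n))\<^sup>2" 1 "(sd n)\<^sup>2"] by simp
  qed
  have half: "(sd m)\<^sup>2 / 2 \<le> (sd n)\<^sup>2" for n
  proof -
    have "(\<Sum>i<n. (\<beta> (m + Suc i))\<^sup>2) \<le> (\<Sum>i<Suc n. (\<beta> (i + m))\<^sup>2)"
      unfolding sum.lessThan_Suc_shift by (simp add: add.commute)
    also have "\<dots> \<le> (\<Sum>i. (\<beta> (i + m))\<^sup>2)"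
      by (rule sum_le_suminf) (use summable_ignore_initial_segment[OF beta_summable] in auto)
    finally have "1 / 2 \<le> 1 - (\<Sum>i<n. (\<beta> (m + Suc i))\<^sup>2)" using m by linarith
    then have "(sd m)\<^sup>2 * (1 / 2) \<le> (sd m)\<^sup>2 * (1 - (\<Sum>i<n. (\<beta> (m + Suc i))\<^sup>2))" by (rule mult_left_mono) simp
    also have "\<dots> \<le> (sd (m + n))\<^sup>2" by (rule lower)
    also have "\<dots> \<le> (sd n)\<^sup>2" using decseqD[OF dec, of n "m + n"] by simp
    finally show ?thesis by simp
  qed
  obtain L where L: "(\<lambda>n. (sd n)\<^sup>2) \<longlonglongrightarrow> L"
  proof (rule decseq_convergent[OF dec])
    show "\<forall>n. (sd m)\<^sup>2 / 2 \<le> (sd n)\<^sup>2" using half by (rule allI)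
  qed
  have "(sd m)\<^sup>2 / 2 \<le> L" by (rule LIMSEQ_le_const[OF L]) (use half in auto)
  then have "L > 0" using sd_pos'[of m] zero_less_power[of "sd m" 2] by linarith
  moreover have "sd \<longlonglongrightarrow> sqrt L" using tendsto_real_sqrt[OF L] sd_pos' by (simp add: less_imp_le)
  ultimately show ?thesis by (intro exI[of _ "sqrt L"]) simp
qed

section \<open>The score as a martingale\<close>

definition path :: "'a \<Rightarrow> nat \<Rightarrow> real" where "path \<omega> i = \<epsilon> (Suc i) \<omega>"

definition zc :: "(nat \<Rightarrow> real) \<Rightarrow> nat \<Rightarrow> nat \<Rightarrow> real" where "zc e n = fst (ar_state p A \<beta> sd e n)"
definition Sc :: "(nat \<Rightarrow> real) \<Rightarrow> nat \<Rightarrow> nat \<Rightarrow> real" where "Sc e n = snd (ar_state p A \<beta> sd e n)"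
definition wc :: "(nat \<Rightarrow> real) \<Rightarrow> nat \<Rightarrow> nat \<Rightarrow> real" where "wc e n a = zc e n a + \<beta> n * Sc e n a"

text \<open>\<open>ar_state\<close> computes the regressor at time n from the first n innovations,
  which makes the integrand of the score predictable.\<close>

lemma zc_measurable: "(\<lambda>\<omega>. zc (path \<omega>) n a) \<in> borel_measurable (past n)"
  and Sc_measurable: "(\<lambda>\<omega>. Sc (path \<omega>) n a) \<in> borel_measurable (past n)"
proof (induction n arbitrary: a)
  case 0
  { case 1 show ?case by (simp add: zc_def) }
  { case 2 show ?case by (simp add: Sc_def) }
next
  case (Suc n)
  have z: "(\<lambda>\<omega>. zc (path \<omega>) n b) \<in> borel_measurable (past (Suc n))"
    and S: "(\<lambda>\<omega>. Sc (path \<omega>) n b) \<in> borel_measurable (past (Suc n))" for b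
    by (auto intro: past_mono[OF Suc.IH(1)] past_mono[OF Suc.IH(2)])
  have e: "(\<lambda>\<omega>. path \<omega> n) \<in> borel_measurable (past (Suc n))"
    unfolding path_def by (rule noise_past_measurable) simp
  have if_e: "(\<lambda>\<omega>. if a = 0 then sd n * path \<omega> n else 0) \<in> borel_measurable (past (Suc n))" for a
    using e by (cases "a = 0") auto
  { case 1
    have "(\<lambda>\<omega>. zc (path \<omega>) (Suc n) a) = (\<lambda>\<omega>. (\<Sum>b<p. A a b * (zc (path \<omega>) n b + \<beta> n * Sc (path \<omega>) n b)) + (if a = 0 then sd n * path \<omega> n else 0))"
      by (simp add: zc_def Sc_def)
    then show ?case
      by (simp only:) (intro borel_measurable_add borel_measurable_sum borel_measurable_times borel_measurable_const z S if_e) }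
  { case 2
    have "(\<lambda>\<omega>. Sc (path \<omega>) (Suc n) a) = (\<lambda>\<omega>. Sc (path \<omega>) n a + \<beta> n * zc (path \<omega>) n a)"
      by (simp add: zc_def Sc_def)
    then show ?case
      by (simp only:) (intro borel_measurable_add borel_measurable_times borel_measurable_const z S) }
qed

lemma wc_measurable: "(\<lambda>\<omega>. wc (path \<omega>) n a) \<in> borel_measurable (past n)"
  unfolding wc_def using zc_measurable Sc_measurable by simp

lemma wc_approx:
  assumes e: "ergodic_path e" and a: "a < p"
  shows "negligible_seq (\<lambda>i. wc e i a / sd i - lin_proc (\<lambda>d. G d a 0) e i)"
proof -
  obtain L where L: "L > 0" "sd \<longlonglongrightarrow> L" using sd_convergent by blast
  interpret perturbed_ar p A G \<beta> sd L e "zc e" "Sc e" "wc e" "GC / (1 - Gr)"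
  proof
    show "zc e 0 a = 0" for a by (simp add: zc_def)
    show "zc e (Suc n) a = (\<Sum>b<p. A a b * wc e n b) + (if a = 0 then sd n * e n else 0)" for n a
      by (simp add: zc_def Sc_def wc_def)
    show "Sc e n a = (\<Sum>m<n. \<beta> m * zc e m a)" for n a
      unfolding Sc_def zc_def by (rule ar_state_sum)
    show "(\<Sum>d<r. \<bar>G d a b\<bar>) \<le> GC / (1 - Gr)" if "a < p" "b < p" for a b r by (rule G_abs_sum[OF that])
  qed (use L sd_pos' p_ge beta_summable in \<open>auto simp: wc_def\<close>)
  show ?thesis by (rule normalized_regressor_approx[OF e n_beta_tendsto a])
qed

definition score_coeff :: "(nat \<Rightarrow> real) \<Rightarrow> (nat \<Rightarrow> real) \<Rightarrow> nat \<Rightarrow> real" where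
  "score_coeff y e i = (\<Sum>a<p. y a * (wc e i a / sd i))"

definition score :: "(nat \<Rightarrow> real) \<Rightarrow> (nat \<Rightarrow> real) \<Rightarrow> nat \<Rightarrow> real" where
  "score y e n = (\<Sum>i<n. score_coeff y e i * e i)"

definition info_form :: "(nat \<Rightarrow> real) \<Rightarrow> real" where
  "info_form y = (\<Sum>a<p. \<Sum>b<p. y a * info a b * y b)"

lemma score_coeff_measurable: "(\<lambda>\<omega>. score_coeff y (path \<omega>) i) \<in> borel_measurable (past i)"
  unfolding score_coeff_def using wc_measurable by (intro borel_measurable_sum borel_measurable_times borel_measurable_divide) auto

lemma score_coeff_approx:
  assumes "ergodic_path e"
  shows "negligible_seq (\<lambda>i. score_coeff y e i - lin_proc (combo y) e i)"
proof -
  have "negligible_seq (\<lambda>i. \<Sum>a<p. y a * (wc e i a / sd i - lin_proc (\<lambda>d. G d a 0) e i))"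
    using wc_approx[OF assms] by (intro negligible_seq_sum negligible_seq_scale) auto
  moreover have "lin_proc (combo y) e i = (\<Sum>a<p. y a * lin_proc (\<lambda>d. G d a 0) e i)" for i
    using lin_proc_sum[of "\<lambda>a d. y a * G d a 0" "{..<p}" e i] by (simp add: combo_def[abs_def] lin_proc_scale)
  ultimately show ?thesis by (simp add: score_coeff_def sum_subtractf right_diff_distrib)
qed

lemma info_form_eq: "info_form y = (\<Sum>d. (combo y d)\<^sup>2)" "info_form y \<ge> 0"
proof -
  show e: "info_form y = (\<Sum>d. (combo y d)\<^sup>2)"
    using combo_square_sums[of y] by (simp add: info_form_def sums_iff)
  show "info_form y \<ge> 0" unfolding e
    by (rule suminf_nonneg) (use combo_square_sums[of y] in \<open>auto simp: sums_iff\<close>)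
qed

lemma AE_path: "AE \<omega> in M. ergodic_path (path \<omega>)"
  using AE_ergodic_path by (simp add: path_def[abs_def])

text \<open>The compensator of the score is the sum of its squared integrands, and its average tends
  to \<open>info_form y\<close> because the integrand is a negligible perturbation of the filter
  \<open>combo y\<close>.\<close>

lemma score_upper:
  "AE \<omega> in M. \<forall>\<delta>>0. \<forall>\<^sub>F n in sequentially. \<bar>score y (path \<omega>) n\<bar> \<le> (sqrt (info_form y) + \<delta>) * lil_scale n"
  unfolding score_def path_def
proof (rule upper_lil)
  show "(\<lambda>\<omega>. score_coeff y (\<lambda>i. \<epsilon> (Suc i) \<omega>) i) \<in> borel_measurable (past i)" for i
    using score_coeff_measurable[of y i] by (simp add: path_def[abs_def])
  show "AE \<omega> in M. \<forall>\<delta>>0. \<forall>\<^sub>F n in sequentially. (\<Sum>i<n. (score_coeff y (\<lambda>i. \<epsilon> (Suc i) \<omega>) i)\<^sup>2) \<le> ((sqrt (info_form y))\<^sup>2 + \<delta>) * real n"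
    using AE_path
  proof eventually_elim
    case (elim \<omega>)
    have lim: "(\<lambda>n. (\<Sum>i<n. score_coeff y (path \<omega>) i * score_coeff y (path \<omega>) i) / real n) \<longlonglongrightarrow> (\<Sum>d. combo y d * combo y d)"
      by (rule ergodic_path_cross[OF elim combo_abs_summable combo_abs_summable]) (rule score_coeff_approx[OF elim])+
    show ?case
    proof (intro allI impI)
      fix \<delta> :: real assume "\<delta> > 0"
      then have "(\<Sum>d. combo y d * combo y d) < info_form y + \<delta>" by (simp add: info_form_eq(1) power2_eq_square)
      from order_tendstoD(2)[OF lim this] eventually_gt_at_top[of 0]
      show "\<forall>\<^sub>F n in sequentially. (\<Sum>i<n. (score_coeff y (\<lambda>i. \<epsilon> (Suc i) \<omega>) i)\<^sup>2) \<le> ((sqrt (info_form y))\<^sup>2 + \<delta>) * real n"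
      proof eventually_elim
        case (elim n)
        then show ?case using info_form_eq(2)[of y] by (simp add: path_def[abs_def] power2_eq_square divide_less_eq)
      qed
    qed
  qed
qed (use info_form_eq in simp)

text \<open>The filter decays geometrically, so the variance missing from row r is O(q^r) and adds
  up to a bounded amount. This is the short memory condition D of \<open>lower_lil\<close>: the
  variance a block of any length loses at its boundary.\<close>

lemma combo_tail: "\<exists>D. \<forall>L. real L * info_form y - (\<Sum>r<L. \<Sum>d<r. (combo y d)\<^sup>2) \<le> D"
proof -
  define B where "B = ((\<Sum>a<p. \<bar>y a\<bar>) * GC)\<^sup>2"
  define q where "q = Gr\<^sup>2"
  have q: "0 \<le> q" "q < 1" using G_bound(2,3) by (auto simp: q_def power_less_one_iff abs_square_less_1)
  have B0: "B \<ge> 0" by (simp add: B_def)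
  have sm: "summable (\<lambda>d. (combo y d)\<^sup>2)" using combo_square_sums[of y] by (simp add: sums_iff)
  have le: "(combo y d)\<^sup>2 \<le> B * q ^ d" for d
  proof -
    have "\<bar>combo y d\<bar>\<^sup>2 \<le> (((\<Sum>a<p. \<bar>y a\<bar>) * GC) * Gr ^ d)\<^sup>2" by (rule power_mono[OF combo_bound]) simp
    then show ?thesis by (simp add: B_def q_def power_mult_distrib power_mult[symmetric] mult.commute)
  qed
  have tail: "info_form y - (\<Sum>d<r. (combo y d)\<^sup>2) \<le> B / (1 - q) * q ^ r" for r
  proof -
    have "info_form y = (\<Sum>d. (combo y (d + r))\<^sup>2) + (\<Sum>d<r. (combo y d)\<^sup>2)"
      unfolding info_form_eq(1) by (rule suminf_split_initial_segment[OF sm])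
    moreover have "(\<Sum>d. (combo y (d + r))\<^sup>2) \<le> (\<Sum>d. B * q ^ r * q ^ d)"
    proof (rule suminf_le)
      show "(combo y (d + r))\<^sup>2 \<le> B * q ^ r * q ^ d" for d using le[of "d + r"] by (simp add: power_add mult_ac)
      show "summable (\<lambda>d. (combo y (d + r))\<^sup>2)" using summable_ignore_initial_segment[OF sm] .
      show "summable (\<lambda>d. B * q ^ r * q ^ d)" using q by (intro summable_mult summable_geometric) auto
    qed
    moreover have "(\<Sum>d. B * q ^ r * q ^ d) = B / (1 - q) * q ^ r"
      using q by (simp add: suminf_mult summable_geometric suminf_geometric)
    ultimately show ?thesis by simp
  qed
  have "real L * info_form y - (\<Sum>r<L. \<Sum>d<r. (combo y d)\<^sup>2) \<le> B / (1 - q) * (1 / (1 - q))" for L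
  proof -
    have "real L * info_form y - (\<Sum>r<L. \<Sum>d<r. (combo y d)\<^sup>2) = (\<Sum>r<L. info_form y - (\<Sum>d<r. (combo y d)\<^sup>2))"
      by (simp add: sum_subtractf)
    also have "\<dots> \<le> (\<Sum>r<L. B / (1 - q) * q ^ r)" by (rule sum_mono) (rule tail)
    also have "\<dots> = B / (1 - q) * (\<Sum>r<L. q ^ r)" by (simp add: sum_distrib_left)
    also have "\<dots> \<le> B / (1 - q) * (\<Sum>r. q ^ r)"
      using q B0 by (intro mult_left_mono sum_le_suminf summable_geometric) auto
    finally show ?thesis using q by (simp add: suminf_geometric)
  qed
  then show ?thesis by blast
qed

text \<open>For y = 0 the score vanishes. Otherwise it is the form treated in
  \<open>lower_lil\<close> plus a martingale with negligible integrand, which the upper half with s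
  = 0 makes smaller than any multiple of \<open>lil_scale\<close>.\<close>

lemma score_lower:
  "AE \<omega> in M. \<forall>\<delta>>0. \<exists>\<^sub>F n in sequentially. (sqrt (info_form y) - \<delta>) * lil_scale n \<le> score y (path \<omega>) n"
proof (cases "\<forall>a<p. y a = 0")
  case True
  then have 0: "score y e n = 0" for e n by (simp add: score_def score_coeff_def)
  have "info_form y = 0" using True by (simp add: info_form_def)
  have "\<forall>\<^sub>F n in sequentially. (sqrt (info_form y) - \<delta>) * lil_scale n \<le> score y (path \<omega>) n" if "\<delta> > 0" for \<delta> \<omega>
    using lil_scale_pos_ev
  proof eventually_elim
    case (elim n)
    then show ?case using that \<open>info_form y = 0\<close> by (simp add: 0)
  qed
  then show ?thesis by (intro AE_I2 allI impI eventually_frequently) auto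
next
  case False
  let ?s = "sqrt (info_form y)"
  have s: "?s > 0" using info_positive[OF False] by (simp add: info_form_def)
  have s2: "?s\<^sup>2 = info_form y" using info_form_eq(2) by simp
  obtain D where D: "\<And>L. real L * ?s\<^sup>2 - (\<Sum>r<L. \<Sum>d<r. (combo y d)\<^sup>2) \<le> D" using combo_tail[of y] unfolding s2 by blast
  have part: "(\<Sum>d<r. (combo y d)\<^sup>2) \<le> ?s\<^sup>2" for r
    unfolding s2 by (subst info_form_eq(1), rule sum_le_suminf) (use combo_square_sums[of y] in \<open>auto simp: sums_iff\<close>)
  let ?d = "\<lambda>\<omega> i. score_coeff y (path \<omega>) i - lin_proc (combo y) (path \<omega>) i"
  have "AE \<omega> in M. \<forall>\<delta>>0. \<forall>\<^sub>F n in sequentially. \<bar>\<Sum>i<n. ?d \<omega> i * \<epsilon> (Suc i) \<omega>\<bar> \<le> (0 + \<delta>) * lil_scale n"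
  proof (rule upper_lil)
    have "(\<lambda>\<omega>. lin_proc (combo y) (path \<omega>) i) \<in> borel_measurable (past i)" for i
      unfolding lin_proc_def path_def using noise_combination(1)[of "\<lambda>j. combo y (i - 1 - j)" i] by simp
    then show "(\<lambda>\<omega>. ?d \<omega> i) \<in> borel_measurable (past i)" for i
      using score_coeff_measurable by (intro borel_measurable_diff) auto
    show "AE \<omega> in M. \<forall>\<delta>>0. \<forall>\<^sub>F n in sequentially. (\<Sum>i<n. (?d \<omega> i)\<^sup>2) \<le> (0\<^sup>2 + \<delta>) * real n"
      using AE_path
    proof eventually_elim
      case (elim \<omega>)
      show ?case
      proof (intro allI impI)
        fix \<delta> :: real assume \<delta>: "\<delta> > 0"
        have "(\<lambda>n. (rms (?d \<omega>) n)\<^sup>2) \<longlonglongrightarrow> 0\<^sup>2"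
          using score_coeff_approx[OF elim, of y] unfolding negligible_seq_def by (rule tendsto_power)
        then have "\<forall>\<^sub>F n in sequentially. (rms (?d \<omega>) n)\<^sup>2 < \<delta>" using \<delta> by (intro order_tendstoD) auto
        then show "\<forall>\<^sub>F n in sequentially. (\<Sum>i<n. (?d \<omega> i)\<^sup>2) \<le> (0\<^sup>2 + \<delta>) * real n"
          using eventually_gt_at_top[of 0] by eventually_elim (simp add: rms_square divide_less_eq)
      qed
    qed
  qed simp
  with lower_lil[OF part s D] show ?thesis
  proof eventually_elim
    case (elim \<omega>)
    show ?case
    proof (intro allI impI)
      fix \<delta> :: real assume "\<delta> > 0"
      then have d2: "\<delta> / 2 > 0" by simp
      show "\<exists>\<^sub>F n in sequentially. (?s - \<delta>) * lil_scale n \<le> score y (path \<omega>) n"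
        using elim(1)[rule_format, OF d2]
      proof (rule frequently_rev_mp)
        show "\<forall>\<^sub>F n in sequentially. (?s - \<delta> / 2) * lil_scale n \<le> block_form (combo y) 0 n \<omega> \<longrightarrow> (?s - \<delta>) * lil_scale n \<le> score y (path \<omega>) n"
          using elim(2)[rule_format, OF d2]
        proof eventually_elim
          case (elim n)
          have "score y (path \<omega>) n = block_form (combo y) 0 n \<omega> + (\<Sum>i<n. ?d \<omega> i * \<epsilon> (Suc i) \<omega>)"
            unfolding score_def block_form_0 sum.distrib[symmetric]
          proof (rule sum.cong)
            fix i
            show "score_coeff y (path \<omega>) i * path \<omega> i = lin_proc (combo y) (\<lambda>j. \<epsilon> (Suc j) \<omega>) i * \<epsilon> (Suc i) \<omega> + ?d \<omega> i * \<epsilon> (Suc i) \<omega>"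
              by (simp add: path_def[abs_def] left_diff_distrib)
          qed simp
          moreover have "(?s - \<delta>) * lil_scale n = (?s - \<delta> / 2) * lil_scale n - \<delta> / 2 * lil_scale n"
            by (simp add: left_diff_distrib)
          ultimately show ?case using abs_le_D2[OF elim] by simp
        qed
      qed
    qed
  qed
qed

end

section \<open>The maximum likelihood estimator\<close>

lemma sum_lessThan_add_split: "(\<Sum>c<m + n. f c) = (\<Sum>c<m. f c) + (\<Sum>c<n. f (m + c))" for f :: "nat \<Rightarrow> real"
  by (induction n) (auto simp: add.assoc)

lemma zeta_carrier: "zeta p k x n \<in> carrier_vec (2 * p)"
  by (cases "n = 0") (simp_all add: zeta_def Z_vec_def carrier_vecI)

lemma regressor_entry:
  assumes a: "a < p"
  shows "regressor p k x n $ a = (\<Sum>i=1..n. k n i * x (int i - int a))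
    + pacf k n * (\<Sum>m<n. pacf k m * (\<Sum>i=1..m. k m i * x (int i - int a)))"
proof -
  let ?z = "\<lambda>n. \<Sum>i=1..n. k n i * x (int i - int a)"
  have zd: "zeta p k x n \<in> carrier_vec (p + p)"
    using zeta_carrier[of p k x n] unfolding mult_2 .
  have ac: "a_mat p k n \<in> carrier_mat (p + p) p"
    unfolding a_mat_def by (rule carrier_append_rows) auto
  have ae: "a_mat p k n $$ (c, a) = (if c < p then if c = a then 1 else 0 else if c = p + a then pacf k n else 0)" if "c < p + p" for c
    using that a by (auto simp: a_mat_def append_rows_def)
  have z1: "zeta p k x n $ c = (\<Sum>i=1..n. k n i * x (int i - int c))" if "c < p" for c
    using that by (cases "n = 0") (auto simp: zeta_def Z_vec_def Y_vec_def)
  have z2: "zeta p k x n $ (p + c) = (\<Sum>m\<in>{1..<n}. pacf k m * (\<Sum>i=1..m. k m i * x (int i - int c)))" if "c < p" for c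
    using that by (cases "n = 0") (auto simp: zeta_def Z_vec_def Y_vec_def)
  have "regressor p k x n $ a = (\<Sum>c<p + p. a_mat p k n $$ (c, a) * zeta p k x n $ c)"
    unfolding regressor_def using ac a zd
    by (subst mult_mat_vec_entry[of _ p "p + p"]) auto
  also have "\<dots> = (\<Sum>c<p. a_mat p k n $$ (c, a) * zeta p k x n $ c) + (\<Sum>c<p. a_mat p k n $$ (p + c, a) * zeta p k x n $ (p + c))"
    by (rule sum_lessThan_add_split)
  also have "(\<Sum>c<p. a_mat p k n $$ (c, a) * zeta p k x n $ c) = (\<Sum>c<p. if c = a then ?z n else 0)"
    by (rule sum.cong) (auto simp: ae z1)
  also have "(\<Sum>c<p. a_mat p k n $$ (p + c, a) * zeta p k x n $ (p + c)) = (\<Sum>c<p. if c = a then pacf k n * (\<Sum>m\<in>{1..<n}. pacf k m * ?z m) else 0)"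
    by (rule sum.cong) (auto simp: ae z2)
  \<comment> \<open>At m = 0 the inner sum is empty, so this index can be added.\<close>
  also have "(\<Sum>m\<in>{1..<n}. pacf k m * ?z m) = (\<Sum>m<n. pacf k m * ?z m)"
  proof (rule sum.mono_neutral_left)
    show "\<forall>i\<in>{..<n} - {1..<n}. pacf k i * ?z i = 0"
    proof
      fix i assume "i \<in> {..<n} - {1..<n}"
      then have "i = 0" by auto
      then show "pacf k i * ?z i = 0" by simp
    qed
  qed auto
  finally show ?thesis using a by simp
qed

lemma zeta_first_entry:
  assumes "0 < p"
  shows "unit_vec (2 * p) 0 \<bullet> zeta p k x n = (\<Sum>i=1..n. k n i * x (int i))"
proof -
  have "unit_vec (2 * p) 0 \<bullet> zeta p k x n = zeta p k x n $ 0"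
    by (rule scalar_prod_left_unit[OF zeta_carrier]) (use assms in simp)
  also have "\<dots> = (\<Sum>i=1..n. k n i * x (int i))"
    using assms by (cases "n = 0") (auto simp: zeta_def Z_vec_def Y_vec_def)
  finally show ?thesis .
qed

lemma scalar_prod_sum: "w \<in> carrier_vec p \<Longrightarrow> v \<bullet> w = (\<Sum>t<p. v $ t * w $ t)"
  by (simp add: scalar_prod_def lessThan_atLeast0)

lemma lil_scale_ratio:
  "\<forall>\<^sub>F n in sequentially. sqrt (real n / (2 * ln (ln (real n)))) = real n / lil_scale n"
proof -
  have "\<forall>\<^sub>F n in sequentially. ln (ln (real n)) > 0" by real_asymp
  then show ?thesis using eventually_gt_at_top[of 0]
  proof eventually_elim
    case (elim n)
    have "sqrt (real n / (2 * ln (ln (real n)))) = sqrt (real n * real n / (2 * real n * ln (ln (real n))))"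
      using elim by simp
    also have "\<dots> = real n / lil_scale n"
      unfolding lil_scale_def by (simp only: real_sqrt_divide real_sqrt_mult_self abs_of_nat real_sqrt_abs2)
    finally show ?case .
  qed
qed

context ar_mle
begin

text \<open>On a fixed path the filtered model equation and \<open>filtered_lag\<close> give the
  first row of the recursion, and the time shift between the components of Y_n gives the remaining
  rows of the companion matrix; this is the recursion defining \<open>ar_state\<close>.\<close>

lemma regressor_identification:
  assumes \<omega>: "\<omega> \<in> space M" and inn: "\<And>n. 1 \<le> n \<Longrightarrow> \<sigma> n * \<epsilon> n \<omega> = (\<Sum>i=1..n. k n i * \<xi> i \<omega>)"
  shows "a < p \<Longrightarrow> regressor p k (\<lambda>i. X i \<omega>) n $ a = wc (path \<omega>) n a"
    and "unit_vec (2 * p) 0 \<bullet> zeta p k (\<lambda>i. X i \<omega>) (Suc n) = (\<Sum>b<p. \<theta> $ b * wc (path \<omega>) n b) + sd n * path \<omega> n"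
proof -
  define y where "y = (\<lambda>a i. X (int i - int a) \<omega>)"
  define zx where "zx = (\<lambda>n a. \<Sum>i=1..n. k n i * y a i)"
  have y0: "y a 0 = 0" for a using model \<omega> by (simp add: y_def ar_model_def)
  have yS: "y (Suc a) (Suc i) = y a i" for a i by (simp add: y_def)
  have y1: "y 0 (Suc i) = (\<Sum>b<p. \<theta> $ b * y b i) + \<xi> (Suc i) \<omega>" for i
  proof -
    have "X (int (Suc i)) \<omega> = (\<Sum>j=1..p. \<theta> $ (j - 1) * X (int (Suc i) - int j) \<omega>) + \<xi> (Suc i) \<omega>"
      using model \<omega> by (auto simp: ar_model_def theta_dim(2) simp del: of_nat_Suc)
    also have "(\<Sum>j=1..p. \<theta> $ (j - 1) * X (int (Suc i) - int j) \<omega>) = (\<Sum>b<p. \<theta> $ b * y b i)"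
      unfolding One_nat_def sum.atLeast1_atMost_eq by (rule sum.cong) (auto simp: y_def)
    finally show ?thesis by (simp add: y_def)
  qed
  have lag: "(\<Sum>i=1..Suc n. k (Suc n) i * y b (i - 1)) = zx n b + \<beta> n * (\<Sum>m<n. \<beta> m * zx m b)" for n b
    using filtered_lag[of "y b" n, OF y0] by (simp only: zx_def Suc_eq_plus1)
  have zx_0: "zx (Suc n) 0 = (\<Sum>b<p. \<theta> $ b * (zx n b + \<beta> n * (\<Sum>m<n. \<beta> m * zx m b))) + sd n * path \<omega> n" for n
  proof -
    have "zx (Suc n) 0 = (\<Sum>i=1..Suc n. (\<Sum>b<p. \<theta> $ b * (k (Suc n) i * y b (i - 1))) + k (Suc n) i * \<xi> i \<omega>)"
      unfolding zx_def
    proof (rule sum.cong)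
      fix i assume "i \<in> {1..Suc n}"
      then have "i = Suc (i - 1)" by simp
      then have "y 0 i = (\<Sum>b<p. \<theta> $ b * y b (i - 1)) + \<xi> i \<omega>" using y1[of "i - 1"] by metis
      then show "k (Suc n) i * y 0 i = (\<Sum>b<p. \<theta> $ b * (k (Suc n) i * y b (i - 1))) + k (Suc n) i * \<xi> i \<omega>"
        by (simp add: distrib_left sum_distrib_left mult.left_commute)
    qed simp
    also have "\<dots> = (\<Sum>i=1..Suc n. \<Sum>b<p. \<theta> $ b * (k (Suc n) i * y b (i - 1))) + sd n * \<epsilon> (Suc n) \<omega>"
      unfolding sum.distrib by (subst inn) auto
    also have "(\<Sum>i=1..Suc n. \<Sum>b<p. \<theta> $ b * (k (Suc n) i * y b (i - 1))) = (\<Sum>b<p. \<theta> $ b * (\<Sum>i=1..Suc n. k (Suc n) i * y b (i - 1)))"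
      by (subst sum.swap) (simp only: sum_distrib_left)
    finally show ?thesis unfolding lag by (simp add: path_def)
  qed
  have zx_S: "zx (Suc n) (Suc a) = zx n a + \<beta> n * (\<Sum>m<n. \<beta> m * zx m a)" for n a
  proof -
    have "zx (Suc n) (Suc a) = (\<Sum>i=1..Suc n. k (Suc n) i * y a (i - 1))"
      unfolding zx_def
    proof (rule sum.cong)
      fix i assume "i \<in> {1..Suc n}"
      then have "i = Suc (i - 1)" by simp
      then have "y (Suc a) i = y a (i - 1)" using yS[of a "i - 1"] by metis
      then show "k (Suc n) i * y (Suc a) i = k (Suc n) i * y a (i - 1)" by simp
    qed simp
    then show ?thesis unfolding lag .
  qed
  have zx_zc: "a < p \<Longrightarrow> zx n a = zc (path \<omega>) n a" for n a
  proof (induction n arbitrary: a rule: less_induct)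
    case (less n)
    show ?case
    proof (cases n)
      case 0
      then show ?thesis by (simp add: zx_def zc_def)
    next
      case (Suc m)
      have w: "zx m b + \<beta> m * (\<Sum>i<m. \<beta> i * zx i b) = wc (path \<omega>) m b" if "b < p" for b
        using less.IH that Suc by (simp add: wc_def Sc_def ar_state_sum zc_def)
      have zcS: "zc (path \<omega>) (Suc m) a = (\<Sum>b<p. A a b * wc (path \<omega>) m b) + (if a = 0 then sd m * path \<omega> m else 0)"
        by (simp add: zc_def wc_def Sc_def)
      show ?thesis
      proof (cases a)
        case 0
        have "(\<Sum>b<p. \<theta> $ b * (zx m b + \<beta> m * (\<Sum>i<m. \<beta> i * zx i b))) = (\<Sum>b<p. A 0 b * wc (path \<omega>) m b)"
          by (rule sum.cong) (auto simp: w A_first)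
        then show ?thesis unfolding Suc zcS using zx_0[of m] 0 by simp
      next
        case (Suc a')
        then show ?thesis unfolding \<open>n = Suc m\<close> zcS
          using A_sum_sub[of a "wc (path \<omega>) m"] zx_S[of m a'] w[of a'] less.prems by simp
      qed
    qed
  qed
  have w: "zx n b + \<beta> n * (\<Sum>m<n. \<beta> m * zx m b) = wc (path \<omega>) n b" if "b < p" for b n
    using zx_zc that by (simp add: wc_def Sc_def ar_state_sum zc_def)
  show "a < p \<Longrightarrow> regressor p k (\<lambda>i. X i \<omega>) n $ a = wc (path \<omega>) n a"
    using w[of a n] by (simp add: regressor_entry zx_def y_def)
  have "unit_vec (2 * p) 0 \<bullet> zeta p k (\<lambda>i. X i \<omega>) (Suc n) = zx (Suc n) 0"
    using zeta_first_entry[of p k "\<lambda>i. X i \<omega>" "Suc n"] p_ge by (simp only: zx_def y_def) simp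
  also have "\<dots> = (\<Sum>b<p. \<theta> $ b * wc (path \<omega>) n b) + sd n * path \<omega> n"
    unfolding zx_0 using w by simp
  finally show "unit_vec (2 * p) 0 \<bullet> zeta p k (\<lambda>i. X i \<omega>) (Suc n) = (\<Sum>b<p. \<theta> $ b * wc (path \<omega>) n b) + sd n * path \<omega> n" .
qed

text \<open>Collects what the algebra of the estimator needs from a path, for all directions v at
  once. A crude bound on each unit score suffices, since it will be multiplied by a null
  sequence.\<close>

definition good_path :: "'a \<Rightarrow> bool" where
  "good_path \<omega> \<longleftrightarrow> ergodic_path (path \<omega>) \<and>
    (\<forall>n. \<forall>a<p. regressor p k (\<lambda>i. X i \<omega>) n $ a = wc (path \<omega>) n a) \<and>
    (\<forall>n. unit_vec (2 * p) 0 \<bullet> zeta p k (\<lambda>i. X i \<omega>) (Suc n) = (\<Sum>b<p. \<theta> $ b * wc (path \<omega>) n b) + sd n * path \<omega> n) \<and>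
    (\<forall>s<p. \<forall>\<^sub>F n in sequentially. \<bar>score (\<lambda>a. if a = s then 1 else 0) (path \<omega>) n\<bar>
        \<le> (sqrt (info_form (\<lambda>a. if a = s then 1 else 0)) + 1) * lil_scale n)"

lemma AE_good_path: "AE \<omega> in M. good_path \<omega>"
proof -
  have "AE \<omega> in M. \<forall>n. 1 \<le> n \<longrightarrow> \<sigma> n * \<epsilon> n \<omega> = (\<Sum>i=1..n. k n i * \<xi> i \<omega>)"
    unfolding AE_all_countable
  proof
    fix n show "AE \<omega> in M. 1 \<le> n \<longrightarrow> \<sigma> n * \<epsilon> n \<omega> = (\<Sum>i=1..n. k n i * \<xi> i \<omega>)"
      using AE_innovation[of n] by (cases "1 \<le> n") auto
  qed
  moreover have "AE \<omega> in M. \<forall>s. \<forall>\<^sub>F n in sequentially. \<bar>score (\<lambda>a. if a = s then 1 else 0) (path \<omega>) n\<bar>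
        \<le> (sqrt (info_form (\<lambda>a. if a = s then 1 else 0)) + 1) * lil_scale n"
    unfolding AE_all_countable
  proof
    fix s :: nat
    show "AE \<omega> in M. \<forall>\<^sub>F n in sequentially. \<bar>score (\<lambda>a. if a = s then 1 else 0) (path \<omega>) n\<bar>
        \<le> (sqrt (info_form (\<lambda>a. if a = s then 1 else 0)) + 1) * lil_scale n"
      using score_upper[of "\<lambda>a. if a = s then 1 else 0"] by (rule AE_mp) (auto intro!: AE_I2)
  qed
  ultimately show ?thesis using AE_path AE_space
  proof eventually_elim
    case (elim \<omega>)
    have inn: "\<sigma> n * \<epsilon> n \<omega> = (\<Sum>i=1..n. k n i * \<xi> i \<omega>)" if "1 \<le> n" for n using elim(1) that by blast
    show ?case unfolding good_path_def
      using elim(2,3) regressor_identification[OF elim(4) inn] by blast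
  qed
qed

section \<open>Convergence of the normalised information matrix\<close>

abbreviation nm :: "'a \<Rightarrow> nat \<Rightarrow> real Matrix.mat" where
  "nm \<omega> n \<equiv> normal_matrix p k \<sigma> (\<lambda>i. X i \<omega>) n"

lemma nm_carrier: "nm \<omega> n \<in> carrier_mat p p"
  by (simp add: normal_matrix_def)

lemma nm_entry:
  assumes "good_path \<omega>" "s < p" "t < p"
  shows "nm \<omega> n $$ (s, t) = (\<Sum>i<n. (wc (path \<omega>) i s / sd i) * (wc (path \<omega>) i t / sd i))"
proof -
  have "nm \<omega> n $$ (s, t) = (\<Sum>i=1..n. regressor p k (\<lambda>i. X i \<omega>) (i - 1) $ s * regressor p k (\<lambda>i. X i \<omega>) (i - 1) $ t / (\<sigma> i)\<^sup>2)"
    using assms by (simp add: normal_matrix_def)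
  also have "\<dots> = (\<Sum>i<n. (wc (path \<omega>) i s / sd i) * (wc (path \<omega>) i t / sd i))"
    unfolding One_nat_def sum.atLeast1_atMost_eq
    by (rule sum.cong) (use assms in \<open>auto simp: good_path_def power2_eq_square\<close>)
  finally show ?thesis .
qed

lemma nm_limit:
  assumes g: "good_path \<omega>" and st: "s < p" "t < p"
  shows "(\<lambda>n. (1 / real n \<cdot>\<^sub>m nm \<omega> n) $$ (s, t)) \<longlonglongrightarrow> info_mat $$ (s, t)"
proof -
  have e: "ergodic_path (path \<omega>)" using g by (simp add: good_path_def)
  have "(\<lambda>n. (\<Sum>i<n. (wc (path \<omega>) i s / sd i) * (wc (path \<omega>) i t / sd i)) / real n) \<longlonglongrightarrow> (\<Sum>d. G d s 0 * G d t 0)"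
    by (rule ergodic_path_cross[OF e G_abs_summable G_abs_summable wc_approx[OF e] wc_approx[OF e]]) (use st p_ge in auto)
  moreover have "(1 / real n \<cdot>\<^sub>m nm \<omega> n) $$ (s, t) = (\<Sum>i<n. (wc (path \<omega>) i s / sd i) * (wc (path \<omega>) i t / sd i)) / real n" for n
    using nm_carrier[of \<omega> n] st nm_entry[OF g st, of n] by simp
  ultimately show ?thesis using st by (simp add: info_mat_def info_def)
qed

lemma nm_det:
  assumes g: "good_path \<omega>"
  shows "\<forall>\<^sub>F n in sequentially. n > 0 \<and> Determinant.det (1 / real n \<cdot>\<^sub>m nm \<omega> n) \<noteq> 0 \<and> Determinant.det (nm \<omega> n) \<noteq> 0"
proof -
  have "(\<lambda>n. Determinant.det (1 / real n \<cdot>\<^sub>m nm \<omega> n)) \<longlonglongrightarrow> Determinant.det info_mat"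
    by (rule det_tendsto[where n = p]) (use nm_carrier info_mat_carrier nm_limit[OF g] in auto)
  from tendsto_imp_eventually_ne[OF this det_info] eventually_gt_at_top[of 0] show ?thesis
  proof eventually_elim
    case (elim n)
    then show ?case by (auto simp: det_smult)
  qed
qed

lemma nm_inverse_limit:
  assumes g: "good_path \<omega>" and st: "s < p" "t < p"
  shows "(\<lambda>n. real n * mat_inv (nm \<omega> n) $$ (s, t)) \<longlonglongrightarrow> mat_inv info_mat $$ (s, t)"
proof -
  let ?B = "\<lambda>n. 1 / real n \<cdot>\<^sub>m nm \<omega> n"
  have B: "?B n \<in> carrier_mat p p" for n using nm_carrier by simp
  have "(\<lambda>n. mat_inv (?B n) $$ (s, t)) \<longlonglongrightarrow> mat_inv info_mat $$ (s, t)"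
    by (rule mat_inv_tendsto[OF B info_mat_carrier det_info nm_limit[OF g] st])
  moreover have "\<forall>\<^sub>F n in sequentially. mat_inv (?B n) $$ (s, t) = real n * mat_inv (nm \<omega> n) $$ (s, t)"
    using nm_det[OF g]
  proof eventually_elim
    case (elim n)
    have "real n \<cdot>\<^sub>m ?B n = nm \<omega> n"
      by (rule eq_matI) (use elim in auto)
    then show ?case using mat_inv_smult[OF B[of n] _ _ st, of "real n"] elim by auto
  qed
  ultimately show ?thesis by (rule Lim_transform_eventually)
qed

abbreviation unit_score :: "'a \<Rightarrow> nat \<Rightarrow> nat \<Rightarrow> real" where
  "unit_score \<omega> s n \<equiv> score (\<lambda>a. if a = s then 1 else 0) (path \<omega>) n"

lemma unit_score_eq: "s < p \<Longrightarrow> unit_score \<omega> s n = (\<Sum>i<n. wc (path \<omega>) i s / sd i * path \<omega> i)"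
proof -
  assume s: "s < p"
  have "score_coeff (\<lambda>a. if a = s then 1 else 0) (path \<omega>) i = wc (path \<omega>) i s / sd i" for i
  proof -
    have "score_coeff (\<lambda>a. if a = s then 1 else 0) (path \<omega>) i = (\<Sum>a<p. if a = s then wc (path \<omega>) i s / sd i else 0)"
      unfolding score_coeff_def by (rule sum.cong) auto
    then show ?thesis using s by simp
  qed
  then show ?thesis by (simp add: score_def)
qed

lemma score_unit_score: "score y (path \<omega>) n = (\<Sum>s<p. y s * unit_score \<omega> s n)"
proof -
  have "score y (path \<omega>) n = (\<Sum>i<n. \<Sum>s<p. y s * (wc (path \<omega>) i s / sd i * path \<omega> i))"
    by (simp add: score_def score_coeff_def sum_distrib_right mult.assoc)
  also have "\<dots> = (\<Sum>s<p. \<Sum>i<n. y s * (wc (path \<omega>) i s / sd i * path \<omega> i))" by (rule sum.swap)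
  also have "\<dots> = (\<Sum>s<p. y s * unit_score \<omega> s n)"
    by (rule sum.cong) (auto simp: unit_score_eq sum_distrib_left)
  finally show ?thesis .
qed

abbreviation err :: "'a \<Rightarrow> nat \<Rightarrow> real Matrix.vec" where
  "err \<omega> n \<equiv> mle p k \<sigma> (\<lambda>i. X i \<omega>) n - \<theta>"

text \<open>The normal vector is the normal matrix applied to \<theta> plus the score vector, so
  \<theta> cancels exactly.\<close>

lemma mle_error:
  assumes g: "good_path \<omega>" and d: "Determinant.det (nm \<omega> n) \<noteq> 0"
  shows "err \<omega> n \<in> carrier_vec p" and "t < p \<Longrightarrow> err \<omega> n $ t = (\<Sum>s<p. mat_inv (nm \<omega> n) $$ (t, s) * unit_score \<omega> s n)"
proof -
  note inv = mat_inv_props[OF nm_carrier d]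
  let ?m = "Matrix.vec p (\<lambda>s. unit_score \<omega> s n)"
  let ?nv = "normal_vector p k \<sigma> (\<lambda>i. X i \<omega>) n"
  have nv: "?nv = nm \<omega> n *\<^sub>v \<theta> + ?m"
  proof (rule eq_vecI)
    fix s assume "s < dim_vec (nm \<omega> n *\<^sub>v \<theta> + ?m)"
    then have s: "s < p" by simp
    have "?nv $ s = (\<Sum>i<n. regressor p k (\<lambda>i. X i \<omega>) i $ s * (unit_vec (2 * p) 0 \<bullet> zeta p k (\<lambda>i. X i \<omega>) (Suc i)) / (sd i)\<^sup>2)"
      using s unfolding normal_vector_def by (simp add: sum.atLeast1_atMost_eq)
    also have "\<dots> = (\<Sum>i<n. (\<Sum>b<p. (wc (path \<omega>) i s / sd i) * (wc (path \<omega>) i b / sd i) * \<theta> $ b) + wc (path \<omega>) i s / sd i * path \<omega> i)"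
    proof (rule sum.cong)
      fix i
      have sdi: "sd i \<noteq> 0" using sd_pos'[of i] by simp
      have "regressor p k (\<lambda>i. X i \<omega>) i $ s * (unit_vec (2 * p) 0 \<bullet> zeta p k (\<lambda>i. X i \<omega>) (Suc i)) / (sd i)\<^sup>2
          = wc (path \<omega>) i s * ((\<Sum>b<p. \<theta> $ b * wc (path \<omega>) i b) + sd i * path \<omega> i) / (sd i)\<^sup>2"
        using g s by (simp add: good_path_def)
      also have "\<dots> = wc (path \<omega>) i s * (\<Sum>b<p. \<theta> $ b * wc (path \<omega>) i b) / (sd i)\<^sup>2 + wc (path \<omega>) i s / sd i * path \<omega> i"
        using sdi by (simp add: distrib_left add_divide_distrib power2_eq_square)
      also have "wc (path \<omega>) i s * (\<Sum>b<p. \<theta> $ b * wc (path \<omega>) i b) / (sd i)\<^sup>2 = (\<Sum>b<p. (wc (path \<omega>) i s / sd i) * (wc (path \<omega>) i b / sd i) * \<theta> $ b)"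
        by (simp add: sum_distrib_left sum_divide_distrib power2_eq_square mult_ac)
      finally show "regressor p k (\<lambda>i. X i \<omega>) i $ s * (unit_vec (2 * p) 0 \<bullet> zeta p k (\<lambda>i. X i \<omega>) (Suc i)) / (sd i)\<^sup>2
          = (\<Sum>b<p. (wc (path \<omega>) i s / sd i) * (wc (path \<omega>) i b / sd i) * \<theta> $ b) + wc (path \<omega>) i s / sd i * path \<omega> i" .
    qed simp
    also have "\<dots> = (\<Sum>b<p. \<Sum>i<n. (wc (path \<omega>) i s / sd i) * (wc (path \<omega>) i b / sd i) * \<theta> $ b) + unit_score \<omega> s n"
      unfolding sum.distrib unit_score_eq[OF s] by (subst sum.swap) simp
    also have "(\<Sum>b<p. \<Sum>i<n. (wc (path \<omega>) i s / sd i) * (wc (path \<omega>) i b / sd i) * \<theta> $ b) = (\<Sum>b<p. nm \<omega> n $$ (s, b) * \<theta> $ b)"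
      by (rule sum.cong) (auto simp: nm_entry[OF g s] sum_distrib_right)
    also have "\<dots> = (nm \<omega> n *\<^sub>v \<theta>) $ s"
      by (rule mult_mat_vec_entry[OF nm_carrier theta_dim(1) s, symmetric])
    finally show "?nv $ s = (nm \<omega> n *\<^sub>v \<theta> + ?m) $ s" using s by simp
  qed (simp add: normal_vector_def)
  have m: "?m \<in> carrier_vec p" by simp
  have "mle p k \<sigma> (\<lambda>i. X i \<omega>) n = mat_inv (nm \<omega> n) *\<^sub>v (nm \<omega> n *\<^sub>v \<theta>) + mat_inv (nm \<omega> n) *\<^sub>v ?m"
    unfolding mle_def nv using nm_carrier[of \<omega> n] theta_dim(1)
    by (intro mult_add_distrib_mat_vec[OF inv(1)]) auto
  also have "mat_inv (nm \<omega> n) *\<^sub>v (nm \<omega> n *\<^sub>v \<theta>) = \<theta>"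
    unfolding assoc_mult_mat_vec[OF inv(1) nm_carrier[of \<omega> n] theta_dim(1), symmetric] inv(3)
    using theta_dim(1) by (rule one_mult_mat_vec)
  finally have e: "mle p k \<sigma> (\<lambda>i. X i \<omega>) n = \<theta> + mat_inv (nm \<omega> n) *\<^sub>v ?m" .
  have im: "mat_inv (nm \<omega> n) *\<^sub>v ?m \<in> carrier_vec p" using inv(1) by simp
  show "err \<omega> n \<in> carrier_vec p" unfolding e using theta_dim(1) im by simp
  assume t: "t < p"
  have "err \<omega> n $ t = (mat_inv (nm \<omega> n) *\<^sub>v ?m) $ t" unfolding e using theta_dim(1) inv(1) t by simp
  then show "err \<omega> n $ t = (\<Sum>s<p. mat_inv (nm \<omega> n) $$ (t, s) * unit_score \<omega> s n)"
    unfolding mult_mat_vec_entry[OF inv(1) m t] by simp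
qed

text \<open>The row vector v^* I^{-1}, through which the error in direction v depends on the
  score.\<close>

abbreviation dual :: "real Matrix.vec \<Rightarrow> nat \<Rightarrow> real" where
  "dual v s \<equiv> \<Sum>t<p. v $ t * mat_inv info_mat $$ (t, s)"

text \<open>Multiplied by n, the inverse of the normal matrix converges to I^{-1}, while the unit
  scores are O(lil_scale). Replacing the random inverse by its limit therefore costs o(1) on the
  scale n / \<open>lil_scale n\<close>.\<close>

lemma error_expansion:
  assumes g: "good_path \<omega>" and v: "v \<in> carrier_vec p"
  shows "(\<lambda>n. sqrt (real n / (2 * ln (ln (real n)))) * (v \<bullet> err \<omega> n) - score (dual v) (path \<omega>) n / lil_scale n) \<longlonglongrightarrow> 0"
proof -
  have term0: "(\<lambda>n. (real n * mat_inv (nm \<omega> n) $$ (t, s) - mat_inv info_mat $$ (t, s)) * (unit_score \<omega> s n / lil_scale n)) \<longlonglongrightarrow> 0"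
    if st: "s < p" "t < p" for s t
  proof -
    obtain C where C: "\<forall>\<^sub>F n in sequentially. \<bar>unit_score \<omega> s n\<bar> \<le> C * lil_scale n"
      using g st unfolding good_path_def by blast
    have lim: "(\<lambda>n. \<bar>real n * mat_inv (nm \<omega> n) $$ (t, s) - mat_inv info_mat $$ (t, s)\<bar> * C) \<longlonglongrightarrow> 0"
      using nm_inverse_limit[OF g st(2,1)] by (intro tendsto_mult_left_zero tendsto_rabs_zero) (simp add: LIM_zero_iff)
    show ?thesis
    proof (rule Lim_null_comparison[OF _ lim])
      show "\<forall>\<^sub>F n in sequentially. norm ((real n * mat_inv (nm \<omega> n) $$ (t, s) - mat_inv info_mat $$ (t, s)) * (unit_score \<omega> s n / lil_scale n))
          \<le> \<bar>real n * mat_inv (nm \<omega> n) $$ (t, s) - mat_inv info_mat $$ (t, s)\<bar> * C"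
        using C lil_scale_pos_ev
      proof eventually_elim
        case (elim n)
        have "\<bar>unit_score \<omega> s n / lil_scale n\<bar> \<le> C" using elim by (simp add: divide_le_eq)
        then show ?case unfolding real_norm_def abs_mult by (intro mult_left_mono) auto
      qed
    qed
  qed
  have "(\<lambda>n. \<Sum>t<p. \<Sum>s<p. v $ t * ((real n * mat_inv (nm \<omega> n) $$ (t, s) - mat_inv info_mat $$ (t, s)) * (unit_score \<omega> s n / lil_scale n))) \<longlonglongrightarrow> (\<Sum>t<p. \<Sum>s<p. v $ t * 0)"
    by (intro tendsto_sum tendsto_mult_left term0) auto
  then have lim: "(\<lambda>n. \<Sum>t<p. \<Sum>s<p. v $ t * ((real n * mat_inv (nm \<omega> n) $$ (t, s) - mat_inv info_mat $$ (t, s)) * (unit_score \<omega> s n / lil_scale n))) \<longlonglongrightarrow> 0" by simp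
  have "\<forall>\<^sub>F n in sequentially. (\<Sum>t<p. \<Sum>s<p. v $ t * ((real n * mat_inv (nm \<omega> n) $$ (t, s) - mat_inv info_mat $$ (t, s)) * (unit_score \<omega> s n / lil_scale n)))
      = sqrt (real n / (2 * ln (ln (real n)))) * (v \<bullet> err \<omega> n) - score (dual v) (path \<omega>) n / lil_scale n"
    using nm_det[OF g] lil_scale_ratio
  proof eventually_elim
    case (elim n)
    have d: "Determinant.det (nm \<omega> n) \<noteq> 0" using elim by simp
    have "v \<bullet> err \<omega> n = (\<Sum>t<p. v $ t * err \<omega> n $ t)"
      by (rule scalar_prod_sum[OF mle_error(1)[OF g d]])
    also have "\<dots> = (\<Sum>t<p. \<Sum>s<p. v $ t * (mat_inv (nm \<omega> n) $$ (t, s) * unit_score \<omega> s n))"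
      by (rule sum.cong) (auto simp: mle_error(2)[OF g d] sum_distrib_left)
    finally have 1: "real n / lil_scale n * (v \<bullet> err \<omega> n) = (\<Sum>t<p. \<Sum>s<p. v $ t * (real n * mat_inv (nm \<omega> n) $$ (t, s) * (unit_score \<omega> s n / lil_scale n)))"
      by (simp add: sum_distrib_left mult_ac)
    have "score (dual v) (path \<omega>) n = (\<Sum>s<p. \<Sum>t<p. v $ t * (mat_inv info_mat $$ (t, s) * unit_score \<omega> s n))"
      unfolding score_unit_score[of "dual v"] by (simp add: sum_distrib_right mult.assoc)
    also have "\<dots> = (\<Sum>t<p. \<Sum>s<p. v $ t * (mat_inv info_mat $$ (t, s) * unit_score \<omega> s n))" by (rule sum.swap)
    finally have 2: "score (dual v) (path \<omega>) n / lil_scale n = (\<Sum>t<p. \<Sum>s<p. v $ t * (mat_inv info_mat $$ (t, s) * (unit_score \<omega> s n / lil_scale n)))"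
      by (simp add: sum_divide_distrib)
    show ?case unfolding elim(2) 1 2 sum_subtractf[symmetric]
      by (intro sum.cong refl) (simp add: algebra_simps)
  qed
  from Lim_transform_eventually[OF lim this] show ?thesis .
qed

lemma info_commute: "info a b = info b a"
  by (simp add: info_def mult.commute)

text \<open>As I is symmetric, with y = I^{-1} v the limiting variance y^* I y collapses to v^*
  I^{-1} v.\<close>

lemma info_form_dual:
  assumes v: "v \<in> carrier_vec p"
  shows "info_form (dual v) = v \<bullet> (mat_inv (asymptotic_info \<theta>) *\<^sub>v v)"
proof -
  note inv = mat_inv_props[OF info_mat_carrier det_info]
  have J: "(\<Sum>b<p. info a b * dual v b) = v $ a" if a: "a < p" for a
  proof -
    have "(\<Sum>b<p. info a b * dual v b) = (\<Sum>t<p. \<Sum>b<p. v $ t * (mat_inv info_mat $$ (t, b) * info b a))"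
      by (subst sum.swap) (simp add: sum_distrib_left mult_ac info_commute[of a])
    also have "\<dots> = (\<Sum>t<p. v $ t * (if t = a then 1 else 0))"
    proof (rule sum.cong)
      fix t assume "t \<in> {..<p}"
      then have t: "t < p" by simp
      have "(\<Sum>b<p. mat_inv info_mat $$ (t, b) * info b a) = (mat_inv info_mat * info_mat) $$ (t, a)"
        unfolding mult_mat_entry[OF inv(1) info_mat_carrier t a] by (rule sum.cong) (use a in \<open>auto simp: info_mat_def\<close>)
      also have "\<dots> = (if t = a then 1 else 0)" unfolding inv(3) using t a by simp
      finally show "(\<Sum>b<p. v $ t * (mat_inv info_mat $$ (t, b) * info b a)) = v $ t * (if t = a then 1 else 0)"
        by (simp add: sum_distrib_left[symmetric])
    qed simp
    also have "\<dots> = v $ a" using a by (simp add: sum.delta if_distrib cong: if_cong)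
    finally show ?thesis .
  qed
  have "info_form (dual v) = (\<Sum>a<p. dual v a * (\<Sum>b<p. info a b * dual v b))"
    by (simp add: info_form_def sum_distrib_left mult.assoc)
  also have "\<dots> = (\<Sum>a<p. dual v a * v $ a)" by (rule sum.cong) (auto simp: J)
  also have "\<dots> = (\<Sum>t<p. v $ t * (\<Sum>a<p. mat_inv info_mat $$ (t, a) * v $ a))"
    unfolding sum_distrib_left sum_distrib_right by (subst sum.swap) (simp only: mult_ac)
  also have "\<dots> = (\<Sum>t<p. v $ t * (mat_inv info_mat *\<^sub>v v) $ t)"
    by (rule sum.cong) (auto simp: mult_mat_vec_entry[OF inv(1) v])
  also have "\<dots> = v \<bullet> (mat_inv info_mat *\<^sub>v v)"
    using mult_mat_vec_carrier[OF inv(1) v] by (rule scalar_prod_sum[symmetric])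
  finally show ?thesis by (simp add: asymptotic_info_eq)
qed

lemma score_uminus: "score (\<lambda>s. - y s) e n = - score y e n"
  by (simp add: score_def score_coeff_def sum_negf)

lemma info_form_uminus: "info_form (\<lambda>s. - y s) = info_form y"
  by (simp add: info_form_def)

abbreviation scaled_error :: "real Matrix.vec \<Rightarrow> 'a \<Rightarrow> nat \<Rightarrow> real" where
  "scaled_error v \<omega> n \<equiv> sqrt (real n / (2 * ln (ln (real n)))) * (v \<bullet> err \<omega> n)"

lemma scaled_error_lil:
  assumes v: "v \<in> carrier_vec p"
  defines "s \<equiv> sqrt (v \<bullet> (mat_inv (asymptotic_info \<theta>) *\<^sub>v v))"
  shows "AE \<omega> in M. \<forall>\<delta>>0. (\<forall>\<^sub>F n in sequentially. \<bar>scaled_error v \<omega> n\<bar> \<le> s + \<delta>)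
    \<and> (\<exists>\<^sub>F n in sequentially. s - \<delta> \<le> scaled_error v \<omega> n) \<and> (\<exists>\<^sub>F n in sequentially. s - \<delta> \<le> - scaled_error v \<omega> n)"
proof -
  have s: "s = sqrt (info_form (dual v))" unfolding s_def info_form_dual[OF v] ..
  \<comment> \<open>The lower half in the opposite direction, which yields the liminf.\<close>
  have "AE \<omega> in M. \<forall>\<delta>>0. \<exists>\<^sub>F n in sequentially. (s - \<delta>) * lil_scale n \<le> - score (dual v) (path \<omega>) n"
    using score_lower[of "\<lambda>s. - dual v s"] by (simp add: score_uminus info_form_uminus s)
  with score_upper[of "dual v"] score_lower[of "dual v"] AE_good_path show ?thesis
  proof eventually_elim
    case (elim \<omega>)
    have lim: "(\<lambda>n. scaled_error v \<omega> n - score (dual v) (path \<omega>) n / lil_scale n) \<longlonglongrightarrow> 0"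
      by (rule error_expansion[OF elim(3) v])
    show ?case
    proof (intro allI impI)
      fix \<delta> :: real assume "\<delta> > 0"
      then have d: "\<delta> / 2 > 0" by simp
      have "\<forall>\<^sub>F n in sequentially. \<bar>scaled_error v \<omega> n - score (dual v) (path \<omega>) n / lil_scale n\<bar> < \<delta> / 2"
        using tendstoD[OF lim d] by (simp add: dist_real_def)
      then have ev: "\<forall>\<^sub>F n in sequentially. \<bar>scaled_error v \<omega> n - score (dual v) (path \<omega>) n / lil_scale n\<bar> < \<delta> / 2 \<and> lil_scale n > 0"
        using lil_scale_pos_ev by eventually_elim simp
      show "(\<forall>\<^sub>F n in sequentially. \<bar>scaled_error v \<omega> n\<bar> \<le> s + \<delta>)
        \<and> (\<exists>\<^sub>F n in sequentially. s - \<delta> \<le> scaled_error v \<omega> n) \<and> (\<exists>\<^sub>F n in sequentially. s - \<delta> \<le> - scaled_error v \<omega> n)"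
      proof (intro conjI)
        show "\<forall>\<^sub>F n in sequentially. \<bar>scaled_error v \<omega> n\<bar> \<le> s + \<delta>"
          using ev elim(1)[rule_format, OF d]
        proof eventually_elim
          case (elim n)
          then have "\<bar>score (dual v) (path \<omega>) n / lil_scale n\<bar> \<le> s + \<delta> / 2" by (simp add: s divide_le_eq)
          then show ?case using elim by linarith
        qed
        have "\<forall>\<^sub>F n in sequentially. (s - \<delta> / 2) * lil_scale n \<le> score (dual v) (path \<omega>) n \<longrightarrow> s - \<delta> \<le> scaled_error v \<omega> n"
          using ev
        proof eventually_elim
          case (elim n)
          show ?case
          proof
            assume "(s - \<delta> / 2) * lil_scale n \<le> score (dual v) (path \<omega>) n"
            then have "s - \<delta> / 2 \<le> score (dual v) (path \<omega>) n / lil_scale n" using elim by (simp add: le_divide_eq)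
            then show "s - \<delta> \<le> scaled_error v \<omega> n" using elim by linarith
          qed
        qed
        with elim(2)[rule_format, OF d] show "\<exists>\<^sub>F n in sequentially. s - \<delta> \<le> scaled_error v \<omega> n"
          unfolding s[symmetric] by (rule frequently_rev_mp)
        have "\<forall>\<^sub>F n in sequentially. (s - \<delta> / 2) * lil_scale n \<le> - score (dual v) (path \<omega>) n \<longrightarrow> s - \<delta> \<le> - scaled_error v \<omega> n"
          using ev
        proof eventually_elim
          case (elim n)
          show ?case
          proof
            assume "(s - \<delta> / 2) * lil_scale n \<le> - score (dual v) (path \<omega>) n"
            then have "s - \<delta> / 2 \<le> - score (dual v) (path \<omega>) n / lil_scale n" using elim by (simp only: pos_le_divide_eq)
            then have "s - \<delta> / 2 \<le> - (score (dual v) (path \<omega>) n / lil_scale n)" by (simp only: minus_divide_left)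
            then show "s - \<delta> \<le> - scaled_error v \<omega> n" using elim by linarith
          qed
        qed
        with elim(4)[rule_format, OF d] show "\<exists>\<^sub>F n in sequentially. s - \<delta> \<le> - scaled_error v \<omega> n"
          by (rule frequently_rev_mp)
      qed
    qed
  qed
qed

lemma mle_limsup_liminf:
  assumes v: "v \<in> carrier_vec p"
  shows "AE \<omega> in M. limsup (\<lambda>n. ereal (scaled_error v \<omega> n)) = ereal (sqrt (v \<bullet> (mat_inv (asymptotic_info \<theta>) *\<^sub>v v)))
    \<and> - liminf (\<lambda>n. ereal (scaled_error v \<omega> n)) = ereal (sqrt (v \<bullet> (mat_inv (asymptotic_info \<theta>) *\<^sub>v v)))"
  using scaled_error_lil[OF v]
proof eventually_elim
  case (elim \<omega>)
  let ?s = "sqrt (v \<bullet> (mat_inv (asymptotic_info \<theta>) *\<^sub>v v))"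
  have up: "\<forall>\<^sub>F n in sequentially. \<bar>scaled_error v \<omega> n\<bar> \<le> ?s + \<delta>" if "\<delta> > 0" for \<delta> using elim that by blast
  have 1: "limsup (\<lambda>n. ereal (scaled_error v \<omega> n)) = ereal ?s"
  proof (rule limsup_eqI)
    fix \<delta> :: real assume \<delta>: "\<delta> > 0"
    show "\<forall>\<^sub>F n in sequentially. scaled_error v \<omega> n \<le> ?s + \<delta>"
      by (rule eventually_mono[OF up[OF \<delta>]]) (rule abs_le_D1)
    show "\<exists>\<^sub>F n in sequentially. ?s - \<delta> \<le> scaled_error v \<omega> n" using elim \<delta> by blast
  qed
  have 2: "limsup (\<lambda>n. ereal (- scaled_error v \<omega> n)) = ereal ?s"
  proof (rule limsup_eqI)
    fix \<delta> :: real assume \<delta>: "\<delta> > 0"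
    show "\<forall>\<^sub>F n in sequentially. - scaled_error v \<omega> n \<le> ?s + \<delta>"
      by (rule eventually_mono[OF up[OF \<delta>]]) (rule abs_le_D2)
    show "\<exists>\<^sub>F n in sequentially. ?s - \<delta> \<le> - scaled_error v \<omega> n" using elim \<delta> by blast
  qed
  have "limsup (\<lambda>n. ereal (- scaled_error v \<omega> n)) = - liminf (\<lambda>n. ereal (scaled_error v \<omega> n))"
    using ereal_Limsup_uminus[of sequentially "\<lambda>n. ereal (scaled_error v \<omega> n)"] by simp
  then show ?case using 1 2 by simp
qed

text \<open>Taking the unit vectors for v bounds each coordinate, and the p almost sure events
  intersect in one.\<close>

lemma mle_norm_rate:
  "AE \<omega> in M. (\<lambda>n. (vec_euclid_norm (err \<omega> n))\<^sup>2) \<in> O(\<lambda>n. ln (ln (real n)) / real n)"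
proof -
  let ?s = "\<lambda>t. sqrt (unit_vec p t \<bullet> (mat_inv (asymptotic_info \<theta>) *\<^sub>v unit_vec p t))"
  have "AE \<omega> in M. \<forall>t\<in>{..<p}. \<forall>\<^sub>F n in sequentially. \<bar>scaled_error (unit_vec p t) \<omega> n\<bar> \<le> ?s t + 1"
  proof (rule AE_finite_allI)
    fix t assume "t \<in> {..<p}"
    show "AE \<omega> in M. \<forall>\<^sub>F n in sequentially. \<bar>scaled_error (unit_vec p t) \<omega> n\<bar> \<le> ?s t + 1"
      using scaled_error_lil[of "unit_vec p t"] by (rule AE_mp) (auto intro!: AE_I2)
  qed simp
  with AE_good_path show ?thesis
  proof eventually_elim
    case (elim \<omega>)
    \<comment> \<open>The factor 2 undoes the normalisation by 2 ln ln n; the 1 added keeps C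
      positive, as the O-bound requires.\<close>
    define C where "C = (\<Sum>t<p. 2 * (?s t + 1)\<^sup>2) + 1"
    have "\<forall>\<^sub>F n in sequentially. \<forall>t\<in>{..<p}. \<bar>scaled_error (unit_vec p t) \<omega> n\<bar> \<le> ?s t + 1"
      using elim(2) by (subst eventually_ball_finite_distrib) auto
    moreover have "\<forall>\<^sub>F n in sequentially. ln (ln (real n)) > 0" by real_asymp
    ultimately have "\<forall>\<^sub>F n in sequentially. norm ((vec_euclid_norm (err \<omega> n))\<^sup>2) \<le> C * norm (ln (ln (real n)) / real n)"
      using nm_det[OF elim(1)]
    proof eventually_elim
      case (elim n)
      have e: "err \<omega> n \<in> carrier_vec p" using mle_error(1)[OF \<open>good_path \<omega>\<close>] elim by auto
      let ?L = "ln (ln (real n))"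
      have pos: "real n / (2 * ?L) > 0" using elim by simp
      have et: "(err \<omega> n $ t)\<^sup>2 \<le> 2 * (?s t + 1)\<^sup>2 * (?L / real n)" if t: "t < p" for t
      proof -
        have u: "unit_vec p t \<bullet> err \<omega> n = err \<omega> n $ t" by (rule scalar_prod_left_unit[OF e t])
        have "\<bar>scaled_error (unit_vec p t) \<omega> n\<bar> \<le> ?s t + 1" using elim t by blast
        then have "\<bar>scaled_error (unit_vec p t) \<omega> n\<bar>\<^sup>2 \<le> (?s t + 1)\<^sup>2" by (rule power_mono) simp
        then have "real n / (2 * ?L) * (err \<omega> n $ t)\<^sup>2 \<le> (?s t + 1)\<^sup>2"
          unfolding u using pos by (simp add: power_mult_distrib)
        then show ?thesis using elim by (simp add: field_simps)
      qed
      have "(vec_euclid_norm (err \<omega> n))\<^sup>2 = (\<Sum>t<p. (err \<omega> n $ t)\<^sup>2)"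
      proof -
        have "err \<omega> n \<bullet> err \<omega> n = (\<Sum>t<p. (err \<omega> n $ t)\<^sup>2)"
          unfolding scalar_prod_sum[OF e] power2_eq_square ..
        then show ?thesis unfolding vec_euclid_norm_def by (simp add: sum_nonneg)
      qed
      also have "\<dots> \<le> (\<Sum>t<p. 2 * (?s t + 1)\<^sup>2 * (?L / real n))" by (intro sum_mono et) auto
      also have "\<dots> = (C - 1) * (?L / real n)" unfolding C_def by (simp only: sum_distrib_right add_diff_cancel_right')
      also have "\<dots> \<le> C * (?L / real n)" using elim by (intro mult_right_mono) auto
      finally show ?case using elim by simp
    qed
    then show ?case by (rule landau_o.bigI[rotated]) (auto simp: C_def intro!: add_nonneg_pos sum_nonneg)
  qed
qed

end

theorem proposition3p1:
  fixes p :: nat and \<theta> :: "real Matrix.vec"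
    and M :: "'a measure" and \<xi> :: "nat \<Rightarrow> 'a \<Rightarrow> real" and f\<^sub>\<xi> :: "real \<Rightarrow> real"
    and \<sigma> :: "nat \<Rightarrow> real" and \<epsilon> :: "nat \<Rightarrow> 'a \<Rightarrow> real" and k :: "nat \<Rightarrow> nat \<Rightarrow> real"
    and X :: "int \<Rightarrow> 'a \<Rightarrow> real"
    and \<alpha>\<^sub>1 \<alpha>\<^sub>2 :: real
  assumes "prob_space M"
    and "p \<ge> 1"
    and "\<theta> \<in> stable_params p"
    and "gaussian_process M \<xi>"
    and "centered_process M \<xi>"
    and "stationary_process M \<xi>"
    and "autocov M \<xi> 0 = 1"
    and "spectral_density (autocov M \<xi>) f\<^sub>\<xi>"
    and "innovations M \<xi> \<sigma> \<epsilon>"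
    and "innovation_coeffs M \<xi> \<sigma> \<epsilon> k"
    and "ar_model M \<xi> \<theta> X"
    and "\<alpha>\<^sub>1 > 0"
    and "autocov M \<xi> \<in> O(\<lambda>n. real n powr (- \<alpha>\<^sub>1))"
    and "(\<integral>\<^sup>+ x\<in>{-pi..pi}. abs_log (f\<^sub>\<xi> x) \<partial>lborel) < \<infinity>"
    and "\<alpha>\<^sub>2 > 1"
    and "(\<lambda>n. (pacf k n)\<^sup>2) \<in> O(\<lambda>n. real n powr (- \<alpha>\<^sub>2))"
  shows "(AE \<omega> in M. \<forall>\<^sub>F n in sequentially.
            invertible_mat (normal_matrix p k \<sigma> (\<lambda>i. X i \<omega>) n)) \<and>
         (\<forall>v\<in>carrier_vec p. AE \<omega> in M.
            limsup (\<lambda>n. ereal (sqrt (real n / (2 * ln (ln (real n)))) *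
                               scalar_prod v (mle p k \<sigma> (\<lambda>i. X i \<omega>) n - \<theta>)))
              = ereal (sqrt (scalar_prod v (mat_inv (asymptotic_info \<theta>) *\<^sub>v v))) \<and>
            - liminf (\<lambda>n. ereal (sqrt (real n / (2 * ln (ln (real n)))) *
                               scalar_prod v (mle p k \<sigma> (\<lambda>i. X i \<omega>) n - \<theta>)))
              = ereal (sqrt (scalar_prod v (mat_inv (asymptotic_info \<theta>) *\<^sub>v v)))) \<and>
         (AE \<omega> in M. (\<lambda>n. (vec_euclid_norm (mle p k \<sigma> (\<lambda>i. X i \<omega>) n - \<theta>))\<^sup>2)
            \<in> O(\<lambda>n. ln (ln (real n)) / real n))"
proof -
  interpret prob_space M by fact
  interpret ar_mle M \<xi> \<sigma> \<epsilon> k p \<theta> X \<alpha>\<^sub>2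
    by unfold_locales (use assms in \<open>auto simp: gaussian_process_def\<close>)
  have "AE \<omega> in M. \<forall>\<^sub>F n in sequentially. invertible_mat (normal_matrix p k \<sigma> (\<lambda>i. X i \<omega>) n)"
    using AE_good_path
  proof eventually_elim
    case (elim \<omega>)
    show ?case using nm_det[OF elim] by eventually_elim (use nm_carrier invertible_mat_of_det in blast)
  qed
  then show ?thesis using mle_limsup_liminf mle_norm_rate by blast
qed

end
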